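(* Let $l>0$, $T>0$, $0<\alpha<1$, and $Q_T=\{(x,t): 0<x<l,\ 0\le t\le T\}$. Let $p\in C([0,T])$ with $p(t)\ge 0$ for all $t$, and let $f\in C(\overline{Q}_T)$. Let $u(x,t)$ be a solution of the initial-boundary value problem $$\partial_t^{\alpha} u(x,t)-u_{xx}(x,t)+p(t)u(x,t)=f(x,t),\quad (x,t)\in Q_T,$$ $$u(x,0)=\varphi(x),\quad x\in[0,l],\qquad u(0,t)=0,\quad u(l,t)=0,\quad t\in[0,T].$$ Then $u$ satisfies the a priori estimate $$\|u(\cdot,t)\|_{L^2}^2\le \|\varphi\|_{L^2}^2+c\,\mathcal{D}_t^{-\alpha}\|f(\cdot,t)\|_{L^2}^2,\qquad t\in[0,T],\qquad c=\frac{l^2}{2\pi^2}.$$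
   Context: $\partial_t^\alpha$ is the Caputo fractional derivative in time of order $\alpha\in(0,1)$: $$\partial_t^\alpha u(x,t)=\frac{1}{\Gamma(1-\alpha)}\int_0^t\frac{u_s(x,s)}{(t-s)^\alpha}\,ds,$$ where $u_s$ is the derivative of $u$ in the time variable and $u(x,\cdot)$ is absolutely continuous on $[0,T]$. A solution is a function $u$ on $\overline{Q}_T$ such that $u(\cdot,t)\in C^2[0,l]$ for each $t$, and, for each $x$, $u(x,\cdot)\in C[0,T]$ with $\partial_t^\alpha u(x,\cdot)\in C[0,T]$ (the value at $t=0$ being understood by continuous extension), satisfying the equation, initial condition and boundary conditions. Notation: $\|\psi(\cdot,t)\|_{L^2}^2=\int_0^l|\psi(x,t)|^2\,dx$, and $\mathcal{D}_t^{-\alpha}$ is the Riemann–Liouville fractional integral: $$\mathcal{D}_t^{-\alpha}\|\psi(\cdot,t)\|_{L^2}^2=\frac{1}{\Gamma(\alpha)}\int_0^t\frac{\|\psi(\cdot,s)\|_{L^2}^2}{(t-s)^{1-\alpha}}\,ds.$$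
   Formalization: The formal theorem additionally assumes that the Caputo derivative of u is square integrable over Q_T; with regularity only separately in x and t the estimate fails, as a nonzero solution with p = f = φ = 0, singular at the corner (0,0), shows. *)

theory Defs
  imports "HOL-Analysis.Analysis"
begin

definition abs_continuous_on :: "real \<Rightarrow> real \<Rightarrow> (real \<Rightarrow> real) \<Rightarrow> bool" where
  "abs_continuous_on a b v \<longleftrightarrow>
     (\<forall>\<epsilon>>0. \<exists>\<delta>>0. \<forall>(n::nat) x y.
        (\<forall>i<n. a \<le> x i \<and> x i \<le> y i \<and> y i \<le> b) \<longrightarrow>
        pairwise (\<lambda>i j. {x i<..<y i} \<inter> {x j<..<y j} = {}) {..<n} \<longrightarrow>
        (\<Sum>i<n. y i - x i) < \<delta> \<longrightarrow>
        (\<Sum>i<n. \<bar>v (y i) - v (x i)\<bar>) < \<epsilon>)"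

text \<open>One-sided derivatives at the end points: \<open>v\<close> belongs to \<open>C\<^sup>2[a, b]\<close>.\<close>

definition C2_on :: "real \<Rightarrow> real \<Rightarrow> (real \<Rightarrow> real) \<Rightarrow> bool" where
  "C2_on a b v \<longleftrightarrow>
     (\<exists>v' v''. (\<forall>x\<in>{a..b}. (v has_real_derivative v' x) (at x within {a..b})) \<and>
               (\<forall>x\<in>{a..b}. (v' has_real_derivative v'' x) (at x within {a..b})) \<and>
               continuous_on {a..b} v'')"

text \<open>
  An absolutely continuous function is differentiable only almost everywhere. Elsewhere
  \<^const>\<open>deriv\<close> takes some unspecified value, which the integrals below do not see.
\<close>

definition caputo_integrand :: "real \<Rightarrow> (real \<Rightarrow> real) \<Rightarrow> real \<Rightarrow> real \<Rightarrow> real" where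
  "caputo_integrand \<alpha> v t s = deriv v s / (t - s) powr \<alpha>"

text \<open>The value at \<open>t = 0\<close> is the limit from the right, not the (empty) integral.\<close>

definition caputo :: "real \<Rightarrow> (real \<Rightarrow> real) \<Rightarrow> real \<Rightarrow> real" where
  "caputo \<alpha> v =
     (let D = (\<lambda>t. 1 / Gamma (1 - \<alpha>) * (LINT s:{0<..<t}|lborel. caputo_integrand \<alpha> v t s))
      in (\<lambda>t. if t = 0 then Lim (at_right 0) D else D t))"

text \<open>
  \<open>\<partial>\<^sub>t\<^sup>\<alpha> v \<in> C[0, T]\<close>: the defining integral converges for every \<open>t \<in> (0, T]\<close>, and the
  resulting function extends continuously to \<open>t = 0\<close>.
\<close>

definition caputo_continuous :: "real \<Rightarrow> real \<Rightarrow> (real \<Rightarrow> real) \<Rightarrow> bool" where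
  "caputo_continuous T \<alpha> v \<longleftrightarrow>
     (\<forall>t\<in>{0<..T}. set_integrable lborel {0<..<t} (caputo_integrand \<alpha> v t)) \<and>
     continuous_on {0..T} (caputo \<alpha> v)"

definition RL_integral :: "real \<Rightarrow> (real \<Rightarrow> real) \<Rightarrow> real \<Rightarrow> real" where
  "RL_integral \<alpha> h t =
     1 / Gamma \<alpha> * (LINT s:{0<..<t}|lborel. h s / (t - s) powr (1 - \<alpha>))"

definition L2_norm_sq :: "real \<Rightarrow> (real \<Rightarrow> real) \<Rightarrow> real" where
  "L2_norm_sq l \<psi> = (LINT x:{0..l}|lborel. \<bar>\<psi> x\<bar>\<^sup>2)"

definition Q :: "real \<Rightarrow> real \<Rightarrow> (real \<times> real) set" where
  "Q l T = {0<..<l} \<times> {0..T}"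

text \<open>
  The differential equation is imposed only for \<open>0 < x < l\<close>, where the two-sided second
  derivative is the derivative of the function given on \<open>[0, l]\<close>.
\<close>

definition is_solution ::
  "real \<Rightarrow> real \<Rightarrow> real \<Rightarrow> (real \<Rightarrow> real) \<Rightarrow> (real \<Rightarrow> real \<Rightarrow> real) \<Rightarrow> (real \<Rightarrow> real) \<Rightarrow>
   (real \<Rightarrow> real \<Rightarrow> real) \<Rightarrow> bool" where
  "is_solution l T \<alpha> p f \<phi> u \<longleftrightarrow>
     (\<forall>t\<in>{0..T}. C2_on 0 l (\<lambda>x. u x t)) \<and>
     (\<forall>x\<in>{0..l}. abs_continuous_on 0 T (u x) \<and> caputo_continuous T \<alpha> (u x)) \<and>
     (\<forall>(x, t)\<in>Q l T.
        caputo \<alpha> (u x) t - (deriv ^^ 2) (\<lambda>y. u y t) x + p t * u x t = f x t) \<and>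
     (\<forall>x\<in>{0..l}. u x 0 = \<phi> x) \<and>
     (\<forall>t\<in>{0..T}. u 0 t = 0 \<and> u l t = 0)"

text \<open>
  The regularity in \<^const>\<open>is_solution\<close> is separate in \<open>x\<close> and \<open>t\<close>, which is not enough for
  an energy estimate. Let \<open>S(x, \<sqdot>)\<close> have the Laplace transform \<open>exp (- x s powr (\<alpha>/2))\<close>
  (a one-sided stable density for \<open>x > 0\<close>, put \<open>S(0, \<sqdot>) = 0\<close>). Then
  \<open>u(x, t) = (\<Sum>k\<ge>0. S(x + 2 k l, t) - S(2 (k + 1) l - x, t))\<close> is a nonzero solution with
  \<open>p = 0\<close>, \<open>f = 0\<close>, \<open>\<phi> = 0\<close>: it is unbounded near the corner \<open>(0, 0)\<close>, and yet continuous
  along every line parallel to an axis. The following condition excludes such solutions. It holds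
  whenever \<open>\<partial>\<^sub>t\<^sup>\<alpha> u\<close> is continuous on the closure of \<^term>\<open>Q l T\<close>, or just bounded.
\<close>

definition caputo_square_integrable ::
  "real \<Rightarrow> real \<Rightarrow> real \<Rightarrow> (real \<Rightarrow> real \<Rightarrow> real) \<Rightarrow> bool" where
  "caputo_square_integrable l T \<alpha> u \<longleftrightarrow>
     set_integrable lborel (Q l T) (\<lambda>(x, t). (caputo \<alpha> (u x) t)\<^sup>2)"

end

theory Submission
  imports Defs
begin

text \<open>
  Write \<open>g = \<partial>\<^sub>t\<^sup>\<alpha> u\<close>. For fixed \<open>x\<close> absolute continuity gives \<open>u(x, t) - \<phi>(x) = I\<^sup>\<alpha> g(x, t)\<close>, and the
  pointwise inequality of Alikhanov, \<open>v \<partial>\<^sub>t\<^sup>\<alpha> v \<ge> \<partial>\<^sub>t\<^sup>\<alpha> (v\<^sup>2) / 2\<close>, becomes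
  \<open>(u\<^sup>2 - \<phi>\<^sup>2) / 2 \<le> I\<^sup>\<alpha> (u g)\<close> after applying \<open>I\<^sup>\<alpha>\<close>. For fixed \<open>t\<close> the equation, Wirtinger's inequality with the
  optimal constant \<open>(pi / l)\<^sup>2\<close> and Young's inequality bound the integral of \<open>u g\<close> over \<open>(0, l)\<close> by
  \<open>l\<^sup>2 / (4 pi\<^sup>2)\<close> times the squared norm of \<open>f\<close>. The two are combined by Fubini's theorem. Square integrability
  of \<open>g\<close> carries over to \<open>u\<close>, so that \<open>(t - s) powr (\<alpha> - 1) u g\<close> is integrable in \<open>(x, s)\<close> for almost every
  \<open>t\<close>; Fatou's lemma along \<open>t\<^sub>n \<up> t\<close> gives the estimate for the remaining \<open>t\<close>.
\<close>

section \<open>Differentiability of monotone and absolutely continuous functions\<close>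

text \<open>The assumed regularity of \<open>u\<close> shapes the proof. In time, \<open>u x\<close>
  is only absolutely continuous, so the Caputo integrand sees a genuine derivative only almost
  everywhere; recovering \<open>u x\<close> from it rests on Lebesgue's differentiation theorem and
  the fundamental theorem of calculus for absolutely continuous functions, both proved below. In the
  plane, \<open>u\<close> and \<open>g\<close> are regular along each axis separately: joint
  measurability comes from a Caratheodory argument, and exchanging the integrals has to be paid for
  by square integrability. Applying I^\<alpha> before integrating in \<open>x\<close> avoids
  differentiating the energy in time. The energy is not known to be continuous in time either; the
  lower semicontinuity that Fatou gives is enough. The constant: with c = pi / l, Young's inequality
  u f \<le> c^2 u^2 + f^2 / (4 c^2) spends exactly the c^2 u^2 that Wirtinger's inequality absorbs
  and leaves l^2 / (4 pi^2); the factor 1/2 at u^2 in Alikhanov's inequality doubles this to l^2 /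
  (2 pi^2).\<close>

lemma mono_sum_disjoint_intervals_le:
  fixes F :: "real \<Rightarrow> real" and u w :: "'i \<Rightarrow> real"
  assumes "mono F" "finite C" "a \<le> b"
    and "\<And>i. i \<in> C \<Longrightarrow> a \<le> u i \<and> u i \<le> w i \<and> w i \<le> b"
    and "pairwise (\<lambda>i j. disjnt {u i..w i} {u j..w j}) C"
  shows "(\<Sum>i\<in>C. F (w i) - F (u i)) \<le> F b - F a"
  using assms(2-)
\<comment> \<open>The inserted interval has the largest left end, so by disjointness all others end
  before it; the induction hypothesis is applied with \<open>u x\<close> in place of
  \<open>b\<close>.\<close>
proof (induction C arbitrary: b rule: finite_ranking_induct[where f = u])
  case empty
  then show ?case using \<open>mono F\<close> by (simp add: monoD)
next
  case (insert x C)
  show ?case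
  proof (cases "x \<in> C")
    case True
    then show ?thesis using insert.IH[of b] insert.prems by (simp add: insert_absorb)
  next
    case False
    have "w j \<le> u x" if "j \<in> C" for j
    proof (rule ccontr)
      assume "\<not> w j \<le> u x"
      with insert.hyps(2)[OF that] insert.prems(2)[of x] have "u x \<in> {u j..w j} \<inter> {u x..w x}" by auto
      moreover have "j \<noteq> x" using False that by auto
      ultimately show False
        using insert.prems(3) that by (auto simp: pairwise_insert disjnt_def)
    qed
    then have "(\<Sum>i\<in>C. F (w i) - F (u i)) \<le> F (u x) - F a"
      using insert.prems by (intro insert.IH) (auto simp: pairwise_insert)
    moreover have "F (w x) \<le> F b" using insert.prems \<open>mono F\<close> by (auto intro: monoD)
    ultimately show ?thesis using insert False by simp
  qed
qed

text \<open>In dimension one a closed interval is the closed ball about its midpoint, so Vitali's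
  theorem for balls applies. The covered point may sit anywhere in its interval, as difference
  quotients require.\<close>

lemma Vitali_covering_intervals:
  fixes S :: "real set" and K :: "(real \<times> real) set"
  assumes K: "\<And>u w. (u, w) \<in> K \<Longrightarrow> u < w"
    and S: "\<And>x d. x \<in> S \<Longrightarrow> 0 < d \<Longrightarrow> \<exists>u w. (u, w) \<in> K \<and> u \<le> x \<and> x \<le> w \<and> w - u < d"
  obtains C where "countable C" "C \<subseteq> K"
    "pairwise (\<lambda>i j. disjnt {fst i..snd i} {fst j..snd j}) C"
    "negligible (S - (\<Union>i\<in>C. {fst i..snd i}))"
proof -
  have *: "cball ((fst i + snd i) / 2) ((snd i - fst i) / 2) = {fst i..snd i}" for i :: "real \<times> real"
    by (auto simp: cball_eq_atLeastAtMost field_simps)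
  obtain C where "countable C" "C \<subseteq> K"
    "pairwise (\<lambda>i j. disjnt (cball ((fst i + snd i) / 2) ((snd i - fst i) / 2))
       (cball ((fst j + snd j) / 2) ((snd j - fst j) / 2))) C"
    "negligible (S - (\<Union>i\<in>C. cball ((fst i + snd i) / 2) ((snd i - fst i) / 2)))"
  proof (rule Vitali_covering_theorem_cballs[of K "\<lambda>i. (snd i - fst i) / 2" S "\<lambda>i. (fst i + snd i) / 2"])
    show "0 < (snd i - fst i) / 2" if "i \<in> K" for i
      using K[of "fst i" "snd i"] that by simp
    show "\<exists>i. i \<in> K \<and> x \<in> cball ((fst i + snd i) / 2) ((snd i - fst i) / 2) \<and> (snd i - fst i) / 2 < d"
      if x: "x \<in> S" "0 < d" for x d
    proof -
      obtain u w where "(u, w) \<in> K" "u \<le> x" "x \<le> w" "w - u < d" using S[OF x] by blast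
      then show ?thesis unfolding * using \<open>0 < d\<close> by (intro exI[of _ "(u, w)"]) auto
    qed
  qed
  then show thesis using that unfolding * by blast
qed

text \<open>Quotients are taken over intervals that contain \<open>x\<close>, possibly as an end
  point. Such intervals form Vitali covers directly, and this one notion with its lower counterpart
  replaces the four Dini derivatives.\<close>

definition upper_quotient_gt :: "(real \<Rightarrow> real) \<Rightarrow> real \<Rightarrow> real \<Rightarrow> bool" where
  "upper_quotient_gt F s x \<longleftrightarrow>
     (\<forall>d>0. \<exists>u w. u < w \<and> u \<le> x \<and> x \<le> w \<and> w - u < d \<and> s * (w - u) < F w - F u)"

definition lower_quotient_lt :: "(real \<Rightarrow> real) \<Rightarrow> real \<Rightarrow> real \<Rightarrow> bool" where
  "lower_quotient_lt F r x \<longleftrightarrow>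
     (\<forall>d>0. \<exists>u w. u < w \<and> u \<le> x \<and> x \<le> w \<and> w - u < d \<and> F w - F u < r * (w - u))"

lemma small_interval_in_open:
  fixes V :: "real set"
  assumes "open V" "x \<in> V"
  obtains e where "e > 0" "\<And>u w. u \<le> x \<Longrightarrow> x \<le> w \<Longrightarrow> w - u < e \<Longrightarrow> {u..w} \<subseteq> V"
proof -
  obtain e where e: "e > 0" "ball x e \<subseteq> V" using assms open_contains_ball by blast
  show thesis
  proof (rule that[OF e(1)])
    fix u w assume "u \<le> x" "x \<le> w" "w - u < e"
    then have "{u..w} \<subseteq> ball x e" by (auto simp: dist_real_def)
    with e show "{u..w} \<subseteq> V" by blast
  qed
qed

text \<open>In a disjoint Vitali selection of steep intervals, \<open>s\<close> times the total
  length is at most the total increment, hence at most \<open>B\<close>. The superset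
  \<open>T\<close> stands for outer measure, since \<open>A\<close> is not known to be measurable.
  \<open>B\<close> is left abstract: it is a global increment of \<open>F\<close> in one use and a
  bound inherited from another cover in the other.\<close>

lemma outer_measure_upper_quotient_le:
  fixes A V :: "real set"
  assumes "open V" "A \<subseteq> V" "s > 0"
    and A: "\<And>x. x \<in> A \<Longrightarrow> upper_quotient_gt F s x"
    and B: "\<And>D. finite D \<Longrightarrow> pairwise (\<lambda>i j. disjnt {fst i..snd i} {fst j..snd j}) D \<Longrightarrow>
              (\<And>i. i \<in> D \<Longrightarrow> fst i < snd i \<and> {fst i..snd i} \<subseteq> V) \<Longrightarrow>
              (\<Sum>i\<in>D. F (snd i) - F (fst i)) \<le> B"
  obtains T where "A \<subseteq> T" "T \<in> lmeasurable" "measure lebesgue T \<le> B / s"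
proof -
  define K where "K = {(u, w). u < w \<and> {u..w} \<subseteq> V \<and> s * (w - u) < F w - F u}"
  obtain C where C: "countable C" "C \<subseteq> K"
    "pairwise (\<lambda>i j. disjnt {fst i..snd i} {fst j..snd j}) C"
    "negligible (A - (\<Union>i\<in>C. {fst i..snd i}))"
  proof (rule Vitali_covering_intervals[of K A])
    show "u < w" if "(u, w) \<in> K" for u w using that by (simp add: K_def)
    show "\<exists>u w. (u, w) \<in> K \<and> u \<le> x \<and> x \<le> w \<and> w - u < d" if x: "x \<in> A" "0 < d" for x d
    proof -
      obtain e where e: "e > 0" "\<And>u w. u \<le> x \<Longrightarrow> x \<le> w \<Longrightarrow> w - u < e \<Longrightarrow> {u..w} \<subseteq> V"
        using small_interval_in_open[of V x] assms x by blast
      have "min d e > 0" using x e by simp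
      then obtain u w where "u < w" "u \<le> x" "x \<le> w" "w - u < min d e" "s * (w - u) < F w - F u"
        using A[OF x(1)] unfolding upper_quotient_gt_def by blast
      then show ?thesis using e(2)[of u w] by (intro exI[of _ u] exI[of _ w]) (auto simp: K_def)
    qed
  qed
  let ?U = "\<Union>i\<in>C. {fst i..snd i}"
  have fin: "measure lebesgue (\<Union>i\<in>D. {fst i..snd i}) \<le> B / s" if D: "finite D" "D \<subseteq> C" for D
  proof -
    have DK: "fst i < snd i \<and> {fst i..snd i} \<subseteq> V \<and> s * (snd i - fst i) < F (snd i) - F (fst i)" if "i \<in> D" for i
      using subsetD[OF C(2), of i] that D by (auto simp: K_def case_prod_beta)
    have "measure lebesgue (\<Union>i\<in>D. {fst i..snd i}) \<le> (\<Sum>i\<in>D. measure lebesgue {fst i..snd i})"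
      using D by (intro measure_UNION_le) auto
    also have "\<dots> = (\<Sum>i\<in>D. snd i - fst i)"
      by (intro sum.cong) (use DK in \<open>auto simp: less_imp_le\<close>)
    also have "\<dots> \<le> (\<Sum>i\<in>D. (F (snd i) - F (fst i)) / s)"
      by (intro sum_mono) (use DK \<open>s > 0\<close> in \<open>auto simp: field_simps less_imp_le\<close>)
    also have "\<dots> = (\<Sum>i\<in>D. F (snd i) - F (fst i)) / s" by (simp add: sum_divide_distrib)
    also have "\<dots> \<le> B / s"
      using DK D C(3) \<open>s > 0\<close> by (intro divide_right_mono B) (auto intro: pairwise_subset)
    finally show ?thesis .
  qed
  have U: "?U \<in> lmeasurable \<and> measure lebesgue ?U \<le> B / s"
  proof (cases "C = {}")
    case True
    then show ?thesis using fin[of "{}"] by simp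
  next
    case False
    then obtain f :: "nat \<Rightarrow> real \<times> real" where f: "C = range f"
      using \<open>countable C\<close> by (metis uncountable_def)
    have "measure lebesgue (\<Union>k\<le>n. {fst (f k)..snd (f k)}) \<le> B / s" for n
      using fin[of "f ` {..n}"] f by auto
    then have "(\<Union>k. {fst (f k)..snd (f k)}) \<in> lmeasurable"
        "measure lebesgue (\<Union>k. {fst (f k)..snd (f k)}) \<le> B / s"
      by (intro fmeasurable_countable_Union measure_countable_Union_le; auto)+
    then show ?thesis using f by simp
  qed
  show thesis
  proof (rule that[of "?U \<union> (A - ?U)"])
    have N: "A - ?U \<in> lmeasurable" "measure lebesgue (A - ?U) = 0"
      using C(4) by (auto intro: negligible_imp_measurable negligible_imp_measure0)
    then show "?U \<union> (A - ?U) \<in> lmeasurable" using U by blast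
    have "measure lebesgue (?U \<union> (A - ?U)) \<le> measure lebesgue ?U + measure lebesgue (A - ?U)"
      by (intro measure_Un_le) (use U N in \<open>auto\<close>)
    then show "measure lebesgue (?U \<union> (A - ?U)) \<le> B / s" using U N by linarith
  qed auto
qed

text \<open>Cover \<open>A\<close> by disjoint intervals of slope below \<open>r\<close>, then cover it again, inside those, by disjoint
  intervals of slope above \<open>s\<close>. Monotonicity bounds the increments over the second family by those over
  the first one.\<close>

lemma outer_measure_quotients_le:
  fixes A U :: "real set"
  assumes "mono F" "open U" "U \<in> lmeasurable" "A \<subseteq> U" "0 < r" "0 < s"
    and hi: "\<And>x. x \<in> A \<Longrightarrow> upper_quotient_gt F s x"
    and lo: "\<And>x. x \<in> A \<Longrightarrow> lower_quotient_lt F r x"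
  obtains T where "A \<subseteq> T" "T \<in> lmeasurable" "measure lebesgue T \<le> r / s * measure lebesgue U"
proof -
  define K where "K = {(u, w). u < w \<and> {u..w} \<subseteq> U \<and> F w - F u < r * (w - u)}"
  obtain C where C: "countable C" "C \<subseteq> K"
    "pairwise (\<lambda>i j. disjnt {fst i..snd i} {fst j..snd j}) C"
    "negligible (A - (\<Union>i\<in>C. {fst i..snd i}))"
  proof (rule Vitali_covering_intervals[of K A])
    show "u < w" if "(u, w) \<in> K" for u w using that by (simp add: K_def)
    show "\<exists>u w. (u, w) \<in> K \<and> u \<le> x \<and> x \<le> w \<and> w - u < d" if x: "x \<in> A" "0 < d" for x d
    proof -
      obtain e where e: "e > 0" "\<And>u w. u \<le> x \<Longrightarrow> x \<le> w \<Longrightarrow> w - u < e \<Longrightarrow> {u..w} \<subseteq> U"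
        using small_interval_in_open[of U x] assms x by blast
      have "min d e > 0" using x e by simp
      then obtain u w where "u < w" "u \<le> x" "x \<le> w" "w - u < min d e" "F w - F u < r * (w - u)"
        using lo[OF x(1)] unfolding lower_quotient_lt_def by blast
      then show ?thesis using e(2)[of u w] by (intro exI[of _ u] exI[of _ w]) (auto simp: K_def)
    qed
  qed
  have CK: "fst i < snd i" "{fst i..snd i} \<subseteq> U" "F (snd i) - F (fst i) < r * (snd i - fst i)"
    if "i \<in> C" for i
    using subsetD[OF C(2) that] by (auto simp: K_def case_prod_beta)
  \<comment> \<open>Open intervals make \<open>V\<close> open, as the second covering requires; only
    the countably many end points are lost.\<close>
  define V where "V = (\<Union>i\<in>C. {fst i<..<snd i})"
  \<comment> \<open>A segment in \<open>V\<close> cannot pass from one interval to another: the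
    right end of the first would lie in a second one, although their closures are disjoint.\<close>
  have inside: "\<exists>i\<in>C. u \<in> {fst i<..<snd i} \<and> w \<in> {fst i<..<snd i}"
    if uw: "{u..w} \<subseteq> V" "u < w" for u w
  proof -
    obtain i where i: "i \<in> C" "u \<in> {fst i<..<snd i}" using uw by (force simp: V_def)
    have "w < snd i"
    proof (rule ccontr)
      assume "\<not> w < snd i"
      then have "snd i \<in> {u..w}" using i by auto
      with uw obtain j where j: "j \<in> C" "snd i \<in> {fst j<..<snd j}" by (force simp: V_def)
      then have "i \<noteq> j" by auto
      with C(3) i j have "disjnt {fst i..snd i} {fst j..snd j}" by (simp add: pairwise_def)
      then show False using j CK(1)[OF i(1)] by (auto simp: disjnt_def)
    qed
    then show ?thesis using i uw by auto
  qed
  have sumC: "(\<Sum>i\<in>D. F (snd i) - F (fst i)) \<le> r * measure lebesgue U"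
    if D: "finite D" "D \<subseteq> C" for D
  proof -
    have "(\<Sum>i\<in>D. F (snd i) - F (fst i)) \<le> (\<Sum>i\<in>D. r * (snd i - fst i))"
      using D CK by (intro sum_mono) (auto intro!: less_imp_le)
    also have "\<dots> = r * (\<Sum>i\<in>D. measure lebesgue {fst i..snd i})"
    proof -
      have "snd i - fst i = measure lebesgue {fst i..snd i}" if "i \<in> D" for i
        using CK(1)[of i] D that by auto
      then show ?thesis by (simp add: sum_distrib_left)
    qed
    also have "(\<Sum>i\<in>D. measure lebesgue {fst i..snd i}) = measure lebesgue (\<Union>i\<in>D. {fst i..snd i})"
      using D C(3)
      by (intro measure_UNION'[symmetric]) (auto intro: pairwise_subset)
    also have "measure lebesgue (\<Union>i\<in>D. {fst i..snd i}) \<le> measure lebesgue U"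
    proof -
      have "(\<Union>i\<in>D. {fst i..snd i}) \<subseteq> U" using D CK(2) by blast
      then show ?thesis
        using D \<open>U \<in> lmeasurable\<close> by (intro measure_mono_fmeasurable) auto
    qed
    finally show ?thesis using \<open>r > 0\<close> by simp
  qed
  have "open V" unfolding V_def by auto
  obtain T where T: "A \<inter> V \<subseteq> T" "T \<in> lmeasurable" "measure lebesgue T \<le> r * measure lebesgue U / s"
  proof (rule outer_measure_upper_quotient_le[OF \<open>open V\<close>, of "A \<inter> V" s F "r * measure lebesgue U"])
    fix D :: "(real \<times> real) set"
    assume D: "finite D" "pairwise (\<lambda>i j. disjnt {fst i..snd i} {fst j..snd j}) D"
      "\<And>i. i \<in> D \<Longrightarrow> fst i < snd i \<and> {fst i..snd i} \<subseteq> V"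
    have "\<forall>j\<in>D. \<exists>i. i \<in> C \<and> fst j \<in> {fst i<..<snd i} \<and> snd j \<in> {fst i<..<snd i}"
      using inside D(3) by blast
    then obtain \<pi> where \<pi>: "\<And>j. j \<in> D \<Longrightarrow> \<pi> j \<in> C"
      "\<And>j. j \<in> D \<Longrightarrow> fst j \<in> {fst (\<pi> j)<..<snd (\<pi> j)} \<and> snd j \<in> {fst (\<pi> j)<..<snd (\<pi> j)}"
      by metis
    \<comment> \<open>Group the steep intervals by the flat interval \<open>\<pi> j\<close> around
      them; within each group monotonicity of \<open>F\<close> bounds the sum.\<close>
    have "(\<Sum>j\<in>D. F (snd j) - F (fst j)) = (\<Sum>i\<in>\<pi> ` D. \<Sum>j\<in>{j\<in>D. \<pi> j = i}. F (snd j) - F (fst j))"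
      using D(1) by (rule sum.image_gen)
    also have "\<dots> \<le> (\<Sum>i\<in>\<pi> ` D. F (snd i) - F (fst i))"
    proof (intro sum_mono mono_sum_disjoint_intervals_le[OF \<open>mono F\<close>])
      fix i assume "i \<in> \<pi> ` D"
      then show "fst i \<le> snd i" using CK(1) \<pi>(1) by (auto intro: less_imp_le)
      show "pairwise (\<lambda>i j. disjnt {fst i..snd i} {fst j..snd j}) {j \<in> D. \<pi> j = i}"
        using D(2) by (rule pairwise_subset) auto
      show "fst i \<le> fst j \<and> fst j \<le> snd j \<and> snd j \<le> snd i" if "j \<in> {j \<in> D. \<pi> j = i}" for j
        using that \<pi>(2)[of j] D(3)[of j] by auto
    qed (use D in auto)
    also have "\<dots> \<le> r * measure lebesgue U" using D \<pi>(1) by (intro sumC) auto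
    finally show "(\<Sum>j\<in>D. F (snd j) - F (fst j)) \<le> r * measure lebesgue U" .
  qed (use assms in auto)
  have "negligible (A - V)"
  proof (rule negligible_subset)
    show "A - V \<subseteq> (A - (\<Union>i\<in>C. {fst i..snd i})) \<union> (fst ` C \<union> snd ` C)"
      by (force simp: V_def)
    show "negligible ((A - (\<Union>i\<in>C. {fst i..snd i})) \<union> (fst ` C \<union> snd ` C))"
      using C by (intro negligible_Un)
        (auto simp: negligible_iff_null_sets intro!: null_sets_completionI countable_imp_null_set_lborel)
  qed
  then have N: "A - V \<in> lmeasurable" "measure lebesgue (A - V) = 0"
    by (auto intro: negligible_imp_measurable negligible_imp_measure0)
  show thesis
  proof (rule that[of "T \<union> (A - V)"])
    have "measure lebesgue (T \<union> (A - V)) \<le> measure lebesgue T + measure lebesgue (A - V)"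
      using T N by (intro measure_Un_le) auto
    then show "measure lebesgue (T \<union> (A - V)) \<le> r / s * measure lebesgue U" using T N by simp
  qed (use T N in auto)
qed

text \<open>Let \<open>m\<close> be the outer measure of a bounded piece. The preceding estimate,
  applied in open sets approximating a measurable cover, gives m \<le> (r / s) m, and r < s forces m
  = 0.\<close>

lemma negligible_lower_upper_quotients:
  assumes "mono F" "0 < r" "r < s"
  shows "negligible {x. lower_quotient_lt F r x \<and> upper_quotient_gt F s x}"
proof -
  have "negligible ({x. lower_quotient_lt F r x \<and> upper_quotient_gt F s x} \<inter> ball 0 n)" for n :: real
  proof -
    define A where "A = {x. lower_quotient_lt F r x \<and> upper_quotient_gt F s x} \<inter> ball 0 n"
    define M where "M = {measure lebesgue T |T. A \<subseteq> T \<and> T \<in> lmeasurable}"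
    define m where "m = Inf M"
    have "A \<subseteq> ball 0 n" by (auto simp: A_def)
    then have "measure lebesgue (ball 0 n :: real set) \<in> M"
      unfolding M_def using lmeasurable_ball by blast
    then have "M \<noteq> {}" by blast
    have "bdd_below M"
    proof (rule bdd_belowI)
      show "0 \<le> \<mu>" if "\<mu> \<in> M" for \<mu> using that unfolding M_def by force
    qed
    note M = \<open>M \<noteq> {}\<close> this
    have bound: "m \<le> r / s * \<mu>" if "\<mu> \<in> M" for \<mu>
    proof (rule field_le_epsilon)
      fix e :: real assume "e > 0"
      obtain T where T: "A \<subseteq> T" "T \<in> lmeasurable" "\<mu> = measure lebesgue T" using \<open>\<mu> \<in> M\<close> unfolding M_def by blast
      have "T \<in> sets lebesgue" using T by auto
      then obtain W where W: "open W" "T \<subseteq> W" "W - T \<in> lmeasurable" "emeasure lebesgue (W - T) < ennreal e"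
        using sets_lebesgue_outer_open[of T e] \<open>e > 0\<close> by auto
      have WT: "T \<union> (W - T) = W" using W by blast
      have Wm: "W \<in> lmeasurable" using fmeasurable.Un[OF T(2) W(3)] WT by simp
      have "measure lebesgue (W - T) < e"
        using W \<open>e > 0\<close> by (simp add: emeasure_eq_measure2 ennreal_less_iff)
      moreover have "measure lebesgue W \<le> measure lebesgue T + measure lebesgue (W - T)"
        using measure_Un_le[of T lebesgue "W - T"] T W(3) WT by auto
      ultimately have mW: "measure lebesgue W \<le> \<mu> + e" using T by simp
      obtain T' where T': "A \<subseteq> T'" "T' \<in> lmeasurable" "measure lebesgue T' \<le> r / s * measure lebesgue W"
      proof (rule outer_measure_quotients_le[OF \<open>mono F\<close> \<open>open W\<close> Wm])
        show "A \<subseteq> W" using T(1) W(2) by blast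
        show "upper_quotient_gt F s x" "lower_quotient_lt F r x" if "x \<in> A" for x
          using that by (auto simp: A_def)
      qed (use assms in auto)
      have "m \<le> measure lebesgue T'" unfolding m_def using M T' by (intro cInf_lower) (auto simp: M_def)
      also have "\<dots> \<le> r / s * (\<mu> + e)"
        using T'(3) mW assms by (meson order_trans mult_left_mono divide_nonneg_nonneg less_imp_le less_trans)
      also have "\<dots> \<le> r / s * \<mu> + 1 * e"
        using assms \<open>e > 0\<close> unfolding distrib_left by (intro add_left_mono mult_right_mono) auto
      finally show "m \<le> r / s * \<mu> + e" by simp
    qed
    have "m / (r / s) \<le> m"
      unfolding m_def
    proof (rule cInf_greatest[OF M(1)])
      show "Inf M / (r / s) \<le> \<mu>" if "\<mu> \<in> M" for \<mu>
        using bound[OF that] assms by (simp add: m_def field_simps)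
    qed
    then have "m * s \<le> m * r" using assms by (simp add: field_simps)
    then have "m \<le> 0" using \<open>r < s\<close> by (simp add: mult_le_cancel_left not_le)
    have "negligible A"
      unfolding negligible_outer_le
    proof (intro allI impI)
      fix e :: real assume "e > 0"
      then have "Inf M < e" using \<open>m \<le> 0\<close> by (simp add: m_def)
      then obtain \<mu> where "\<mu> \<in> M" "\<mu> < e" using M cInf_lessD by blast
      then show "\<exists>T. A \<subseteq> T \<and> T \<in> lmeasurable \<and> measure lebesgue T \<le> e"
        by (auto simp: M_def intro: less_imp_le)
    qed
    then show ?thesis by (simp add: A_def)
  qed
  then have "negligible (\<Union>n::nat. {x. lower_quotient_lt F r x \<and> upper_quotient_gt F s x} \<inter> ball 0 (real n))"
    by (intro negligible_countable_Union) auto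
  moreover have "(\<Union>n::nat. A \<inter> ball 0 (real n)) = A" for A :: "real set"
    by (auto simp: reals_Archimedean2)
  ultimately show ?thesis by simp
qed

text \<open>Slopes above \<open>B / e\<close> on a set inside an interval where \<open>F\<close>
  grows by less than \<open>B\<close> force the set to have outer measure at most
  \<open>e\<close>.\<close>

lemma negligible_unbounded_upper_quotients:
  assumes "mono F"
  shows "negligible {x. \<forall>s>0. upper_quotient_gt F s x}"
proof -
  have "negligible ({x. \<forall>s>0. upper_quotient_gt F s x} \<inter> ball 0 n)" (is "negligible ?A") if "n > 0" for n :: real
    unfolding negligible_outer_le
  proof (intro allI impI)
    fix e :: real assume "e > 0"
    \<comment> \<open>The summand 1 keeps \<open>B\<close>, and with it the slope
      \<open>B / e\<close>, positive when \<open>F\<close> is constant on the interval.\<close>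
    define B where "B = F n - F (- n) + 1"
    have "B > 0" using \<open>mono F\<close> \<open>n > 0\<close> monoD[of F "-n" n] by (simp add: B_def)
    obtain T where T: "?A \<subseteq> T" "T \<in> lmeasurable" "measure lebesgue T \<le> B / (B / e)"
    proof (rule outer_measure_upper_quotient_le[of "ball 0 n" ?A "B / e" F B])
      fix D :: "(real \<times> real) set"
      assume D: "finite D" "pairwise (\<lambda>i j. disjnt {fst i..snd i} {fst j..snd j}) D"
        "\<And>i. i \<in> D \<Longrightarrow> fst i < snd i \<and> {fst i..snd i} \<subseteq> ball 0 n"
      have "(\<Sum>i\<in>D. F (snd i) - F (fst i)) \<le> F n - F (- n)"
      proof (rule mono_sum_disjoint_intervals_le[OF \<open>mono F\<close> D(1) _ _ D(2)])
        show "- n \<le> fst i \<and> fst i \<le> snd i \<and> snd i \<le> n" if "i \<in> D" for i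
        proof -
          have "fst i \<in> ball 0 n" "snd i \<in> ball 0 n" using D(3)[OF that] by (auto simp: subset_iff)
          then show ?thesis using D(3)[OF that] by (auto simp: dist_real_def)
        qed
      qed (use \<open>n > 0\<close> in auto)
      then show "(\<Sum>i\<in>D. F (snd i) - F (fst i)) \<le> B" by (simp add: B_def)
    qed (use \<open>B > 0\<close> \<open>e > 0\<close> in auto)
    then show "\<exists>T. ?A \<subseteq> T \<and> T \<in> lmeasurable \<and> measure lebesgue T \<le> e"
      using \<open>B > 0\<close> \<open>e > 0\<close> by (intro exI[of _ T]) auto
  qed
  then have "negligible (\<Union>n::nat. {x. \<forall>s>0. upper_quotient_gt F s x} \<inter> ball 0 (real (Suc n)))"
    by (intro negligible_countable_Union) auto
  moreover have "(\<Union>n::nat. A \<inter> ball 0 (real (Suc n))) = A" for A :: "real set"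
  proof -
    have "\<exists>n. \<bar>x\<bar> < real (Suc n)" for x
    proof -
      obtain n where "\<bar>x\<bar> < real n" using reals_Archimedean2 by blast
      then show ?thesis by (intro exI[of _ n]) simp
    qed
    then show ?thesis by (auto simp del: of_nat_Suc)
  qed
  ultimately show ?thesis by simp
qed

text \<open>The derivative is \<open>D\<close>, the infimum of the slopes that are not exceeded
  arbitrarily close to \<open>x\<close>. Quotients above \<open>D\<close> are excluded by the choice
  of \<open>D\<close>, quotients below it by \<open>rs\<close>.\<close>

lemma differentiable_if_quotients:
  assumes "mono F" "s0 > 0" "\<not> upper_quotient_gt F s0 x"
    and rs: "\<And>r s. r \<in> \<rat> \<Longrightarrow> s \<in> \<rat> \<Longrightarrow> 0 < r \<Longrightarrow> r < s \<Longrightarrow> \<not> (lower_quotient_lt F r x \<and> upper_quotient_gt F s x)"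
  shows "F differentiable (at x)"
proof -
  define N where "N = {s. s \<ge> 0 \<and> \<not> upper_quotient_gt F s x}"
  define D where "D = Inf N"
  have "s0 \<in> N" using assms by (simp add: N_def)
  then have N: "N \<noteq> {}" "bdd_below N" by (auto simp: N_def intro!: bdd_belowI[of _ 0])
  have "D \<ge> 0" unfolding D_def using N by (intro cInf_greatest) (auto simp: N_def)
  have up: "\<not> upper_quotient_gt F s x" if "D < s" for s :: real
  proof -
    obtain s' where s': "s' \<in> N" "s' < s" using cInf_lessD[OF N(1)] \<open>D < s\<close> unfolding D_def by blast
    have "upper_quotient_gt F s' x" if "upper_quotient_gt F s x"
      unfolding upper_quotient_gt_def
    proof (intro allI impI)
      fix d :: real assume "0 < d"
      then obtain u w where "u < w" "u \<le> x" "x \<le> w" "w - u < d" "s * (w - u) < F w - F u"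
        using \<open>upper_quotient_gt F s x\<close> unfolding upper_quotient_gt_def by blast
      moreover from this have "s' * (w - u) < F w - F u"
        using mult_strict_right_mono[of s' s "w - u"] s' by linarith
      ultimately show "\<exists>u w. u < w \<and> u \<le> x \<and> x \<le> w \<and> w - u < d \<and> s' * (w - u) < F w - F u"
        by blast
    qed
    then show ?thesis using s' by (auto simp: N_def)
  qed
  have lo: "\<not> lower_quotient_lt F r x" if "r < D" for r :: real
  proof (cases "r > 0")
    case False
    have "F u \<le> F w" if "u < w" for u w using \<open>mono F\<close> that by (simp add: monoD)
    then have "r * (w - u) \<le> F w - F u" if "u < w" for u w
      using that False mult_nonpos_nonneg[of r "w - u"] by (simp add: order_trans)
    then show ?thesis unfolding lower_quotient_lt_def by (meson not_le zero_less_one)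
  next
    case True
    \<comment> \<open>Two rationals r' < s' are inserted between \<open>r\<close> and
      \<open>D\<close>, because \<open>rs\<close> speaks of rational pairs only; this keeps the
      exceptional set a countable union.\<close>
    obtain r' where r': "r' \<in> \<rat>" "r < r'" "r' < D" using Rats_dense_in_real[OF \<open>r < D\<close>] by blast
    obtain s' where s': "s' \<in> \<rat>" "r' < s'" "s' < D" using Rats_dense_in_real[OF r'(3)] by blast
    have "s' \<notin> N" using s' N cInf_lower[of s' N] by (auto simp: D_def)
    then have "upper_quotient_gt F s' x" using s' r' True by (auto simp: N_def)
    then have "\<not> lower_quotient_lt F r' x" using rs[of r' s'] r' s' True by auto
    moreover have "lower_quotient_lt F r' x" if "lower_quotient_lt F r x"
      unfolding lower_quotient_lt_def
    proof (intro allI impI)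
      fix d :: real assume "0 < d"
      then obtain u w where "u < w" "u \<le> x" "x \<le> w" "w - u < d" "F w - F u < r * (w - u)"
        using \<open>lower_quotient_lt F r x\<close> unfolding lower_quotient_lt_def by blast
      moreover from this have "F w - F u < r' * (w - u)"
        using mult_strict_right_mono[of r r' "w - u"] r' by linarith
      ultimately show "\<exists>u w. u < w \<and> u \<le> x \<and> x \<le> w \<and> w - u < d \<and> F w - F u < r' * (w - u)"
        by blast
    qed
    ultimately show ?thesis by blast
  qed
  have "((\<lambda>y. (F y - F x) / (y - x)) \<longlongrightarrow> D) (at x)"
  proof (rule tendstoI)
    fix e :: real assume "e > 0"
    obtain d1 where d1: "d1 > 0"
      "\<And>u w. u < w \<Longrightarrow> u \<le> x \<Longrightarrow> x \<le> w \<Longrightarrow> w - u < d1 \<Longrightarrow> F w - F u \<le> (D + e / 2) * (w - u)"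
      using up[of "D + e / 2"] \<open>e > 0\<close> unfolding upper_quotient_gt_def by (force simp: not_less)
    obtain d2 where d2: "d2 > 0"
      "\<And>u w. u < w \<Longrightarrow> u \<le> x \<Longrightarrow> x \<le> w \<Longrightarrow> w - u < d2 \<Longrightarrow> (D - e / 2) * (w - u) \<le> F w - F u"
      using lo[of "D - e / 2"] \<open>e > 0\<close> unfolding lower_quotient_lt_def by (force simp: not_less)
    show "\<forall>\<^sub>F y in at x. dist ((F y - F x) / (y - x)) D < e"
      unfolding eventually_at
    proof (intro exI[of _ "min d1 d2"] conjI ballI impI)
      fix y assume y: "y \<noteq> x \<and> dist y x < min d1 d2"
      have "(F y - F x) / (y - x) \<le> D + e / 2 \<and> D - e / 2 \<le> (F y - F x) / (y - x)"
      proof (cases "x < y")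
        case True
        then show ?thesis using d1(2)[of x y] d2(2)[of x y] y by (simp add: dist_real_def field_simps)
      next
        case False
        then have "y < x" using y by auto
        moreover have "(F y - F x) / (y - x) = (F x - F y) / (x - y)"
          by (metis minus_diff_eq minus_divide_divide)
        ultimately show ?thesis using d1(2)[of y x] d2(2)[of y x] y
          by (simp add: dist_real_def pos_divide_le_eq pos_le_divide_eq)
      qed
      then show "dist ((F y - F x) / (y - x)) D < e" using \<open>e > 0\<close> by (auto simp: dist_real_def abs_less_iff)
    qed (use d1 d2 in auto)
  qed
  then show ?thesis
    by (metis has_field_derivative_iff real_differentiable_def)
qed

text \<open>Lebesgue's theorem. A point of non-differentiability either has unbounded upper
  quotients or is caught by one of countably many rational pairs r < s.\<close>

theorem negligible_mono_not_differentiable: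
  fixes F :: "real \<Rightarrow> real"
  assumes "mono F"
  shows "negligible {x. \<not> F differentiable (at x)}"
proof (rule negligible_subset)
  let ?I = "{(r, s). r \<in> \<rat> \<and> s \<in> \<rat> \<and> 0 < r \<and> r < (s::real)}"
  let ?E = "\<Union>(r, s)\<in>?I. {x. lower_quotient_lt F r x \<and> upper_quotient_gt F s x}"
  have "countable ?I"
    by (rule countable_subset[of _ "\<rat> \<times> \<rat>"]) (auto intro: countable_rat)
  then show "negligible ({x. \<forall>s>0. upper_quotient_gt F s x} \<union> ?E)"
    using assms
    by (intro negligible_Un negligible_countable_Union negligible_unbounded_upper_quotients)
       (auto intro: negligible_lower_upper_quotients)
  show "{x. \<not> F differentiable (at x)} \<subseteq> {x. \<forall>s>0. upper_quotient_gt F s x} \<union> ?E"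
      proof
    fix x assume "x \<in> {x. \<not> F differentiable (at x)}"
    then show "x \<in> {x. \<forall>s>0. upper_quotient_gt F s x} \<union> ?E"
      using differentiable_if_quotients[OF assms, of _ x] by blast
  qed
qed

section \<open>From monotone functions to absolutely continuous ones\<close>

lemma sum_disjoint_interval_lengths_le:
  fixes x y :: "'i \<Rightarrow> real"
  assumes "finite I" "\<And>i. i \<in> I \<Longrightarrow> x i \<le> y i \<and> {x i<..<y i} \<subseteq> S" "S \<in> lmeasurable"
    and "pairwise (\<lambda>i j. {x i<..<y i} \<inter> {x j<..<y j} = {}) I"
  shows "(\<Sum>i\<in>I. y i - x i) \<le> measure lebesgue S"
proof -
  have "(\<Sum>i\<in>I. y i - x i) = (\<Sum>i\<in>I. measure lebesgue {x i<..<y i})"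
    using assms(2) by (intro sum.cong) auto
  also have "\<dots> = measure lebesgue (\<Union>i\<in>I. {x i<..<y i})"
    using assms by (intro measure_UNION'[symmetric]) (auto simp: disjnt_def)
  also have "\<dots> \<le> measure lebesgue S"
    using assms by (intro measure_mono_fmeasurable) auto
  finally show ?thesis .
qed

text \<open>The positive variation \<open>P\<close> and \<open>P - v\<close> are both monotone.\<close>

lemma negligible_not_differentiable_if_positive_variation_bounded:
  fixes v :: "real \<Rightarrow> real"
  assumes cd: "c \<le> d"
    and bound: "\<And>(n::nat) x y. (\<And>i. i < n \<Longrightarrow> c \<le> x i \<and> x i \<le> y i \<and> y i \<le> d) \<Longrightarrow>
       pairwise (\<lambda>i j. {x i<..<y i} \<inter> {x j<..<y j} = {}) {..<n} \<Longrightarrow>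
       (\<Sum>i<n. v (y i) - v (x i)) \<le> B"
  shows "negligible {t\<in>{c<..<d}. \<not> v differentiable (at t)}"
proof -
  define R where "R t = {(\<Sum>i<n. v (y i) - v (x i)) |(n::nat) x y.
     (\<forall>i<n. c \<le> x i \<and> x i \<le> y i \<and> y i \<le> t) \<and>
     pairwise (\<lambda>i j. {x i<..<y i} \<inter> {x j<..<y j} = {}) {..<n}}" for t
  define P where "P t = Sup (R t)" for t
  have ne: "R t \<noteq> {}" for t
    unfolding R_def by (auto intro!: exI[of _ 0])
  have bdd: "bdd_above (R t)" if "t \<le> d" for t
  proof (rule bdd_aboveI)
    fix z assume "z \<in> R t"
    then obtain n :: nat and x y where z: "z = (\<Sum>i<n. v (y i) - v (x i))"
      "\<forall>i<n. c \<le> x i \<and> x i \<le> y i \<and> y i \<le> t"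
      "pairwise (\<lambda>i j. {x i<..<y i} \<inter> {x j<..<y j} = {}) {..<n}"
      unfolding R_def by blast
    show "z \<le> B" unfolding z(1) by (rule bound[OF _ z(3)]) (use z(2) that in force)
  qed
  have mono1: "P s \<le> P t" if "s \<le> t" "t \<le> d" for s t
    unfolding P_def using that
  proof (intro cSup_subset_mono ne bdd)
    show "R s \<subseteq> R t"
      unfolding R_def using order_trans[OF _ \<open>s \<le> t\<close>] by blast
  qed
  have mono2: "P s - v s \<le> P t - v t" if "c \<le> s" "s \<le> t" "t \<le> d" for s t
  proof -
    have "P s \<le> P t - (v t - v s)"
      unfolding P_def
    proof (rule cSup_least[OF ne])
      fix z assume "z \<in> R s"
      then obtain n :: nat and x y where z: "z = (\<Sum>i<n. v (y i) - v (x i))"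
        "\<forall>i<n. c \<le> x i \<and> x i \<le> y i \<and> y i \<le> s"
        "pairwise (\<lambda>i j. {x i<..<y i} \<inter> {x j<..<y j} = {}) {..<n}"
        unfolding R_def by blast
      \<comment> \<open>Appending the interval \<open>{s..t}\<close> to a family inside
        \<open>{c..s}\<close> gives a family inside \<open>{c..t}\<close>, so \<open>P\<close> grows
        by at least \<open>v t - v s\<close>.\<close>
      define x' where "x' = x(n := s)"
      define y' where "y' = y(n := t)"
      have "z + (v t - v s) = (\<Sum>i<Suc n. v (y' i) - v (x' i))"
        by (simp add: z x'_def y'_def)
      moreover have "\<forall>i<Suc n. c \<le> x' i \<and> x' i \<le> y' i \<and> y' i \<le> t"
        using z(2) that by (force simp: x'_def y'_def less_Suc_eq)
      moreover have "pairwise (\<lambda>i j. {x' i<..<y' i} \<inter> {x' j<..<y' j} = {}) {..<Suc n}"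
        unfolding lessThan_Suc pairwise_insert
      proof (intro conjI allI impI)
        show "pairwise (\<lambda>i j. {x' i<..<y' i} \<inter> {x' j<..<y' j} = {}) {..<n}"
          using z(3) by (simp add: pairwise_def x'_def y'_def)
        fix i assume "i \<in> {..<n} \<and> i \<noteq> n"
        then show "{x' n<..<y' n} \<inter> {x' i<..<y' i} = {}" "{x' i<..<y' i} \<inter> {x' n<..<y' n} = {}"
          using z(2) by (force simp: x'_def y'_def)+
      qed
      ultimately have "z + (v t - v s) \<in> R t" unfolding R_def by blast
      then show "z \<le> Sup (R t) - (v t - v s)"
        using cSup_upper[OF _ bdd[OF that(3)]] by (smt (verit))
    qed
    then show ?thesis by simp
  qed
  \<comment> \<open>Clamping to \<open>{c..d}\<close> turns monotonicity on the interval into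
    monotonicity on the whole line; near points of the open interval nothing changes.\<close>
  define k where "k t = max c (min d t)" for t
  have k: "c \<le> k t" "k t \<le> d" for t using cd by (auto simp: k_def)
  have k_mono: "k s \<le> k t" if "s \<le> t" for s t using that by (auto simp: k_def)
  have "mono (\<lambda>t. P (k t))" "mono (\<lambda>t. P (k t) - v (k t))"
    using mono1 mono2 k k_mono by (auto intro!: monoI)
  note neg = this[THEN negligible_mono_not_differentiable]
  have "v differentiable (at t)" if t: "t \<in> {c<..<d}"
    and "(\<lambda>t. P (k t)) differentiable (at t)" "(\<lambda>t. P (k t) - v (k t)) differentiable (at t)" for t
  proof -
    have "(\<lambda>t. P (k t) - (P (k t) - v (k t))) differentiable (at t)"
      using that(2,3) by (rule differentiable_diff)
    then obtain D where "((\<lambda>t. v (k t)) has_derivative D) (at t)" by (auto simp: differentiable_def)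
    then have "(v has_derivative D) (at t)"
      by (rule has_derivative_transform_within_open[of _ _ _ UNIV "{c<..<d}"])
         (use t in \<open>auto simp: k_def\<close>)
    then show ?thesis by (auto simp: differentiable_def)
  qed
  then show ?thesis
    by (intro negligible_subset[OF negligible_Un[OF neg]]) auto
qed

text \<open>Absolute continuity with \<epsilon> = 1 bounds the positive variation by 1 on every
  interval shorter than \<delta>; countably many such intervals with rational ends cover the open
  interval.\<close>

theorem abs_continuous_on_negligible_not_differentiable:
  assumes "abs_continuous_on a b v"
  shows "negligible {t\<in>{a<..<b}. \<not> v differentiable (at t)}"
proof -
  obtain \<delta> where \<delta>: "\<delta> > 0" "\<And>(n::nat) x y. (\<forall>i<n. a \<le> x i \<and> x i \<le> y i \<and> y i \<le> b) \<Longrightarrow>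
        pairwise (\<lambda>i j. {x i<..<y i} \<inter> {x j<..<y j} = {}) {..<n} \<Longrightarrow>
        (\<Sum>i<n. y i - x i) < \<delta> \<Longrightarrow> (\<Sum>i<n. \<bar>v (y i) - v (x i)\<bar>) < 1"
    using assms unfolding abs_continuous_on_def by (meson zero_less_one)
  let ?I = "{(c, d). c \<in> \<rat> \<and> d \<in> \<rat> \<and> a < c \<and> c < d \<and> d < b \<and> d - c < \<delta>}"
  have local: "negligible {t\<in>{c<..<d}. \<not> v differentiable (at t)}"
    if cd: "a < c" "c < d" "d < b" "d - c < \<delta>" for c d
  proof (rule negligible_not_differentiable_if_positive_variation_bounded[of c d v 1])
    fix n :: nat and x y
    assume xy: "\<And>i. i < n \<Longrightarrow> c \<le> x i \<and> x i \<le> y i \<and> y i \<le> d"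
      "pairwise (\<lambda>i j. {x i<..<y i} \<inter> {x j<..<y j} = {}) {..<n}"
    have "(\<Sum>i<n. y i - x i) \<le> measure lebesgue {c..d}"
      using xy by (intro sum_disjoint_interval_lengths_le) force+
    also have "\<dots> < \<delta>" using cd by simp
    finally have "(\<Sum>i<n. \<bar>v (y i) - v (x i)\<bar>) < 1"
      using xy cd by (intro \<delta>) force+
    moreover have "(\<Sum>i<n. v (y i) - v (x i)) \<le> (\<Sum>i<n. \<bar>v (y i) - v (x i)\<bar>)"
      by (intro sum_mono) auto
    ultimately show "(\<Sum>i<n. v (y i) - v (x i)) \<le> 1" by linarith
  qed (use cd in auto)
  have "countable ?I"
    by (rule countable_subset[of _ "\<rat> \<times> \<rat>"]) (auto intro: countable_rat)
  then have "negligible (\<Union>(c, d)\<in>?I. {t\<in>{c<..<d}. \<not> v differentiable (at t)})"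
    by (intro negligible_countable_Union) (use local in auto)
  then show ?thesis
  proof (rule negligible_subset, safe)
    fix t assume t: "t \<in> {a<..<b}" "\<not> v differentiable (at t)"
    obtain c where c: "c \<in> \<rat>" "max a (t - \<delta> / 2) < c" "c < t"
      using Rats_dense_in_real[of "max a (t - \<delta> / 2)" t] t \<delta>(1) by auto
    obtain d where d: "d \<in> \<rat>" "t < d" "d < min b (t + \<delta> / 2)"
      using Rats_dense_in_real[of t "min b (t + \<delta> / 2)"] t \<delta>(1) by auto
    have "(c, d) \<in> ?I" using c d by auto
    then show "t \<in> (\<Union>(c, d)\<in>?I. {t\<in>{c<..<d}. \<not> v differentiable (at t)})"
      using c d t by (intro UN_I[of "(c, d)"]) auto
  qed
qed

section \<open>The fundamental theorem of calculus for absolutely continuous functions\<close>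

text \<open>Tagged divisions are finite sets of pairs, while the definition indexes its families by
  \<open>{..<n}\<close>.\<close>

lemma abs_continuous_onE_finite:
  assumes "abs_continuous_on a b v" "\<epsilon> > 0"
  obtains \<delta> where "\<delta> > 0"
    "\<And>I (x :: 'i \<Rightarrow> real) y. finite I \<Longrightarrow> (\<And>i. i \<in> I \<Longrightarrow> a \<le> x i \<and> x i \<le> y i \<and> y i \<le> b) \<Longrightarrow>
       pairwise (\<lambda>i j. {x i<..<y i} \<inter> {x j<..<y j} = {}) I \<Longrightarrow>
       (\<Sum>i\<in>I. y i - x i) < \<delta> \<Longrightarrow> (\<Sum>i\<in>I. \<bar>v (y i) - v (x i)\<bar>) < \<epsilon>"
proof -
  obtain \<delta> where \<delta>: "\<delta> > 0" "\<And>(n::nat) x y. (\<forall>i<n. a \<le> x i \<and> x i \<le> y i \<and> y i \<le> b) \<Longrightarrow>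
        pairwise (\<lambda>i j. {x i<..<y i} \<inter> {x j<..<y j} = {}) {..<n} \<Longrightarrow>
        (\<Sum>i<n. y i - x i) < \<delta> \<Longrightarrow> (\<Sum>i<n. \<bar>v (y i) - v (x i)\<bar>) < \<epsilon>"
    using assms unfolding abs_continuous_on_def by meson
  show thesis
  proof (rule that[OF \<delta>(1)])
    fix I and x y :: "'i \<Rightarrow> real"
    assume I: "finite I" "\<And>i. i \<in> I \<Longrightarrow> a \<le> x i \<and> x i \<le> y i \<and> y i \<le> b"
      "pairwise (\<lambda>i j. {x i<..<y i} \<inter> {x j<..<y j} = {}) I" "(\<Sum>i\<in>I. y i - x i) < \<delta>"
    obtain h where h: "bij_betw h {..<card I} I"
      using ex_bij_betw_nat_finite[OF I(1)] by (auto simp: atLeast0LessThan)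
    have "(\<Sum>i<card I. \<bar>v (y (h i)) - v (x (h i))\<bar>) < \<epsilon>"
    proof (rule \<delta>(2)[of "card I" "x \<circ> h" "y \<circ> h", unfolded o_def])
      show "\<forall>i<card I. a \<le> x (h i) \<and> x (h i) \<le> y (h i) \<and> y (h i) \<le> b"
        using I(2) h by (auto dest: bij_betwE)
      show "pairwise (\<lambda>i j. {x (h i)<..<y (h i)} \<inter> {x (h j)<..<y (h j)} = {}) {..<card I}"
        unfolding pairwise_def
      proof (intro ballI impI)
        fix i j assume ij: "i \<in> {..<card I}" "j \<in> {..<card I}" "i \<noteq> j"
        then have "h i \<noteq> h j" "h i \<in> I" "h j \<in> I"
          using h by (auto simp: bij_betw_def dest: inj_onD)
        then show "{x (h i)<..<y (h i)} \<inter> {x (h j)<..<y (h j)} = {}"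
          using pairwiseD[OF I(3), of "h i" "h j"] by blast
      qed
      show "(\<Sum>i<card I. y (h i) - x (h i)) < \<delta>"
        using I(4) sum.reindex_bij_betw[OF h, of "\<lambda>i. y i - x i"] by simp
    qed
    then show "(\<Sum>i\<in>I. \<bar>v (y i) - v (x i)\<bar>) < \<epsilon>"
      using sum.reindex_bij_betw[OF h, of "\<lambda>i. \<bar>v (y i) - v (x i)\<bar>"] by simp
  qed
qed

text \<open>With the gauge integral, integrability of \<open>w'\<close> is part of the conclusion.
  Tags off \<open>N\<close> are handled by differentiability, as in the classical fundamental
  theorem; intervals tagged in \<open>N\<close> are confined to an open set of small measure, where
  absolute continuity makes their increments small.\<close>

theorem abs_continuous_on_has_integral_derivative:
  fixes w w' :: "real \<Rightarrow> real"
  assumes ac: "abs_continuous_on a b w" and "a \<le> b" and N: "negligible N"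
    and deriv: "\<And>t. t \<in> {a..b} - N \<Longrightarrow> (w has_real_derivative w' t) (at t within {a..b})"
  shows "(w' has_integral (w b - w a)) {a..b}"
proof -
  \<comment> \<open>With the value 0 on \<open>N\<close>, a tag in \<open>N\<close> contributes
    nothing to the Riemann sum, so its error is the increment of \<open>w\<close> alone.\<close>
  define f where "f t = (if t \<in> N then 0 else w' t)" for t
  have "(f has_integral (w b - w a)) {a..b}"
  proof (cases "a = b")
    case True
    then show ?thesis by (simp add: has_integral_refl)
  next
    case False
    with \<open>a \<le> b\<close> have "a < b" by simp
    show ?thesis
      unfolding has_integral_factor_content_real
    proof (intro allI impI)
      fix e :: real assume "e > 0"
      \<comment> \<open>Half of the admissible error: tags in \<open>N\<close> and tags off
        \<open>N\<close> may each use up \<open>\<eta>\<close>.\<close>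
      define \<eta> where "\<eta> = e * (b - a) / 2"
      have "\<eta> > 0" using \<open>e > 0\<close> \<open>a < b\<close> by (simp add: \<eta>_def)
      obtain \<delta> where \<delta>: "\<delta> > 0"
        "\<And>I (x :: real \<times> real set \<Rightarrow> real) y. finite I \<Longrightarrow>
         (\<And>i. i \<in> I \<Longrightarrow> a \<le> x i \<and> x i \<le> y i \<and> y i \<le> b) \<Longrightarrow>
         pairwise (\<lambda>i j. {x i<..<y i} \<inter> {x j<..<y j} = {}) I \<Longrightarrow>
         (\<Sum>i\<in>I. y i - x i) < \<delta> \<Longrightarrow> (\<Sum>i\<in>I. \<bar>w (y i) - w (x i)\<bar>) < \<eta>"
        using abs_continuous_onE_finite[OF ac \<open>\<eta> > 0\<close>] by blast
      have "N \<in> sets lebesgue" using N by (simp add: negligible_iff_null_sets null_setsD2)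
      then obtain U where U: "open U" "N \<subseteq> U" "U - N \<in> lmeasurable" "emeasure lebesgue (U - N) < ennreal \<delta>"
        using sets_lebesgue_outer_open \<delta>(1) by blast
      have NU: "N \<union> (U - N) = U" using U by blast
      have N': "N \<in> lmeasurable" "measure lebesgue N = 0"
        using N by (auto intro: negligible_imp_measurable negligible_imp_measure0)
      have Um: "U \<in> lmeasurable" using fmeasurable.Un[OF N'(1) U(3)] NU by simp
      have "measure lebesgue (U - N) < \<delta>"
        using U \<delta>(1) by (simp add: emeasure_eq_measure2 ennreal_less_iff)
      then have mU: "measure lebesgue U < \<delta>"
        using measure_Un_le[of N lebesgue "U - N"] N' U(3) NU by auto
      have "\<exists>d>0. ball x d \<subseteq> U" if "x \<in> N" for x
        using that U open_contains_ball by blast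
      then obtain d1 where d1: "\<And>x. x \<in> N \<Longrightarrow> d1 x > 0 \<and> ball x (d1 x) \<subseteq> U" by metis
      have "\<exists>d>0. \<forall>y\<in>{a..b}. \<bar>y - x\<bar> < d \<longrightarrow> \<bar>w y - w x - w' x * (y - x)\<bar> \<le> e / 2 * \<bar>y - x\<bar>"
        if "x \<in> {a..b} - N" for x
      proof -
        have "(w has_derivative (\<lambda>h. w' x * h)) (at x within {a..b})"
          using deriv[OF that] by (simp add: has_field_derivative_def)
        moreover have "e / 2 > 0" using \<open>e > 0\<close> by simp
        ultimately show ?thesis unfolding has_derivative_within_alt real_norm_def by blast
      qed
      then obtain d2 where d2: "\<And>x. x \<in> {a..b} - N \<Longrightarrow> d2 x > 0 \<and>
          (\<forall>y\<in>{a..b}. \<bar>y - x\<bar> < d2 x \<longrightarrow> \<bar>w y - w x - w' x * (y - x)\<bar> \<le> e / 2 * \<bar>y - x\<bar>)"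
        by metis
      define g where "g x = (if x \<in> N then ball x (d1 x) else if x \<in> {a..b} then ball x (d2 x) else ball x 1)" for x
      have "gauge g"
        using d1 d2 by (auto simp: gauge_def g_def)
      moreover have "norm ((\<Sum>(x, k)\<in>p. measure lborel k *\<^sub>R f x) - (w b - w a)) \<le> e * measure lborel {a..b}"
        if p: "p tagged_division_of {a..b}" and fine: "g fine p" for p
      proof -
        define D where "D = (\<lambda>(x :: real, k). w (Sup k) - w (Inf k))"
        have fin: "finite p" using p by blast
        have pk: "\<exists>u v. k = {u..v} \<and> a \<le> u \<and> u \<le> x \<and> x \<le> v \<and> v \<le> b \<and> k \<subseteq> g x" if "(x, k) \<in> p" for x k
        proof -
          obtain u v where "k = cbox u v" using tagged_division_ofD(4)[OF p \<open>(x, k) \<in> p\<close>] by blast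
          moreover have "x \<in> k" "k \<subseteq> {a..b}" using tagged_division_ofD(2,3)[OF p that] .
          moreover have "k \<subseteq> g x" using fine that by (auto simp: fine_def)
          ultimately show ?thesis by (intro exI[of _ u] exI[of _ v]) auto
        qed
        define P1 where "P1 = {z\<in>p. fst z \<in> N}"
        define P2 where "P2 = {z\<in>p. fst z \<notin> N}"
        \<comment> \<open>The gauge keeps every interval tagged in \<open>N\<close> inside
          \<open>U\<close>, so these intervals have total length below
          \<open>\<delta>\<close>.\<close>
        have "(\<Sum>z\<in>P1. \<bar>w (Sup (snd z)) - w (Inf (snd z))\<bar>) < \<eta>"
        proof (rule \<delta>(2))
          show "finite P1" using fin by (simp add: P1_def)
          have P1k: "\<exists>x u v. z = (x, {u..v}) \<and> a \<le> u \<and> u \<le> v \<and> v \<le> b \<and> {u..v} \<subseteq> U" if "z \<in> P1" for z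
          proof -
            obtain x k where z: "z = (x, k)" by (cases z)
            with that have x: "x \<in> N" "(x, k) \<in> p" by (auto simp: P1_def)
            with pk[OF x(2)] d1[OF x(1)] show ?thesis unfolding z g_def by fastforce
          qed
          show "a \<le> Inf (snd z) \<and> Inf (snd z) \<le> Sup (snd z) \<and> Sup (snd z) \<le> b" if "z \<in> P1" for z
            using P1k[OF that] by auto
          show pw: "pairwise (\<lambda>i j. {Inf (snd i)<..<Sup (snd i)} \<inter> {Inf (snd j)<..<Sup (snd j)} = {}) P1"
            unfolding pairwise_def
          proof (intro ballI impI)
            fix i j assume ij: "i \<in> P1" "j \<in> P1" "i \<noteq> j"
            obtain x1 u1 v1 where i: "i = (x1, {u1..v1})" "u1 \<le> v1" using P1k[OF ij(1)] by blast
            obtain x2 u2 v2 where j: "j = (x2, {u2..v2})" "u2 \<le> v2" using P1k[OF ij(2)] by blast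
            have "interior {u1..v1} \<inter> interior {u2..v2} = {}"
              using tagged_division_ofD(5)[OF p, of x1 "{u1..v1}" x2 "{u2..v2}"] ij i j by (auto simp: P1_def)
            then show "{Inf (snd i)<..<Sup (snd i)} \<inter> {Inf (snd j)<..<Sup (snd j)} = {}"
              using i j by (simp add: interior_atLeastAtMost_real)
          qed
          have "(\<Sum>i\<in>P1. Sup (snd i) - Inf (snd i)) \<le> measure lebesgue U"
          proof (rule sum_disjoint_interval_lengths_le[OF \<open>finite P1\<close> _ Um pw])
            show "Inf (snd z) \<le> Sup (snd z) \<and> {Inf (snd z)<..<Sup (snd z)} \<subseteq> U" if "z \<in> P1" for z
              using P1k[OF that] by fastforce
          qed
          then show "(\<Sum>i\<in>P1. Sup (snd i) - Inf (snd i)) < \<delta>" using mU by linarith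
        qed
        moreover have "\<bar>\<Sum>(x, k)\<in>P1. measure lborel k * f x - D (x, k)\<bar> \<le> (\<Sum>z\<in>P1. \<bar>w (Sup (snd z)) - w (Inf (snd z))\<bar>)"
          by (rule order_trans[OF sum_abs]) (auto intro!: sum_mono simp: P1_def D_def f_def)
        ultimately have 1: "\<bar>\<Sum>(x, k)\<in>P1. measure lborel k * f x - D (x, k)\<bar> \<le> \<eta>" by linarith
        \<comment> \<open>The straddle argument: the linear approximation at the tag is compared at
          both ends of the interval, and the two distances to the tag add up to its length.\<close>
        have "\<bar>measure lborel k * f x - D (x, k)\<bar> \<le> e / 2 * measure lborel k" if "(x, k) \<in> P2" for x k
        proof -
          have xk: "(x, k) \<in> p" "x \<notin> N" using that by (auto simp: P2_def)
          obtain u v where k: "k = {u..v}" "a \<le> u" "u \<le> x" "x \<le> v" "v \<le> b" "k \<subseteq> g x" using pk[OF xk(1)] by blast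
          then have x: "x \<in> {a..b} - N" using xk by auto
          then have "g x = ball x (d2 x)" using xk(2) by (simp add: g_def)
          moreover have "u \<in> k" "v \<in> k" using k by auto
          ultimately have "u \<in> ball x (d2 x)" "v \<in> ball x (d2 x)" using k(6) by blast+
          then have uv: "\<bar>u - x\<bar> < d2 x" "\<bar>v - x\<bar> < d2 x" by (auto simp: dist_real_def)
          have "\<bar>w u - w x - w' x * (u - x)\<bar> \<le> e / 2 * \<bar>u - x\<bar>" "\<bar>w v - w x - w' x * (v - x)\<bar> \<le> e / 2 * \<bar>v - x\<bar>"
            using conjunct2[OF d2[OF x], rule_format, of u] conjunct2[OF d2[OF x], rule_format, of v] uv k(2-5)
            by (simp_all only: atLeastAtMost_iff) auto
          moreover have "measure lborel k * f x - D (x, k) =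
              (w u - w x - w' x * (u - x)) - (w v - w x - w' x * (v - x))"
            using k xk by (simp add: D_def f_def algebra_simps)
          ultimately have "\<bar>measure lborel k * f x - D (x, k)\<bar> \<le> e / 2 * (x - u) + e / 2 * (v - x)"
            using k(3,4) abs_triangle_ineq4[of "w u - w x - w' x * (u - x)" "w v - w x - w' x * (v - x)"]
            by (simp only: abs_of_nonneg abs_of_nonpos diff_ge_0_iff_ge diff_le_0_iff_le minus_diff_eq)
          also have "\<dots> = e / 2 * measure lborel k"
            unfolding distrib_left[symmetric] using k by simp
          finally show ?thesis .
        qed
        then have "\<bar>\<Sum>(x, k)\<in>P2. measure lborel k * f x - D (x, k)\<bar> \<le> (\<Sum>(x, k)\<in>P2. e / 2 * measure lborel k)"
          by (intro order_trans[OF sum_abs] sum_mono) auto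
        also have "\<dots> \<le> (\<Sum>(x, k)\<in>p. e / 2 * measure lborel k)"
          using fin \<open>e > 0\<close> by (intro sum_mono2) (auto simp: P2_def)
        also have "\<dots> = e / 2 * (\<Sum>(x, k)\<in>p. measure lborel k)"
          by (simp add: sum_distrib_left case_prod_unfold)
        also have "\<dots> = \<eta>"
          using additive_content_tagged_division[of p a b] p \<open>a \<le> b\<close> by (simp add: \<eta>_def)
        finally have 2: "\<bar>\<Sum>(x, k)\<in>P2. measure lborel k * f x - D (x, k)\<bar> \<le> \<eta>" .
        have "(\<Sum>(x, k)\<in>p. measure lborel k * f x) - (w b - w a) = (\<Sum>(x, k)\<in>p. measure lborel k * f x) - (\<Sum>z\<in>p. D z)"
          unfolding D_def using additive_tagged_division_1[OF \<open>a \<le> b\<close> p, of w] by simp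
        also have "\<dots> = (\<Sum>(x, k)\<in>p. measure lborel k * f x - D (x, k))"
          by (simp add: sum_subtractf case_prod_unfold)
        also have "\<dots> = (\<Sum>(x, k)\<in>P1. measure lborel k * f x - D (x, k)) + (\<Sum>(x, k)\<in>P2. measure lborel k * f x - D (x, k))"
        proof -
          have "p = P1 \<union> P2" by (auto simp: P1_def P2_def)
          moreover have "finite P1" "finite P2" "P1 \<inter> P2 = {}" using fin by (auto simp: P1_def P2_def)
          ultimately show ?thesis by (simp only: sum.union_disjoint)
        qed
        finally have "\<bar>(\<Sum>(x, k)\<in>p. measure lborel k * f x) - (w b - w a)\<bar> \<le> \<eta> + \<eta>" using 1 2 by linarith
        then show ?thesis using \<open>a \<le> b\<close> by (simp add: \<eta>_def)
      qed
      ultimately show "\<exists>d. gauge d \<and> (\<forall>p. p tagged_division_of {a..b} \<and> d fine p \<longrightarrow>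
          norm ((\<Sum>(x, k)\<in>p. measure lborel k *\<^sub>R f x) - (w b - w a)) \<le> e * measure lborel {a..b})"
        by (intro exI[of _ g] conjI allI impI) simp_all
    qed
  qed
  then show ?thesis
    by (rule has_integral_spike[OF N, rotated]) (auto simp: f_def)
qed

text \<open>The gauge and Lebesgue integrals agree once the latter exists, hence the integrability
  hypothesis. The end points join the null set because \<open>w'\<close> is the derivative only
  inside.\<close>

corollary abs_continuous_on_lebesgue_integral_derivative:
  fixes w w' :: "real \<Rightarrow> real"
  assumes "abs_continuous_on a b w" "a \<le> b"
    and N: "negligible {t\<in>{a<..<b}. \<not> (w has_real_derivative w' t) (at t)}"
    and int: "set_integrable lborel {a<..<b} w'"
  shows "(LINT t:{a<..<b}|lborel. w' t) = w b - w a"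
proof -
  have "(w' has_integral (w b - w a)) {a..b}"
  proof (rule abs_continuous_on_has_integral_derivative)
    show "negligible ({t\<in>{a<..<b}. \<not> (w has_real_derivative w' t) (at t)} \<union> {a, b})"
      by (intro negligible_Un[OF N]) simp
  qed (use assms in \<open>auto intro: has_field_derivative_at_within\<close>)
  then have "(w' has_integral (w b - w a)) {a<..<b}"
    by (simp add: has_integral_Icc_iff_Ioo)
  then show ?thesis
    using set_borel_integral_eq_integral(2)[OF int] by (simp add: integral_unique)
qed

lemma abs_continuous_on_dominated:
  assumes "abs_continuous_on a b v"
    and dom: "\<And>s t. a \<le> s \<Longrightarrow> s \<le> t \<Longrightarrow> t \<le> b \<Longrightarrow> \<bar>w t - w s\<bar> \<le> M * \<bar>v t - v s\<bar>"
  shows "abs_continuous_on a b w"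
  unfolding abs_continuous_on_def
proof (intro allI impI)
  fix \<epsilon> :: real assume "\<epsilon> > 0"
  \<comment> \<open>Positive whatever the sign of \<open>M\<close>, so that \<epsilon> can be
    divided by it.\<close>
  define M' where "M' = \<bar>M\<bar> + 1"
  have "M' > 0" by (simp add: M'_def)
  then have "\<epsilon> / M' > 0" using \<open>\<epsilon> > 0\<close> by simp
  then obtain \<delta> where \<delta>: "\<delta> > 0" "\<And>(n::nat) x y. (\<forall>i<n. a \<le> x i \<and> x i \<le> y i \<and> y i \<le> b) \<Longrightarrow>
        pairwise (\<lambda>i j. {x i<..<y i} \<inter> {x j<..<y j} = {}) {..<n} \<Longrightarrow>
        (\<Sum>i<n. y i - x i) < \<delta> \<Longrightarrow> (\<Sum>i<n. \<bar>v (y i) - v (x i)\<bar>) < \<epsilon> / M'"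
    using assms(1) unfolding abs_continuous_on_def by meson
  show "\<exists>\<delta>>0. \<forall>(n::nat) x y.
        (\<forall>i<n. a \<le> x i \<and> x i \<le> y i \<and> y i \<le> b) \<longrightarrow>
        pairwise (\<lambda>i j. {x i<..<y i} \<inter> {x j<..<y j} = {}) {..<n} \<longrightarrow>
        (\<Sum>i<n. y i - x i) < \<delta> \<longrightarrow>
        (\<Sum>i<n. \<bar>w (y i) - w (x i)\<bar>) < \<epsilon>"
  proof (intro exI[of _ \<delta>] conjI \<delta>(1) allI impI)
    fix n :: nat and x y
    assume xy: "\<forall>i<n. a \<le> x i \<and> x i \<le> y i \<and> y i \<le> b"
      "pairwise (\<lambda>i j. {x i<..<y i} \<inter> {x j<..<y j} = {}) {..<n}" "(\<Sum>i<n. y i - x i) < \<delta>"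
    have "(\<Sum>i<n. \<bar>w (y i) - w (x i)\<bar>) \<le> (\<Sum>i<n. M' * \<bar>v (y i) - v (x i)\<bar>)"
    proof (intro sum_mono)
      fix i assume "i \<in> {..<n}"
      then have "\<bar>w (y i) - w (x i)\<bar> \<le> M * \<bar>v (y i) - v (x i)\<bar>" using dom xy by auto
      also have "\<dots> \<le> M' * \<bar>v (y i) - v (x i)\<bar>" by (intro mult_right_mono) (auto simp: M'_def)
      finally show "\<bar>w (y i) - w (x i)\<bar> \<le> M' * \<bar>v (y i) - v (x i)\<bar>" .
    qed
    also have "\<dots> = M' * (\<Sum>i<n. \<bar>v (y i) - v (x i)\<bar>)" by (simp add: sum_distrib_left)
    also have "\<dots> < M' * (\<epsilon> / M')" using \<delta>(2)[OF xy] \<open>M' > 0\<close> by (intro mult_strict_left_mono)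
    also have "\<dots> = \<epsilon>" using \<open>M' > 0\<close> by simp
    finally show "(\<Sum>i<n. \<bar>w (y i) - w (x i)\<bar>) < \<epsilon>" .
  qed
qed

lemma abs_continuous_on_subset:
  assumes "abs_continuous_on a b v" "a \<le> c" "d \<le> b"
  shows "abs_continuous_on c d v"
  unfolding abs_continuous_on_def
proof (intro allI impI)
  fix \<epsilon> :: real assume "\<epsilon> > 0"
  then obtain \<delta> where \<delta>: "\<delta> > 0" "\<And>(n::nat) x y. (\<forall>i<n. a \<le> x i \<and> x i \<le> y i \<and> y i \<le> b) \<Longrightarrow>
        pairwise (\<lambda>i j. {x i<..<y i} \<inter> {x j<..<y j} = {}) {..<n} \<Longrightarrow>
        (\<Sum>i<n. y i - x i) < \<delta> \<Longrightarrow> (\<Sum>i<n. \<bar>v (y i) - v (x i)\<bar>) < \<epsilon>"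
    using assms(1) unfolding abs_continuous_on_def by meson
  show "\<exists>\<delta>>0. \<forall>(n::nat) x y.
        (\<forall>i<n. c \<le> x i \<and> x i \<le> y i \<and> y i \<le> d) \<longrightarrow>
        pairwise (\<lambda>i j. {x i<..<y i} \<inter> {x j<..<y j} = {}) {..<n} \<longrightarrow>
        (\<Sum>i<n. y i - x i) < \<delta> \<longrightarrow>
        (\<Sum>i<n. \<bar>v (y i) - v (x i)\<bar>) < \<epsilon>"
    by (intro exI[of _ \<delta>] conjI \<delta>(1) allI impI \<delta>(2)) (use assms(2,3) in force)+
qed

lemma abs_continuous_on_imp_continuous_on:
  assumes "abs_continuous_on a b v"
  shows "continuous_on {a..b} v"
  unfolding continuous_on_iff
proof (intro ballI allI impI)
  fix s \<epsilon> :: real assume s: "s \<in> {a..b}" and "\<epsilon> > 0"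
  obtain \<delta> where \<delta>: "\<delta> > 0"
    "\<And>I (x :: unit \<Rightarrow> real) y. finite I \<Longrightarrow> (\<And>i. i \<in> I \<Longrightarrow> a \<le> x i \<and> x i \<le> y i \<and> y i \<le> b) \<Longrightarrow>
       pairwise (\<lambda>i j. {x i<..<y i} \<inter> {x j<..<y j} = {}) I \<Longrightarrow>
       (\<Sum>i\<in>I. y i - x i) < \<delta> \<Longrightarrow> (\<Sum>i\<in>I. \<bar>v (y i) - v (x i)\<bar>) < \<epsilon>"
    using abs_continuous_onE_finite[OF assms \<open>\<epsilon> > 0\<close>] by blast
  have "dist (v t) (v s) < \<epsilon>" if t: "t \<in> {a..b}" "dist t s < \<delta>" for t
    using \<delta>(2)[of "{()}" "\<lambda>_. s" "\<lambda>_. t"] \<delta>(2)[of "{()}" "\<lambda>_. t" "\<lambda>_. s"] s t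
    by (cases "s \<le> t") (auto simp: dist_real_def abs_minus_commute)
  then show "\<exists>d>0. \<forall>t\<in>{a..b}. dist t s < d \<longrightarrow> dist (v t) (v s) < \<epsilon>" using \<delta>(1) by blast
qed

section \<open>Abel inversion\<close>

lemma nn_integral_powr_kernel:
  fixes a t \<beta> :: real
  assumes "\<beta> > 0" "a \<le> t"
  shows "(\<integral>\<^sup>+s. ennreal (indicator {a<..<t} s * (t - s) powr (\<beta> - 1)) \<partial>lborel) = ennreal ((t - a) powr \<beta> / \<beta>)"
proof -
  have "(\<integral>\<^sup>+s. ennreal (indicator {a<..<t} s * (t - s) powr (\<beta> - 1)) \<partial>lborel)
      = (\<integral>\<^sup>+r. ennreal (indicator {a<..<t} (t + (-1) * r) * (t - (t + (-1) * r)) powr (\<beta> - 1)) \<partial>lborel)"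
    by (subst nn_integral_real_affine[of _ "-1" t]) auto
  also have "\<dots> = (\<integral>\<^sup>+r. ennreal (indicator {0<..<t - a} r * r powr (\<beta> - 1)) \<partial>lborel)"
    by (intro nn_integral_cong arg_cong[where f = ennreal]) (auto simp: indicator_def)
  also have "\<dots> = ennreal ((t - a) powr \<beta> / \<beta>)"
  proof (rule nn_integral_has_integral_lebesgue)
    show "((\<lambda>r. r powr (\<beta> - 1)) has_integral ((t - a) powr \<beta> / \<beta>)) {0<..<t - a}"
      using has_integral_powr_from_0[of "\<beta> - 1" "t - a"] assms by (simp add: has_integral_Icc_iff_Ioo)
  qed auto
  finally show ?thesis .
qed

text \<open>After r = s + (t - s) x the powers of t - s cancel, since 1 + (\<alpha> - 1) - \<alpha>
  = 0, and Beta(1 - \<alpha>, \<alpha>) remains. Independence of \<open>s\<close> and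
  \<open>t\<close> is what makes Abel inversion work.\<close>

lemma nn_integral_Beta_kernel:
  fixes s t \<alpha> :: real
  assumes "0 < \<alpha>" "\<alpha> < 1" "s < t"
  shows "(\<integral>\<^sup>+r. ennreal (indicator {s<..<t} r * ((t - r) powr (\<alpha> - 1) * (r - s) powr (- \<alpha>))) \<partial>lborel)
         = ennreal (Gamma \<alpha> * Gamma (1 - \<alpha>))"
proof -
  let ?d = "t - s"
  have "(\<integral>\<^sup>+r. ennreal (indicator {s<..<t} r * ((t - r) powr (\<alpha> - 1) * (r - s) powr (- \<alpha>))) \<partial>lborel)
      = ennreal ?d * (\<integral>\<^sup>+x. ennreal (indicator {s<..<t} (s + ?d * x) *
           ((t - (s + ?d * x)) powr (\<alpha> - 1) * ((s + ?d * x) - s) powr (- \<alpha>))) \<partial>lborel)"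
    using assms by (subst nn_integral_real_affine[of _ ?d s]) auto
  also have "\<dots> = (\<integral>\<^sup>+x. ennreal ?d * ennreal (indicator {s<..<t} (s + ?d * x) *
           ((t - (s + ?d * x)) powr (\<alpha> - 1) * ((s + ?d * x) - s) powr (- \<alpha>))) \<partial>lborel)"
    by (rule nn_integral_cmult[symmetric]) measurable
  also have "\<dots> = (\<integral>\<^sup>+x. ennreal (indicator {0<..<1} x * (x powr ((1 - \<alpha>) - 1) * (1 - x) powr (\<alpha> - 1))) \<partial>lborel)"
  proof (intro nn_integral_cong)
    fix x :: real
    have ind: "(indicator {s<..<t} (s + ?d * x) :: real) = indicator {0<..<1} x"
    proof -
      have "s < s + ?d * x \<longleftrightarrow> 0 < x" using assms by (simp add: zero_less_mult_iff)
      moreover have "s + ?d * x < t \<longleftrightarrow> 0 < ?d * (1 - x)" by (simp add: algebra_simps)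
      moreover have "0 < ?d * (1 - x) \<longleftrightarrow> x < 1" using assms by (simp add: zero_less_mult_iff)
      ultimately show ?thesis by (simp add: indicator_def)
    qed
    have "?d * ((t - (s + ?d * x)) powr (\<alpha> - 1) * ((s + ?d * x) - s) powr (- \<alpha>)) =
        x powr ((1 - \<alpha>) - 1) * (1 - x) powr (\<alpha> - 1)" if x: "0 < x" "x < 1"
    proof -
      have "t - (s + ?d * x) = ?d * (1 - x)" "(s + ?d * x) - s = ?d * x" by (auto simp: algebra_simps)
      then have "?d * ((t - (s + ?d * x)) powr (\<alpha> - 1) * ((s + ?d * x) - s) powr (- \<alpha>)) =
         (?d powr 1 * ?d powr (\<alpha> - 1) * ?d powr (- \<alpha>)) * ((1 - x) powr (\<alpha> - 1) * x powr (- \<alpha>))"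
        using assms x by (simp only: powr_mult) (simp add: powr_mult)
      also have "?d powr 1 * ?d powr (\<alpha> - 1) * ?d powr (- \<alpha>) = 1"
        using assms by (simp only: powr_add[symmetric]) simp
      finally show ?thesis by (simp add: mult.commute)
    qed
    then show "ennreal ?d * ennreal (indicator {s<..<t} (s + ?d * x) *
           ((t - (s + ?d * x)) powr (\<alpha> - 1) * ((s + ?d * x) - s) powr (- \<alpha>))) =
        ennreal (indicator {0<..<1} x * (x powr ((1 - \<alpha>) - 1) * (1 - x) powr (\<alpha> - 1)))"
      unfolding ind using assms by (subst ennreal_mult'[symmetric]) (auto simp: indicator_def)
  qed
  also have "\<dots> = ennreal (Beta (1 - \<alpha>) \<alpha>)"
    by (rule nn_integral_has_integral_lebesgue)
       (use has_integral_Beta_real[of "1 - \<alpha>" \<alpha>] assms in \<open>auto simp: has_integral_Icc_iff_Ioo\<close>)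
  also have "Beta (1 - \<alpha>) \<alpha> = Gamma \<alpha> * Gamma (1 - \<alpha>)"
    by (simp add: Beta_def)
  finally show ?thesis .
qed

text \<open>The semigroup law I^\<alpha> I^(1-\<alpha>) = I^1 without its Gamma factors. After
  Fubini over the triangle s < r < t the inner integral is the constant Beta integral, which also
  bounds the absolute integral.\<close>

theorem Abel_inversion:
  fixes h :: "real \<Rightarrow> real"
  assumes \<alpha>: "0 < \<alpha>" "\<alpha> < 1" and int: "set_integrable lborel {0<..<t} h"
  shows "set_integrable lborel {0<..<t}
           (\<lambda>r. (LINT s:{0<..<r}|lborel. h s / (r - s) powr \<alpha>) / (t - r) powr (1 - \<alpha>))" (is ?int)
    and "(LINT r:{0<..<t}|lborel. (LINT s:{0<..<r}|lborel. h s / (r - s) powr \<alpha>) / (t - r) powr (1 - \<alpha>))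
         = Gamma \<alpha> * Gamma (1 - \<alpha>) * (LINT s:{0<..<t}|lborel. h s)" (is ?eq)
proof -
  define g where "g s = indicator {0<..<t} s * h s" for s
  have g: "integrable lborel g" using int by (simp add: g_def[abs_def] set_integrable_def)
  then have [measurable]: "g \<in> borel_measurable borel" by auto
  define \<Gamma> where "\<Gamma> = Gamma \<alpha> * Gamma (1 - \<alpha>)"
  have "\<Gamma> > 0" using \<alpha> by (simp add: \<Gamma>_def Gamma_real_pos)
  define k where "k s r = indicator {s<..<t} r * ((t - r) powr (\<alpha> - 1) * (r - s) powr (- \<alpha>))" for s r :: real
  have [measurable]: "(\<lambda>(s, r). k s r) \<in> borel_measurable (borel \<Otimes>\<^sub>M borel)"
  proof -
    have "(\<lambda>(s, r). k s r) = (\<lambda>z. if fst z < snd z \<and> snd z < t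
        then (t - snd z) powr (\<alpha> - 1) * (snd z - fst z) powr (- \<alpha>) else 0)"
      by (auto simp: k_def indicator_def fun_eq_iff)
    also have "\<dots> \<in> borel_measurable (borel \<Otimes>\<^sub>M borel)" by measurable
    finally show ?thesis .
  qed
  define H where "H s r = k s r * g s" for s r
  have Hm[measurable]: "(\<lambda>(s, r). H s r) \<in> borel_measurable (lborel \<Otimes>\<^sub>M lborel)"
    unfolding H_def by measurable
  have kpos: "k s r \<ge> 0" for s r by (simp add: k_def)
  have nnk: "(\<integral>\<^sup>+r. ennreal (k s r) \<partial>lborel) = ennreal \<Gamma>" if "g s \<noteq> 0" for s
  proof -
    have "s < t" using that by (auto simp: g_def indicator_def split: if_splits)
    then show ?thesis unfolding k_def \<Gamma>_def by (rule nn_integral_Beta_kernel[OF \<alpha>])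
  qed
  have kint: "has_bochner_integral lborel (k s) \<Gamma>" if "g s \<noteq> 0" for s
    using nnk[OF that] kpos \<open>\<Gamma> > 0\<close> by (intro has_bochner_integral_nn_integral) (auto simp: k_def)
  have "integrable (lborel \<Otimes>\<^sub>M lborel) (\<lambda>(s, r). H s r)"
  proof (rule integrableI_bounded[OF Hm])
    have "(\<integral>\<^sup>+z. ennreal (norm (case z of (s, r) \<Rightarrow> H s r)) \<partial>(lborel \<Otimes>\<^sub>M lborel)) =
        (\<integral>\<^sup>+s. \<integral>\<^sup>+r. ennreal (norm (H s r)) \<partial>lborel \<partial>lborel)"
      by (subst lborel.nn_integral_fst[symmetric]) auto
    also have "\<dots> = (\<integral>\<^sup>+s. ennreal \<Gamma> * ennreal \<bar>g s\<bar> \<partial>lborel)"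
    proof (rule nn_integral_cong)
      fix s :: real
      have "(\<integral>\<^sup>+r. ennreal (norm (H s r)) \<partial>lborel) = (\<integral>\<^sup>+r. ennreal (k s r) * ennreal \<bar>g s\<bar> \<partial>lborel)"
        using kpos by (intro nn_integral_cong) (simp add: H_def abs_mult ennreal_mult')
      also have "\<dots> = (\<integral>\<^sup>+r. ennreal (k s r) \<partial>lborel) * ennreal \<bar>g s\<bar>"
        by (rule nn_integral_multc) (simp add: k_def)
      also have "\<dots> = ennreal \<Gamma> * ennreal \<bar>g s\<bar>"
        by (cases "g s = 0") (auto simp: nnk)
      finally show "(\<integral>\<^sup>+r. ennreal (norm (H s r)) \<partial>lborel) = ennreal \<Gamma> * ennreal \<bar>g s\<bar>" .
    qed
    also have "\<dots> = ennreal \<Gamma> * (\<integral>\<^sup>+s. ennreal (norm (g s)) \<partial>lborel)"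
      by (subst nn_integral_cmult) auto
    also have "\<dots> < \<infinity>"
      using g by (auto simp: integrable_iff_bounded ennreal_mult_less_top)
    finally show "(\<integral>\<^sup>+z. ennreal (norm (case z of (s, r) \<Rightarrow> H s r)) \<partial>(lborel \<Otimes>\<^sub>M lborel)) < \<infinity>" .
  qed
  note HI = this
  \<comment> \<open>This holds for every \<open>r\<close>: where the integral over \<open>s\<close>
    diverges, both sides take the default value 0.\<close>
  have inner: "(LINT s|lborel. H s r) =
      indicator {0<..<t} r *\<^sub>R ((LINT s:{0<..<r}|lborel. h s / (r - s) powr \<alpha>) / (t - r) powr (1 - \<alpha>))" for r
  proof (cases "r \<in> {0<..<t}")
    case True
    have "H s r = (indicator {0<..<r} s *\<^sub>R (h s / (r - s) powr \<alpha>)) / (t - r) powr (1 - \<alpha>)" for s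
    proof -
      have "(t - r) powr (\<alpha> - 1) = 1 / (t - r) powr (1 - \<alpha>)" "(r - s) powr (- \<alpha>) = 1 / (r - s) powr \<alpha>"
        using powr_minus_divide[of "t - r" "1 - \<alpha>"] powr_minus_divide[of "r - s" \<alpha>] by auto
      then show ?thesis
        using True by (auto simp: H_def k_def g_def indicator_def)
    qed
    then have "(LINT s|lborel. H s r) =
        (LINT s|lborel. (indicator {0<..<r} s *\<^sub>R (h s / (r - s) powr \<alpha>)) / (t - r) powr (1 - \<alpha>))"
      by (simp only:)
    also have "\<dots> = (LINT s:{0<..<r}|lborel. h s / (r - s) powr \<alpha>) / (t - r) powr (1 - \<alpha>)"
      unfolding set_lebesgue_integral_def by (rule integral_divide_zero)
    finally show ?thesis using True by simp
  next
    case False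
    then have "H s r = 0" for s by (auto simp: H_def k_def g_def indicator_def)
    then show ?thesis using False by simp
  qed
  show ?int
    using lborel_pair.integrable_snd[OF HI] unfolding inner set_integrable_def .
  have "(LINT r|lborel. LINT s|lborel. H s r) = (LINT s|lborel. LINT r|lborel. H s r)"
    using lborel_pair.Fubini_integral[OF HI] by simp
  also have "\<dots> = (LINT s|lborel. \<Gamma> * g s)"
  proof (rule Bochner_Integration.integral_cong[OF refl])
    show "(LINT r|lborel. H s r) = \<Gamma> * g s" for s
      using kint[of s] by (cases "g s = 0") (auto simp: H_def has_bochner_integral_iff)
  qed
  finally show ?eq
    unfolding inner set_lebesgue_integral_def by (simp add: \<Gamma>_def g_def)
qed

section \<open>The inequality of Alikhanov\<close>

lemma continuous_on_Icc_abs_bounded: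
  fixes g :: "real \<Rightarrow> real"
  assumes "continuous_on {a..b} g"
  obtains M where "\<And>s. s \<in> {a..b} \<Longrightarrow> \<bar>g s\<bar> \<le> M"
proof -
  have "compact (g ` {a..b})" using assms by (intro compact_continuous_image) auto
  then have "bounded (g ` {a..b})" by (rule compact_imp_bounded)
  then obtain M where "\<forall>x\<in>g ` {a..b}. norm x \<le> M" unfolding bounded_iff by blast
  then show thesis by (intro that[of M]) auto
qed

lemma set_integrable_mult_continuous:
  fixes f g :: "real \<Rightarrow> real"
  assumes f: "set_integrable lborel A f" and g: "continuous_on {a..b} g"
    and A: "A \<subseteq> {a..b}" "A \<in> sets borel"
  shows "set_integrable lborel A (\<lambda>s. g s * f s)"
proof -
  obtain M where M: "\<And>s. s \<in> {a..b} \<Longrightarrow> \<bar>g s\<bar> \<le> M"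
    using continuous_on_Icc_abs_bounded[OF g] by blast
  have [measurable]: "(\<lambda>s. indicator A s *\<^sub>R g s) \<in> borel_measurable lborel"
    using borel_measurable_continuous_on_indicator[of A g] continuous_on_subset[OF g A(1)] A(2) by simp
  have f': "integrable lborel (\<lambda>s. indicator A s *\<^sub>R f s)" using f by (simp add: set_integrable_def)
  have eq: "indicator A s *\<^sub>R (g s * f s) = (indicator A s *\<^sub>R g s) * (indicator A s *\<^sub>R f s)" for s
    by (auto simp: indicator_def)
  show ?thesis
    unfolding set_integrable_def eq
  proof (rule Bochner_Integration.integrable_bound)
    show "integrable lborel (\<lambda>s. M * (indicator A s *\<^sub>R f s))" using f' by simp
    show "(\<lambda>s. (indicator A s *\<^sub>R g s) * (indicator A s *\<^sub>R f s)) \<in> borel_measurable lborel"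
      using f' by measurable
    show "AE s in lborel. norm ((indicator A s *\<^sub>R g s) * (indicator A s *\<^sub>R f s)) \<le> norm (M * (indicator A s *\<^sub>R f s))"
    proof (rule AE_I2)
      fix s
      show "norm ((indicator A s *\<^sub>R g s) * (indicator A s *\<^sub>R f s)) \<le> norm (M * (indicator A s *\<^sub>R f s))"
      proof (cases "s \<in> A")
        case True
        then have "\<bar>g s\<bar> \<le> \<bar>M\<bar>" using M[of s] A by force
        then show ?thesis using True by (simp add: abs_mult mult_right_mono)
      qed simp
    qed
  qed
qed

lemma abs_continuous_on_power2_diff:
  assumes "abs_continuous_on a b v"
  shows "abs_continuous_on a b (\<lambda>s. (v s - c)\<^sup>2 / 2)"
proof -
  obtain M where M: "\<And>s. s \<in> {a..b} \<Longrightarrow> \<bar>v s\<bar> \<le> M"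
    using continuous_on_Icc_abs_bounded[OF abs_continuous_on_imp_continuous_on[OF assms]] by blast
  show ?thesis
  proof (rule abs_continuous_on_dominated[OF assms])
    fix s t assume st: "a \<le> s" "s \<le> t" "t \<le> b"
    have "(v t - c)\<^sup>2 / 2 - (v s - c)\<^sup>2 / 2 = ((v t + v s - 2 * c) / 2) * (v t - v s)"
      by (simp add: power2_eq_square field_simps)
    then have "\<bar>(v t - c)\<^sup>2 / 2 - (v s - c)\<^sup>2 / 2\<bar> = \<bar>(v t + v s - 2 * c) / 2\<bar> * \<bar>v t - v s\<bar>"
      by (simp only: abs_mult)
    also have "\<dots> \<le> (M + \<bar>c\<bar>) * \<bar>v t - v s\<bar>"
      using M[of s] M[of t] st by (intro mult_right_mono) auto
    finally show "\<bar>(v t - c)\<^sup>2 / 2 - (v s - c)\<^sup>2 / 2\<bar> \<le> (M + \<bar>c\<bar>) * \<bar>v t - v s\<bar>" .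
  qed
qed

lemma abs_continuous_on_negligible_no_deriv:
  assumes "abs_continuous_on a b v"
  shows "negligible {t\<in>{a<..<b}. \<not> (v has_real_derivative deriv v t) (at t)}"
  using abs_continuous_on_negligible_not_differentiable[OF assms]
  by (rule negligible_subset)
     (auto simp: real_differentiable_def field_differentiable_def DERIV_deriv_iff_real_differentiable)

lemma abs_continuous_on_integral_deriv:
  assumes "abs_continuous_on a b v" "a \<le> b" "set_integrable lborel {a<..<b} (deriv v)"
  shows "(LINT s:{a<..<b}|lborel. deriv v s) = v b - v a"
  using assms by (intro abs_continuous_on_lebesgue_integral_derivative abs_continuous_on_negligible_no_deriv)

text \<open>The shift \<open>c\<close> serves two uses: c = v t in Alikhanov's inequality, and c = 0
  for the energy (v^2) / 2.\<close>

lemma abs_continuous_on_integral_diff_mult_deriv: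
  assumes ac: "abs_continuous_on a b v" and "a \<le> b" and int: "set_integrable lborel {a<..<b} (deriv v)"
  shows "(LINT s:{a<..<b}|lborel. (v s - c) * deriv v s) = ((v b - c)\<^sup>2 - (v a - c)\<^sup>2) / 2"
proof -
  have "(LINT s:{a<..<b}|lborel. (v s - c) * deriv v s) = (v b - c)\<^sup>2 / 2 - (v a - c)\<^sup>2 / 2"
  proof (rule abs_continuous_on_lebesgue_integral_derivative[OF abs_continuous_on_power2_diff[OF ac] \<open>a \<le> b\<close>])
    show "set_integrable lborel {a<..<b} (\<lambda>s. (v s - c) * deriv v s)"
      using abs_continuous_on_imp_continuous_on[OF ac]
      by (intro set_integrable_mult_continuous[OF int, of a b] continuous_intros) auto
    have "((\<lambda>s. (v s - c)\<^sup>2 / 2) has_real_derivative (v t - c) * deriv v t) (at t)"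
      if "(v has_real_derivative deriv v t) (at t)" for t
      by (rule derivative_eq_intros that refl | simp)+
    then show "negligible {t\<in>{a<..<b}. \<not> ((\<lambda>s. (v s - c)\<^sup>2 / 2) has_real_derivative (v t - c) * deriv v t) (at t)}"
      by (intro negligible_subset[OF abs_continuous_on_negligible_no_deriv[OF ac]]) blast
  qed
  then show ?thesis by (simp add: diff_divide_distrib)
qed

lemma set_integrable_deriv_if_caputo_integrand:
  assumes "set_integrable lborel {0<..<t} (caputo_integrand \<alpha> v t)" "\<alpha> > 0"
  shows "set_integrable lborel {0<..<t} (deriv v)"
proof -
  have "set_integrable lborel {0<..<t} (\<lambda>s. (t - s) powr \<alpha> * caputo_integrand \<alpha> v t s)"
    using assms
    by (intro set_integrable_mult_continuous[OF assms(1), of 0 t] continuous_on_powr' continuous_intros) auto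
  then show ?thesis
    by (rule set_integrable_cong[THEN iffD1, rotated -1]) (auto simp: caputo_integrand_def)
qed

text \<open>Solves the inequality that describes a superlevel set of the kernel, showing that this
  set is an interval ending at \<open>t\<close>.\<close>

lemma less_inverse_powr_iff:
  fixes y z \<alpha> :: real
  assumes "y > 0" "z > 0" "\<alpha> > 0"
  shows "z < 1 / y powr \<alpha> \<longleftrightarrow> y < z powr (- 1 / \<alpha>)"
proof -
  have "(z powr (- 1 / \<alpha>)) powr \<alpha> = z powr (- 1)"
    using assms by (subst powr_powr) simp
  then have z: "(z powr (- 1 / \<alpha>)) powr \<alpha> = 1 / z"
    using assms by (simp add: powr_minus_divide)
  have "z < 1 / y powr \<alpha> \<longleftrightarrow> y powr \<alpha> < 1 / z"
    using assms by (simp add: field_simps)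
  also have "\<dots> \<longleftrightarrow> y powr \<alpha> < (z powr (- 1 / \<alpha>)) powr \<alpha>" by (simp only: z)
  also have "\<dots> \<longleftrightarrow> y < z powr (- 1 / \<alpha>)"
    using assms powr_less_mono2[of \<alpha> y "z powr (- 1 / \<alpha>)"] powr_mono2[of \<alpha> "z powr (- 1 / \<alpha>)" y]
    by (auto simp: not_le[symmetric])
  finally show ?thesis .
qed

text \<open>The kernel is an average of indicators of its superlevel sets \<open>(a, t)\<close>, and on each of those
  the integral is \<open>(v t - v a)\<^sup>2 / 2\<close>.\<close>

lemma caputo_integrand_diff_nonneg:
  assumes ac: "abs_continuous_on 0 t v" and "0 < t" "0 < \<alpha>"
    and int: "set_integrable lborel {0<..<t} (caputo_integrand \<alpha> v t)"
  shows "0 \<le> (LINT s:{0<..<t}|lborel. (v t - v s) * caputo_integrand \<alpha> v t s)"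
proof -
  define k where "k s = 1 / (t - s) powr \<alpha>" for s
  define g where "g s = indicator {0<..<t} s * ((v t - v s) * deriv v s)" for s
  have cont: "continuous_on {0..t} v" using ac by (rule abs_continuous_on_imp_continuous_on)
  have int': "set_integrable lborel {0<..<t} (deriv v)"
    using set_integrable_deriv_if_caputo_integrand[OF int \<open>0 < \<alpha>\<close>] .
  have "set_integrable lborel {0<..<t} (\<lambda>s. (v t - v s) * deriv v s)"
    using cont by (intro set_integrable_mult_continuous[OF int', of 0 t] continuous_intros) auto
  then have "integrable lborel g" by (simp add: set_integrable_def g_def[abs_def])
  then have [measurable]: "g \<in> borel_measurable borel" by auto
  have [measurable]: "k \<in> borel_measurable borel" unfolding k_def[abs_def] by measurable
  have k: "k s \<ge> 0" for s by (simp add: k_def)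
  have gk: "g s * k s = indicator {0<..<t} s *\<^sub>R ((v t - v s) * caputo_integrand \<alpha> v t s)" for s
    by (simp add: g_def k_def caputo_integrand_def)
  have "set_integrable lborel {0<..<t} (\<lambda>s. (v t - v s) * caputo_integrand \<alpha> v t s)"
    using cont by (intro set_integrable_mult_continuous[OF int, of 0 t] continuous_intros) auto
  then have gk_int: "integrable lborel (\<lambda>s. g s * k s)" by (simp add: set_integrable_def gk)
  \<comment> \<open>Layer cake: \<open>k s\<close> is the length of \<open>{0<..<k s}\<close>, so
    integrating \<open>G s z\<close> over \<open>z\<close> returns \<open>g s * k s\<close>, and
    Fubini exchanges the levels \<open>z\<close> with \<open>s\<close>.\<close>
  define G where "G s z = (if 0 < z \<and> z < k s then g s else 0)" for s z
  have G: "G s z = indicator {0<..<k s} z *\<^sub>R g s" for s z by (simp add: G_def indicator_def)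
  have [measurable]: "(\<lambda>(s, z). G s z) \<in> borel_measurable (lborel \<Otimes>\<^sub>M lborel)"
    unfolding G_def by measurable
  have Gint: "(LINT z|lborel. G s z) = g s * k s" "integrable lborel (G s)" for s
    using k[of s] unfolding G[abs_def] by (auto simp: G[abs_def] simp del: scaleR_conv_of_real)
  have "integrable (lborel \<Otimes>\<^sub>M lborel) (\<lambda>(s, z). G s z)"
  proof (rule lborel_pair.Fubini_integrable)
    have "(\<lambda>s. LINT z|lborel. norm (case (s, z) of (s, z) \<Rightarrow> G s z)) = (\<lambda>s. norm (g s * k s))"
      using k by (auto simp: G abs_mult)
    then show "integrable lborel (\<lambda>s. LINT z|lborel. norm (case (s, z) of (s, z) \<Rightarrow> G s z))"
      using gk_int by simp
  qed (use Gint(2) in auto)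
  then have "(LINT s|lborel. LINT z|lborel. G s z) = (LINT z|lborel. LINT s|lborel. G s z)"
    using lborel_pair.Fubini_integral by fastforce
  then have "(LINT s|lborel. g s * k s) = (LINT z|lborel. LINT s|lborel. G s z)" by (simp add: Gint)
  moreover have "0 \<le> (LINT s|lborel. G s z)" for z
  proof (cases "z > 0")
    case False
    then show ?thesis by (simp add: G_def)
  next
    case True
    \<comment> \<open>The left end of the superlevel set at level \<open>z\<close>, cut off at 0 for
      small levels, where the set would reach beyond the domain.\<close>
    define a where "a = max 0 (t - z powr (- 1 / \<alpha>))"
    have a: "0 \<le> a" "a \<le> t" using \<open>0 < t\<close> by (auto simp: a_def)
    have "G s z = indicator {a<..<t} s *\<^sub>R (- ((v s - v t) * deriv v s))" for s
    proof (cases "s \<in> {0<..<t}")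
      case s: True
      then have "z < k s \<longleftrightarrow> t - s < z powr (- 1 / \<alpha>)"
        using less_inverse_powr_iff[of "t - s" z \<alpha>] True \<open>0 < \<alpha>\<close> by (simp add: k_def)
      also have "\<dots> \<longleftrightarrow> a < s" using s by (auto simp: a_def)
      finally show ?thesis using True s by (simp add: G_def g_def algebra_simps)
    next
      case False
      then show ?thesis using a by (auto simp: G_def g_def indicator_def)
    qed
    then have "(LINT s|lborel. G s z) = - (LINT s:{a<..<t}|lborel. (v s - v t) * deriv v s)"
      by (simp add: set_lebesgue_integral_def)
    also have "\<dots> = (v a - v t)\<^sup>2 / 2"
    proof (subst abs_continuous_on_integral_diff_mult_deriv)
      show "abs_continuous_on a t v" using abs_continuous_on_subset[OF ac a(1)] by simp
      show "set_integrable lborel {a<..<t} (deriv v)"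
        using int' by (rule set_integrable_subset) (use a in auto)
    qed (use a in auto)
    also have "\<dots> \<ge> 0" by simp
    finally show ?thesis .
  qed
  ultimately have "0 \<le> (LINT s|lborel. g s * k s)" by simp
  then show ?thesis by (simp add: gk set_lebesgue_integral_def)
qed

text \<open>Alikhanov's inequality up to the factor 1 / Gamma (1 - \<alpha>): on the left, v v' is
  the derivative of (v^2) / 2.\<close>

lemma abs_continuous_caputo_square:
  assumes ac: "abs_continuous_on 0 t v" and "0 < t" "0 < \<alpha>"
    and int: "set_integrable lborel {0<..<t} (caputo_integrand \<alpha> v t)"
  shows "(LINT s:{0<..<t}|lborel. v s * caputo_integrand \<alpha> v t s)
     \<le> v t * (LINT s:{0<..<t}|lborel. caputo_integrand \<alpha> v t s)"
proof -
  have cont: "continuous_on {0..t} v" using ac by (rule abs_continuous_on_imp_continuous_on)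
  have "set_integrable lborel {0<..<t} (\<lambda>s. v s * caputo_integrand \<alpha> v t s)"
    using cont by (intro set_integrable_mult_continuous[OF int, of 0 t]) auto
  moreover have "set_integrable lborel {0<..<t} (\<lambda>s. v t * caputo_integrand \<alpha> v t s)"
    using int by simp
  ultimately have "(LINT s:{0<..<t}|lborel. (v t - v s) * caputo_integrand \<alpha> v t s) =
    v t * (LINT s:{0<..<t}|lborel. caputo_integrand \<alpha> v t s) - (LINT s:{0<..<t}|lborel. v s * caputo_integrand \<alpha> v t s)"
    by (simp add: left_diff_distrib set_integral_diff)
  then show ?thesis using caputo_integrand_diff_nonneg[OF assms] by simp
qed

section \<open>Riemann-Liouville integrals of Caputo derivatives\<close>

lemma RL_kernel_integral:
  fixes t \<alpha> :: real
  assumes "\<alpha> > 0" "a \<le> t"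
  shows "set_integrable lborel {a<..<t} (\<lambda>s. 1 / (t - s) powr (1 - \<alpha>))"
    and "(LINT s:{a<..<t}|lborel. 1 / (t - s) powr (1 - \<alpha>)) = (t - a) powr \<alpha> / \<alpha>"
proof -
  have eq: "indicator {a<..<t} s * (t - s) powr (\<alpha> - 1) = indicator {a<..<t} s *\<^sub>R (1 / (t - s) powr (1 - \<alpha>))" for s
    using powr_minus_divide[of "t - s" "1 - \<alpha>"] by simp
  have "has_bochner_integral lborel (\<lambda>s. indicator {a<..<t} s * (t - s) powr (\<alpha> - 1)) ((t - a) powr \<alpha> / \<alpha>)"
    using nn_integral_powr_kernel[OF assms] assms(1) by (intro has_bochner_integral_nn_integral) auto
  then show "set_integrable lborel {a<..<t} (\<lambda>s. 1 / (t - s) powr (1 - \<alpha>))"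
    "(LINT s:{a<..<t}|lborel. 1 / (t - s) powr (1 - \<alpha>)) = (t - a) powr \<alpha> / \<alpha>"
    unfolding eq has_bochner_integral_iff set_integrable_def set_lebesgue_integral_def by auto
qed

lemma set_integrable_RL_kernel_mult:
  fixes \<alpha> t T :: real
  assumes "\<alpha> > 0" "continuous_on {0..T} g" "0 \<le> t" "t \<le> T"
  shows "set_integrable lborel {0<..<t} (\<lambda>s. g s / (t - s) powr (1 - \<alpha>))"
proof -
  have "set_integrable lborel {0<..<t} (\<lambda>s. g s * (1 / (t - s) powr (1 - \<alpha>)))"
    using assms by (intro set_integrable_mult_continuous[OF RL_kernel_integral(1) assms(2)]) auto
  then show ?thesis by simp
qed

text \<open>The Cauchy-Schwarz inequality for the measure with density \<open>k\<close>, whose mass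
  \<open>K\<close> is at most T^\<alpha> / \<alpha>. It lets square integrability pass from
  \<open>g\<close> to \<open>u\<close>.\<close>

lemma RL_integral_power2_le:
  fixes \<alpha> t T :: real
  assumes "\<alpha> > 0" "continuous_on {0..T} g" "0 \<le> t" "t \<le> T"
  shows "(RL_integral \<alpha> g t)\<^sup>2 \<le> T powr \<alpha> / (\<alpha> * Gamma \<alpha>) * RL_integral \<alpha> (\<lambda>s. (g s)\<^sup>2) t"
proof (cases "t = 0")
  case True
  then show ?thesis by (simp add: RL_integral_def set_lebesgue_integral_def)
next
  case False
  then have "t > 0" using assms by simp
  define K where "K = t powr \<alpha> / \<alpha>"
  have "K > 0" using \<open>t > 0\<close> \<open>\<alpha> > 0\<close> by (simp add: K_def)
  have "Gamma \<alpha> > 0" using assms by (simp add: Gamma_real_pos)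
  define k where "k s = 1 / (t - s) powr (1 - \<alpha>)" for s
  define I where "I = (LINT s:{0<..<t}|lborel. g s * k s)"
  define J where "J = (LINT s:{0<..<t}|lborel. (g s)\<^sup>2 * k s)"
  have int: "set_integrable lborel {0<..<t} (\<lambda>s. h s * k s)" if "continuous_on {0..T} h" for h
    using set_integrable_RL_kernel_mult[OF \<open>\<alpha> > 0\<close> that] assms by (simp add: k_def)
  have ints: "set_integrable lborel {0<..<t} (\<lambda>s. (g s)\<^sup>2 * k s)"
    "set_integrable lborel {0<..<t} (\<lambda>s. g s * k s)" "set_integrable lborel {0<..<t} k"
    using int[of "\<lambda>_. 1"] assms by (auto intro!: int continuous_intros)
  have K: "(LINT s:{0<..<t}|lborel. k s) = K"
    using RL_kernel_integral(2)[of \<alpha> 0 t] assms by (simp add: k_def K_def)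
  \<comment> \<open>\<open>I / K\<close> is the mean of \<open>g\<close> under this measure;
    expanding the nonnegative variance gives I^2 \<le> K J.\<close>
  have "0 \<le> (LINT s:{0<..<t}|lborel. (g s - I / K)\<^sup>2 * k s)"
    unfolding set_lebesgue_integral_def by (intro Bochner_Integration.integral_nonneg) (simp add: k_def)
  also have "\<dots> = (LINT s:{0<..<t}|lborel. (g s)\<^sup>2 * k s - 2 * (I / K) * (g s * k s) + (I / K)\<^sup>2 * k s)"
    by (intro set_lebesgue_integral_cong) (auto simp: power2_eq_square algebra_simps)
  also have "\<dots> = J - 2 * (I / K) * I + (I / K)\<^sup>2 * K"
    using ints by (simp add: set_integral_add set_integral_diff I_def J_def K)
  also have "\<dots> = J - I\<^sup>2 / K" using \<open>K > 0\<close> by (simp add: power2_eq_square field_simps)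
  finally have IJ: "I\<^sup>2 \<le> K * J" using \<open>K > 0\<close> by (simp add: field_simps)
  have "0 \<le> J"
    unfolding J_def set_lebesgue_integral_def by (intro Bochner_Integration.integral_nonneg) (simp add: k_def)
  have "K \<le> T powr \<alpha> / \<alpha>" using assms by (auto simp: K_def intro!: divide_right_mono powr_mono2)
  have "(RL_integral \<alpha> g t)\<^sup>2 = I\<^sup>2 / (Gamma \<alpha>)\<^sup>2"
    by (simp add: RL_integral_def I_def k_def power_divide)
  also have "\<dots> \<le> K * J / (Gamma \<alpha>)\<^sup>2" using IJ by (intro divide_right_mono) auto
  also have "\<dots> \<le> (T powr \<alpha> / \<alpha>) * J / (Gamma \<alpha>)\<^sup>2"
    using \<open>K \<le> _\<close> \<open>0 \<le> J\<close> by (intro divide_right_mono mult_right_mono) auto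
  also have "\<dots> = T powr \<alpha> / (\<alpha> * Gamma \<alpha>) * RL_integral \<alpha> (\<lambda>s. (g s)\<^sup>2) t"
    by (simp add: RL_integral_def J_def k_def power2_eq_square)
  finally show ?thesis .
qed

lemma caputo_eq_integral:
  assumes "t > 0"
  shows "caputo \<alpha> v t = 1 / Gamma (1 - \<alpha>) * (LINT s:{0<..<t}|lborel. caputo_integrand \<alpha> v t s)"
  using assms by (simp add: caputo_def)

context
  fixes T \<alpha> :: real and v :: "real \<Rightarrow> real"
  assumes \<alpha>: "0 < \<alpha>" "\<alpha> < 1"
    and ac: "abs_continuous_on 0 T v"
    and cc: "caputo_continuous T \<alpha> v"
begin

lemma caputo_integrand_integrable:
  "t \<in> {0<..T} \<Longrightarrow> set_integrable lborel {0<..<t} (caputo_integrand \<alpha> v t)"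
  using cc by (simp add: caputo_continuous_def)

lemma continuous_on_caputo: "continuous_on {0..T} (caputo \<alpha> v)"
  using cc by (simp add: caputo_continuous_def)

text \<open>The Caputo derivative is I^(1-\<alpha>) applied to v', so Abel inversion leaves the
  plain integral of v', to which the fundamental theorem applies.\<close>

theorem RL_integral_caputo:
  assumes t: "t \<in> {0..T}"
  shows "v t = v 0 + RL_integral \<alpha> (caputo \<alpha> v) t"
proof (cases "t = 0")
  case True
  then show ?thesis by (simp add: RL_integral_def set_lebesgue_integral_def)
next
  case False
  with t have t': "t \<in> {0<..T}" by simp
  have int: "set_integrable lborel {0<..<t} (deriv v)"
    using set_integrable_deriv_if_caputo_integrand[OF caputo_integrand_integrable[OF t']] \<alpha> by simp
  have \<Gamma>: "Gamma \<alpha> > 0" "Gamma (1 - \<alpha>) > 0" using \<alpha> by (auto simp: Gamma_real_pos)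
  have "(LINT r:{0<..<t}|lborel. caputo \<alpha> v r / (t - r) powr (1 - \<alpha>)) =
    (LINT r:{0<..<t}|lborel. 1 / Gamma (1 - \<alpha>) *
       ((LINT s:{0<..<r}|lborel. deriv v s / (r - s) powr \<alpha>) / (t - r) powr (1 - \<alpha>)))"
    by (intro set_lebesgue_integral_cong) (auto simp: caputo_eq_integral caputo_integrand_def[abs_def])
  also have "\<dots> = 1 / Gamma (1 - \<alpha>) * (Gamma \<alpha> * Gamma (1 - \<alpha>) * (LINT s:{0<..<t}|lborel. deriv v s))"
    by (simp only: set_integral_mult_right Abel_inversion(2)[OF \<alpha> int])
  also have "(LINT s:{0<..<t}|lborel. deriv v s) = v t - v 0"
    using abs_continuous_on_integral_deriv[of 0 t v] abs_continuous_on_subset[OF ac, of 0 t] int t by simp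
  finally show ?thesis using \<Gamma> by (simp add: RL_integral_def)
qed

text \<open>Abel inversion is read backwards for v v': half the increment of v^2 becomes I^\<alpha>
  I^(1-\<alpha>) (v v'). Alikhanov's inequality then acts at each \<open>r\<close> under the
  positive outer kernel.\<close>

theorem power2_le_RL_integral_mult_caputo:
  assumes t: "t \<in> {0<..T}"
  shows "((v t)\<^sup>2 - (v 0)\<^sup>2) / 2 \<le> RL_integral \<alpha> (\<lambda>s. v s * caputo \<alpha> v s) t"
proof -
  have \<Gamma>: "Gamma \<alpha> > 0" "Gamma (1 - \<alpha>) > 0" using \<alpha> by (auto simp: Gamma_real_pos)
  have ac_t: "abs_continuous_on 0 r v" if "r \<le> T" for r
    using abs_continuous_on_subset[OF ac, of 0 r] that by simp
  have cont: "continuous_on {0..T} v" using ac by (rule abs_continuous_on_imp_continuous_on)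
  have int: "set_integrable lborel {0<..<t} (deriv v)"
    using set_integrable_deriv_if_caputo_integrand[OF caputo_integrand_integrable[OF t]] \<alpha> by simp
  have int2: "set_integrable lborel {0<..<t} (\<lambda>s. v s * deriv v s)"
    using t by (intro set_integrable_mult_continuous[OF int cont]) auto
  have "Gamma \<alpha> * Gamma (1 - \<alpha>) * (((v t)\<^sup>2 - (v 0)\<^sup>2) / 2) =
      Gamma \<alpha> * Gamma (1 - \<alpha>) * (LINT s:{0<..<t}|lborel. v s * deriv v s)"
    using abs_continuous_on_integral_diff_mult_deriv[OF ac_t, of t 0] int t by simp
  also have "\<dots> = (LINT r:{0<..<t}|lborel. (LINT s:{0<..<r}|lborel. v s * deriv v s / (r - s) powr \<alpha>) / (t - r) powr (1 - \<alpha>))"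
    using Abel_inversion(2)[OF \<alpha> int2] by simp
  also have "\<dots> \<le> (LINT r:{0<..<t}|lborel. Gamma (1 - \<alpha>) * ((v r * caputo \<alpha> v r) / (t - r) powr (1 - \<alpha>)))"
  proof (rule set_integral_mono)
    show "set_integrable lborel {0<..<t} (\<lambda>r. (LINT s:{0<..<r}|lborel. v s * deriv v s / (r - s) powr \<alpha>) / (t - r) powr (1 - \<alpha>))"
      using Abel_inversion(1)[OF \<alpha> int2] .
    show "set_integrable lborel {0<..<t} (\<lambda>r. Gamma (1 - \<alpha>) * ((v r * caputo \<alpha> v r) / (t - r) powr (1 - \<alpha>)))"
      using t cont continuous_on_caputo
      by (intro set_integrable_mult_right set_integrable_RL_kernel_mult[OF \<alpha>(1), of T] continuous_on_mult) auto
    fix r assume r: "r \<in> {0<..<t}"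
    then have r': "r \<in> {0<..T}" using t by auto
    have "(LINT s:{0<..<r}|lborel. v s * deriv v s / (r - s) powr \<alpha>) \<le> v r * (LINT s:{0<..<r}|lborel. caputo_integrand \<alpha> v r s)"
      using abs_continuous_caputo_square[OF ac_t _ \<alpha>(1) caputo_integrand_integrable[OF r']] r r'
      by (simp add: caputo_integrand_def)
    also have "\<dots> = Gamma (1 - \<alpha>) * (v r * caputo \<alpha> v r)"
      using r \<Gamma> by (simp add: caputo_eq_integral)
    finally show "(LINT s:{0<..<r}|lborel. v s * deriv v s / (r - s) powr \<alpha>) / (t - r) powr (1 - \<alpha>)
      \<le> Gamma (1 - \<alpha>) * ((v r * caputo \<alpha> v r) / (t - r) powr (1 - \<alpha>))"
      unfolding times_divide_eq_right by (intro divide_right_mono) auto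
  qed
  also have "\<dots> = Gamma (1 - \<alpha>) * (LINT r:{0<..<t}|lborel. (v r * caputo \<alpha> v r) / (t - r) powr (1 - \<alpha>))"
    by (rule set_integral_mult_right)
  also have "\<dots> = Gamma \<alpha> * Gamma (1 - \<alpha>) * RL_integral \<alpha> (\<lambda>s. v s * caputo \<alpha> v s) t"
    using \<Gamma> by (simp add: RL_integral_def)
  finally show ?thesis using \<Gamma> by simp
qed

text \<open>From (a + b)^2 \<le> 2 a^2 + 2 b^2 and Cauchy-Schwarz. A crude bound, meant for
  integrability of u^2 and not for the estimate itself.\<close>

lemma power2_le_RL_integral_caputo_power2:
  assumes t: "t \<in> {0..T}"
  shows "(v t)\<^sup>2 \<le> 2 * (v 0)\<^sup>2 + 2 * (T powr \<alpha> / (\<alpha> * Gamma \<alpha>)) * RL_integral \<alpha> (\<lambda>s. (caputo \<alpha> v s)\<^sup>2) t"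
proof -
  have "(v t)\<^sup>2 \<le> 2 * (v 0)\<^sup>2 + 2 * (RL_integral \<alpha> (caputo \<alpha> v) t)\<^sup>2"
    unfolding RL_integral_caputo[OF t]
    using zero_le_power2[of "v 0 - RL_integral \<alpha> (caputo \<alpha> v) t"] by (simp add: power2_eq_square algebra_simps)
  then show ?thesis
    using RL_integral_power2_le[OF \<alpha>(1) continuous_on_caputo, of t] t by simp
qed

end

section \<open>Wirtinger's inequality\<close>

text \<open>L'Hospital's rule in its simplest form, with derivatives at the limit point only. It
  controls u / sin at the ends of the interval.\<close>

lemma tendsto_divide_at_common_zero:
  fixes u s :: "real \<Rightarrow> real"
  assumes "(u has_real_derivative u') (at e within A)" "(s has_real_derivative s') (at e within A)"
    and "u e = 0" "s e = 0" "s' \<noteq> 0"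
  shows "((\<lambda>x. u x / s x) \<longlongrightarrow> u' / s') (at e within A)"
proof -
  have "((\<lambda>x. ((u x - u e) / (x - e)) / ((s x - s e) / (x - e))) \<longlongrightarrow> u' / s') (at e within A)"
    using assms by (intro tendsto_divide) (auto simp: has_field_derivative_iff)
  moreover have "\<forall>\<^sub>F x in at e within A. ((u x - u e) / (x - e)) / ((s x - s e) / (x - e)) = u x / s x"
    by (auto simp: eventually_at_filter assms)
  ultimately show ?thesis by (rule Lim_transform_eventually)
qed

text \<open>With \<open>c = pi / l\<close>, Jacobi's trick \<open>(u' - c u cot (c x))\<^sup>2 \<ge> 0\<close> says that \<open>u u'' + c\<^sup>2 u\<^sup>2\<close> is at most
  the derivative of \<open>u u' - c u\<^sup>2 cot (c x)\<close>, which vanishes at both end points.\<close>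

lemma Wirtinger_inequality:
  fixes u u' u'' :: "real \<Rightarrow> real" and l :: real
  defines "c \<equiv> pi / l"
  assumes "l > 0"
    and u': "\<And>x. x \<in> {0..l} \<Longrightarrow> (u has_real_derivative u' x) (at x within {0..l})"
    and u'': "\<And>x. x \<in> {0..l} \<Longrightarrow> (u' has_real_derivative u'' x) (at x within {0..l})"
    and cont: "continuous_on {0..l} u''"
    and "u 0 = 0" "u l = 0"
  shows "integral {0..l} (\<lambda>x. u x * u'' x + c\<^sup>2 * (u x)\<^sup>2) \<le> 0"
proof -
  define \<psi> where "\<psi> x = u x * u'' x + c\<^sup>2 * (u x)\<^sup>2" for x
  \<comment> \<open>Grouped so that \<open>u x / sin (c * x)\<close> has a finite limit at each end,
    while the separate factor \<open>u x\<close> sends the product to 0.\<close>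
  define M where "M x = u x * u' x - c * (u x / sin (c * x)) * u x * cos (c * x)" for x
  define \<Phi> where "\<Phi> x = M x - integral {0..x} \<psi>" for x
  have "c > 0" using \<open>l > 0\<close> by (simp add: c_def)
  \<comment> \<open>This puts two consecutive zeros of sin (c x) at the ends, where \<open>u\<close>
    vanishes too; inside, the cotangent is smooth.\<close>
  have cl: "c * l = pi" using \<open>l > 0\<close> by (simp add: c_def)
  have sin_pos: "sin (c * x) > 0" if "0 < x" "x < l" for x
    using that \<open>c > 0\<close> cl mult_strict_left_mono[of x l c] by (intro sin_gt_zero) auto
  have cu: "continuous_on {0..l} u" using u' by (rule DERIV_continuous_on)
  have cu': "continuous_on {0..l} u'" using u'' by (rule DERIV_continuous_on)
  have c\<psi>: "continuous_on {0..l} \<psi>" unfolding \<psi>_def using cu cont by (intro continuous_intros)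
  have lim: "(M \<longlongrightarrow> 0) (at e within {0..l})" if e: "e \<in> {0, l}" for e
  proof -
    have "e \<in> {0..l}" "u e = 0" using e \<open>l > 0\<close> assms by auto
    have "((\<lambda>x. sin (c * x)) has_real_derivative c * cos (c * e)) (at e within {0..l})"
      by (auto intro!: derivative_eq_intros)
    moreover have "sin (c * e) = 0" "c * cos (c * e) \<noteq> 0" using e cl \<open>c > 0\<close> by auto
    ultimately have q: "((\<lambda>x. u x / sin (c * x)) \<longlongrightarrow> u' e / (c * cos (c * e))) (at e within {0..l})"
      using u'[OF \<open>e \<in> {0..l}\<close>] \<open>u e = 0\<close> by (intro tendsto_divide_at_common_zero)
    have "(u \<longlongrightarrow> u e) (at e within {0..l})" "(u' \<longlongrightarrow> u' e) (at e within {0..l})"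
      using cu cu' \<open>e \<in> {0..l}\<close> by (auto simp: continuous_on_def)
    then have "(M \<longlongrightarrow> u e * u' e - c * (u' e / (c * cos (c * e))) * u e * cos (c * e)) (at e within {0..l})"
      unfolding M_def by (intro tendsto_intros q)
    then show ?thesis using \<open>u e = 0\<close> by simp
  qed
  have M0: "M 0 = 0" "M l = 0" using assms by (auto simp: M_def)
  have cM: "continuous_on {0..l} M"
    unfolding continuous_on_def
  proof
    fix x assume x: "x \<in> {0..l}"
    show "(M \<longlongrightarrow> M x) (at x within {0..l})"
    proof (cases "x \<in> {0, l}")
      case True
      then show ?thesis using lim[OF True] M0 by auto
    next
      case False
      have "(u \<longlongrightarrow> u x) (at x within {0..l})" "(u' \<longlongrightarrow> u' x) (at x within {0..l})"
        using cu cu' x by (auto simp: continuous_on_def)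
      moreover have "sin (c * x) \<noteq> 0" using sin_pos[of x] False x by auto
      ultimately show ?thesis unfolding M_def by (intro tendsto_intros)
    qed
  qed
  \<comment> \<open>As \<open>M\<close> vanishes at both ends, this says that 0 is at most minus the
    integral of \<open>\<psi>\<close>.\<close>
  have "\<Phi> 0 \<le> \<Phi> l"
  proof (rule DERIV_nonneg_imp_increasing_open[of 0 l \<Phi>])
    show "0 \<le> l" using \<open>l > 0\<close> by simp
    show "continuous_on {0..l} \<Phi>"
      unfolding \<Phi>_def
      using cM indefinite_integral_continuous_1[OF integrable_continuous_real[OF c\<psi>]]
      by (intro continuous_on_diff) auto
    fix x assume x: "0 < x" "x < l"
    then have at: "at x within {0..l} = at x" by (intro at_within_interior) (auto simp: interior_atLeastAtMost_real)
    have s: "sin (c * x) \<noteq> 0" using sin_pos[OF x] by simp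
    define q where "q = cos (c * x) / sin (c * x)"
    have Du: "(u has_real_derivative u' x) (at x)" and Du': "(u' has_real_derivative u'' x) (at x)"
      using u'[of x] u''[of x] x by (auto simp: at)
    have Dq: "((\<lambda>x. cos (c * x) / sin (c * x)) has_real_derivative - c * (1 + q\<^sup>2)) (at x)"
    proof -
      have "((\<lambda>x. cos (c * x) / sin (c * x)) has_real_derivative
          (- sin (c * x) * c * sin (c * x) - cos (c * x) * (cos (c * x) * c)) / (sin (c * x) * sin (c * x))) (at x)"
        using s by (auto intro!: derivative_eq_intros)
      also have "(- sin (c * x) * c * sin (c * x) - cos (c * x) * (cos (c * x) * c)) / (sin (c * x) * sin (c * x)) = - c * (1 + q\<^sup>2)"
      proof -
        have "(- S * c * S - C * (C * c)) / (S * S) = - c * (1 + (C / S)\<^sup>2)" if "S \<noteq> 0" for S C :: real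
          using that by (simp add: field_simps power2_eq_square)
        then show ?thesis using s by (simp only: q_def)
      qed
      finally show ?thesis .
    qed
    have "((\<lambda>x. u x * u' x - c * ((u x)\<^sup>2 * (cos (c * x) / sin (c * x)))) has_real_derivative
        (u' x * u' x + u'' x * u x) - c * (2 * u x * u' x * q + (- c * (1 + q\<^sup>2)) * (u x)\<^sup>2)) (at x)"
      by (rule derivative_eq_intros Du Du' Dq refl | simp add: q_def)+
    moreover have "M = (\<lambda>x. u x * u' x - c * ((u x)\<^sup>2 * (cos (c * x) / sin (c * x))))"
      by (auto simp: M_def power2_eq_square)
    ultimately have DM: "(M has_real_derivative
        (u' x * u' x + u'' x * u x) - c * (2 * u x * u' x * q + (- c * (1 + q\<^sup>2)) * (u x)\<^sup>2)) (at x)"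
      by simp
    have "((\<lambda>x. integral {0..x} \<psi>) has_real_derivative \<psi> x) (at x)"
      using integral_has_real_derivative[OF c\<psi>, of x] x by (simp add: at)
    then have "(\<Phi> has_real_derivative
        (u' x * u' x + u'' x * u x) - c * (2 * u x * u' x * q + (- c * (1 + q\<^sup>2)) * (u x)\<^sup>2) - \<psi> x) (at x)"
      unfolding \<Phi>_def using DM by (intro DERIV_diff)
    \<comment> \<open>The summand c^2 u^2 of \<open>\<psi>\<close> cancels the 1 in 1 + cot^2, which
      completes the square.\<close>
    moreover have "(u' x * u' x + u'' x * u x) - c * (2 * u x * u' x * q + (- c * (1 + q\<^sup>2)) * (u x)\<^sup>2) - \<psi> x
        = (u' x - c * q * u x)\<^sup>2"
      by (simp add: \<psi>_def power2_eq_square algebra_simps)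
    ultimately show "\<exists>y. (\<Phi> has_real_derivative y) (at x) \<and> 0 \<le> y" by force
  qed
  then show ?thesis unfolding \<Phi>_def M0 \<psi>_def by simp
qed

section \<open>Measurability and convergence\<close>

text \<open>Rounding \<open>t\<close> down to a grid of width 1 / (n + 1) leaves countably many
  values, each giving a function measurable in \<open>x\<close>; continuity in \<open>t\<close>
  gives the pointwise limit.\<close>

lemma borel_measurable_Caratheodory:
  fixes h :: "real \<Rightarrow> real \<Rightarrow> real"
  assumes cont: "\<And>x. continuous_on UNIV (h x)"
    and meas: "\<And>t. (\<lambda>x. h x t) \<in> borel_measurable borel"
  shows "(\<lambda>(x, t). h x t) \<in> borel_measurable (borel \<Otimes>\<^sub>M borel)"
proof (rule borel_measurable_LIMSEQ_real)
  let ?r = "\<lambda>n t. real_of_int \<lfloor>real (Suc n) * t\<rfloor> / real (Suc n)"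
  fix z :: "real \<times> real"
  have "(\<lambda>n. ?r n (snd z)) \<longlonglongrightarrow> snd z"
  proof (rule LIMSEQ_I)
    fix e :: real assume "e > 0"
    then obtain N where N: "1 / real (Suc N) < e" using nat_approx_posE by blast
    have "norm (?r n (snd z) - snd z) < e" if "n \<ge> N" for n
    proof -
      have "\<bar>real_of_int \<lfloor>real (Suc n) * snd z\<rfloor> - real (Suc n) * snd z\<bar> \<le> 1" by linarith
      then have "\<bar>real_of_int \<lfloor>real (Suc n) * snd z\<rfloor> - real (Suc n) * snd z\<bar> / real (Suc n) \<le> 1 / real (Suc n)"
        by (intro divide_right_mono) auto
      moreover have "?r n (snd z) - snd z = (real_of_int \<lfloor>real (Suc n) * snd z\<rfloor> - real (Suc n) * snd z) / real (Suc n)"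
        by (simp add: field_simps del: of_nat_Suc)
      moreover have "1 / real (Suc n) \<le> 1 / real (Suc N)" using that by (intro divide_left_mono) auto
      ultimately show ?thesis using N by (simp add: abs_divide del: of_nat_Suc)
    qed
    then show "\<exists>N. \<forall>n\<ge>N. norm (?r n (snd z) - snd z) < e" by blast
  qed
  moreover have "isCont (h (fst z)) (snd z)"
    using cont by (simp add: continuous_on_eq_continuous_at)
  ultimately have "(\<lambda>n. h (fst z) (?r n (snd z))) \<longlonglongrightarrow> h (fst z) (snd z)"
    using isCont_tendsto_compose by blast
  then show "(\<lambda>n. h (fst z) (?r n (snd z))) \<longlonglongrightarrow> (case z of (x, t) \<Rightarrow> h x t)"
    by (simp add: case_prod_beta)
next
  fix n
  show "(\<lambda>z. h (fst z) (real_of_int \<lfloor>real (Suc n) * snd z\<rfloor> / real (Suc n))) \<in> borel_measurable (borel \<Otimes>\<^sub>M borel)"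
  proof (rule measurable_compose_countable[where f = "\<lambda>i z. h (fst z) (real_of_int i / real (Suc n))"])
    show "(\<lambda>z. h (fst z) (real_of_int i / real (Suc n))) \<in> borel_measurable (borel \<Otimes>\<^sub>M borel)" for i
      using meas by (rule measurable_compose[OF measurable_fst])
  qed measurable
qed

text \<open>I^\<alpha> is bounded on L^1(0, T): by Tonelli the kernel is integrated in
  \<open>t\<close> first, which gives (T - s)^\<alpha> / \<alpha>.\<close>

lemma nn_integral_RL_kernel_le:
  fixes W :: "real \<Rightarrow> ennreal"
  assumes "\<alpha> > 0" "T \<ge> 0" and [measurable]: "W \<in> borel_measurable borel"
  shows "(\<integral>\<^sup>+t. indicator {0<..<T} t * (\<integral>\<^sup>+s. ennreal (indicator {0<..<t} s * (t - s) powr (\<alpha> - 1)) * W s \<partial>lborel) \<partial>lborel)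
     \<le> ennreal (T powr \<alpha> / \<alpha>) * (\<integral>\<^sup>+s. indicator {0<..<T} s * W s \<partial>lborel)"
proof -
  define k where "k t s = (if 0 < s \<and> s < t \<and> t < T then ennreal ((t - s) powr (\<alpha> - 1)) else 0)" for t s
  have [measurable]: "(\<lambda>(t, s). k t s * W s) \<in> borel_measurable (lborel \<Otimes>\<^sub>M lborel)"
    unfolding k_def by measurable
  have [measurable]: "(\<lambda>t. k t s) \<in> borel_measurable lborel" for s unfolding k_def by measurable
  have [measurable]: "k t \<in> borel_measurable lborel" for t unfolding k_def by measurable
  have "(\<integral>\<^sup>+t. indicator {0<..<T} t * (\<integral>\<^sup>+s. ennreal (indicator {0<..<t} s * (t - s) powr (\<alpha> - 1)) * W s \<partial>lborel) \<partial>lborel)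
      = (\<integral>\<^sup>+t. \<integral>\<^sup>+s. k t s * W s \<partial>lborel \<partial>lborel)"
  proof (rule nn_integral_cong)
    fix t
    have "indicator {0<..<T} t * (\<integral>\<^sup>+s. ennreal (indicator {0<..<t} s * (t - s) powr (\<alpha> - 1)) * W s \<partial>lborel)
      = (\<integral>\<^sup>+s. indicator {0<..<T} t * (ennreal (indicator {0<..<t} s * (t - s) powr (\<alpha> - 1)) * W s) \<partial>lborel)"
      by (rule nn_integral_cmult[symmetric]) measurable
    also have "\<dots> = (\<integral>\<^sup>+s. k t s * W s \<partial>lborel)"
      by (intro nn_integral_cong) (auto simp: k_def indicator_def)
    finally show "indicator {0<..<T} t * (\<integral>\<^sup>+s. ennreal (indicator {0<..<t} s * (t - s) powr (\<alpha> - 1)) * W s \<partial>lborel)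
      = (\<integral>\<^sup>+s. k t s * W s \<partial>lborel)" .
  qed
  also have "\<dots> = (\<integral>\<^sup>+s. \<integral>\<^sup>+t. k t s * W s \<partial>lborel \<partial>lborel)"
    by (rule lborel_pair.Fubini'[symmetric]) measurable
  also have "\<dots> \<le> (\<integral>\<^sup>+s. ennreal (T powr \<alpha> / \<alpha>) * (indicator {0<..<T} s * W s) \<partial>lborel)"
  proof (rule nn_integral_mono)
    fix s :: real
    have "(\<integral>\<^sup>+t. k t s * W s \<partial>lborel) = (\<integral>\<^sup>+t. k t s \<partial>lborel) * W s"
      by (rule nn_integral_multc) measurable
    also have "(\<integral>\<^sup>+t. k t s \<partial>lborel) \<le> ennreal (T powr \<alpha> / \<alpha>) * indicator {0<..<T} s"
    proof (cases "s \<in> {0<..<T}")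
      case False
      then have "k t s = 0" for t by (auto simp: k_def)
      then show ?thesis by simp
    next
      case True
      \<comment> \<open>The reflection of (s, T) onto itself moves the singularity from
        \<open>s\<close> to \<open>T\<close>, the form in which the kernel integral is
        known.\<close>
      have "(\<integral>\<^sup>+t. k t s \<partial>lborel) = (\<integral>\<^sup>+x. k (s + T + (-1) * x) s \<partial>lborel)"
        by (subst nn_integral_real_affine[of _ "-1" "s + T"]) auto
      also have "\<dots> = (\<integral>\<^sup>+x. ennreal (indicator {s<..<T} x * (T - x) powr (\<alpha> - 1)) \<partial>lborel)"
        using True by (intro nn_integral_cong) (auto simp: k_def indicator_def)
      also have "\<dots> = ennreal ((T - s) powr \<alpha> / \<alpha>)"
        using nn_integral_powr_kernel[of \<alpha> s T] assms True by simp
      also have "\<dots> \<le> ennreal (T powr \<alpha> / \<alpha>)"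
        using True assms by (intro ennreal_leI divide_right_mono powr_mono2) auto
      finally show ?thesis using True by simp
    qed
    finally show "(\<integral>\<^sup>+t. k t s * W s \<partial>lborel) \<le> ennreal (T powr \<alpha> / \<alpha>) * (indicator {0<..<T} s * W s)"
      by (simp add: mult.assoc mult_right_mono)
  qed
  also have "\<dots> = ennreal (T powr \<alpha> / \<alpha>) * (\<integral>\<^sup>+s. indicator {0<..<T} s * W s \<partial>lborel)"
    by (rule nn_integral_cmult) measurable
  finally show ?thesis .
qed

text \<open>The singularity of the kernel moves with the upper limit. Substituting r = \<tau> - s
  fixes it at 0, and approach from the left gives the common majorant M r^(\<alpha>-1) on (0, t).
  The clamped extension \<open>h'\<close> is continuous on the whole line, so the shifted arguments
  need no case split.\<close>

lemma RL_integral_tendsto_left: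
  fixes h :: "real \<Rightarrow> real"
  assumes "\<alpha> > 0" and cont: "continuous_on {0..T} h" and t: "0 \<le> t" "t \<le> T"
    and tn: "\<And>n. 0 \<le> \<tau> n \<and> \<tau> n \<le> t" "\<tau> \<longlonglongrightarrow> t"
  shows "(\<lambda>n. RL_integral \<alpha> h (\<tau> n)) \<longlonglongrightarrow> RL_integral \<alpha> h t"
proof -
  define h' where "h' s = h (max 0 (min T s))" for s
  have ch': "continuous_on UNIV h'"
    unfolding h'_def
    by (rule continuous_on_compose2[OF cont]) (use t in \<open>auto intro!: continuous_intros\<close>)
  then have [measurable]: "h' \<in> borel_measurable borel" by (rule borel_measurable_continuous_onI)
  obtain M where M: "\<And>s. s \<in> {0..T} \<Longrightarrow> \<bar>h s\<bar> \<le> M" using continuous_on_Icc_abs_bounded[OF cont] by blast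
  have M': "\<bar>h' s\<bar> \<le> M" for s using M t by (auto simp: h'_def)
  define K where "K \<tau> r = indicator {0<..<\<tau>} r * (h' (\<tau> - r) * r powr (\<alpha> - 1))" for \<tau> r :: real
  have RL: "RL_integral \<alpha> h \<tau> = 1 / Gamma \<alpha> * (LINT r|lborel. K \<tau> r)" if "0 \<le> \<tau>" "\<tau> \<le> T" for \<tau>
  proof -
    have "(LINT s:{0<..<\<tau>}|lborel. h s / (\<tau> - s) powr (1 - \<alpha>)) =
       (LINT s|lborel. indicator {0<..<\<tau>} s *\<^sub>R (h' s / (\<tau> - s) powr (1 - \<alpha>)))"
      unfolding set_lebesgue_integral_def using that
      by (intro Bochner_Integration.integral_cong) (auto simp: h'_def indicator_def)
    also have "\<dots> = (LINT r|lborel. indicator {0<..<\<tau>} (\<tau> + (-1) * r) *\<^sub>R (h' (\<tau> + (-1) * r) / (\<tau> - (\<tau> + (-1) * r)) powr (1 - \<alpha>)))"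
      by (subst lborel_integral_real_affine[of "-1" _ \<tau>]) auto
    also have "\<dots> = (LINT r|lborel. K \<tau> r)"
    proof (intro Bochner_Integration.integral_cong refl)
      fix r :: real
      show "indicator {0<..<\<tau>} (\<tau> + (-1) * r) *\<^sub>R (h' (\<tau> + (-1) * r) / (\<tau> - (\<tau> + (-1) * r)) powr (1 - \<alpha>)) = K \<tau> r"
        using powr_minus_divide[of r "1 - \<alpha>"] by (auto simp: K_def indicator_def)
    qed
    finally show ?thesis by (simp add: RL_integral_def)
  qed
  have "(\<lambda>n. LINT r|lborel. K (\<tau> n) r) \<longlonglongrightarrow> (LINT r|lborel. K t r)"
  proof (rule integral_dominated_convergence)
    show "K t \<in> borel_measurable lborel" "\<And>n. K (\<tau> n) \<in> borel_measurable lborel"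
      unfolding K_def by measurable
    have "(\<integral>\<^sup>+r. ennreal (indicator {0<..<t} r * r powr (\<alpha> - 1)) \<partial>lborel) = ennreal (t powr \<alpha> / \<alpha>)"
      by (rule nn_integral_has_integral_lebesgue)
         (use has_integral_powr_from_0[of "\<alpha> - 1" t] assms in \<open>auto simp: has_integral_Icc_iff_Ioo\<close>)
    then have "integrable lborel (\<lambda>r. indicator {0<..<t} r * r powr (\<alpha> - 1))"
      by (intro integrableI_nonneg) auto
    then show "integrable lborel (\<lambda>r. M * (indicator {0<..<t} r * r powr (\<alpha> - 1)))" by simp
    show "AE r in lborel. norm (K (\<tau> n) r) \<le> M * (indicator {0<..<t} r * r powr (\<alpha> - 1))" for n
    proof (rule AE_I2)
      fix r
      have "\<bar>h' (\<tau> n - r)\<bar> * r powr (\<alpha> - 1) \<le> M * r powr (\<alpha> - 1)" "0 \<le> M * r powr (\<alpha> - 1)"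
        using M'[of "\<tau> n - r"] by (auto intro!: mult_right_mono mult_nonneg_nonneg)
      then show "norm (K (\<tau> n) r) \<le> M * (indicator {0<..<t} r * r powr (\<alpha> - 1))"
        using tn(1)[of n] by (auto simp: K_def indicator_def abs_mult)
    qed
    show "AE r in lborel. (\<lambda>n. K (\<tau> n) r) \<longlonglongrightarrow> K t r"
    proof (rule AE_I2)
      fix r
      show "(\<lambda>n. K (\<tau> n) r) \<longlonglongrightarrow> K t r"
      proof (cases "0 < r \<and> r < t")
        case False
        then have "K (\<tau> n) r = 0" "K t r = 0" for n
          using tn(1)[of n] by (auto simp: K_def indicator_def)
        then show ?thesis by simp
      next
        case True
        have "isCont h' (t - r)" using ch' by (simp add: continuous_on_eq_continuous_at)
        moreover have "(\<lambda>n. \<tau> n - r) \<longlonglongrightarrow> t - r" using tn(2) by (intro tendsto_intros)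
        ultimately have "(\<lambda>n. h' (\<tau> n - r)) \<longlonglongrightarrow> h' (t - r)" by (rule isCont_tendsto_compose)
        then have "(\<lambda>n. h' (\<tau> n - r) * r powr (\<alpha> - 1)) \<longlonglongrightarrow> K t r"
          using True by (auto simp: K_def intro!: tendsto_mult_right)
        moreover have "\<forall>\<^sub>F n in sequentially. h' (\<tau> n - r) * r powr (\<alpha> - 1) = K (\<tau> n) r"
          using order_tendstoD(1)[OF tn(2), of r] True by (auto simp: K_def elim!: eventually_mono)
        ultimately show ?thesis by (rule Lim_transform_eventually)
      qed
    qed
  qed
  moreover have "RL_integral \<alpha> h (\<tau> n) = 1 / Gamma \<alpha> * (LINT r|lborel. K (\<tau> n) r)" for n
    using RL[of "\<tau> n"] tn(1)[of n] t by auto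
  ultimately show ?thesis unfolding RL[OF t] by (simp only: tendsto_mult_left)
qed

lemma AE_lborel_Ioo_exists:
  fixes a b :: real
  assumes "AE t in lborel. P t" "a < b"
  obtains t where "t \<in> {a<..<b}" "P t"
proof -
  have "\<not> (\<forall>t\<in>{a<..<b}. \<not> P t)"
  proof
    assume "\<forall>t\<in>{a<..<b}. \<not> P t"
    then have "AE t in lborel. t \<notin> {a<..<b}" using assms(1) by (auto elim!: eventually_mono)
    then have "{a<..<b} \<in> null_sets lborel" by (subst (asm) AE_iff_null_sets[symmetric]) auto
    then show False using assms(2) by (simp add: null_sets_def)
  qed
  then show thesis using that by blast
qed

section \<open>The energy estimate\<close>

lemma set_integrable_continuous_Icc:
  fixes \<psi> :: "real \<Rightarrow> real"
  assumes "continuous_on {a..b} \<psi>"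
  shows "set_integrable lborel {a..b} \<psi>"
  unfolding set_integrable_def using assms by (intro borel_integrable_compact) auto

lemma set_integral_Icc_eq_Ioo:
  fixes \<psi> :: "real \<Rightarrow> real"
  shows "(LINT x:{a..b}|lborel. \<psi> x) = (LINT x:{a<..<b}|lborel. \<psi> x)"
  by (rule set_integral_discrete_difference[of "{a, b}"]) auto

lemma L2_norm_sq_eq_integral:
  assumes "continuous_on {0..l} \<psi>"
  shows "L2_norm_sq l \<psi> = integral {0..l} (\<lambda>x. (\<psi> x)\<^sup>2)"
  unfolding L2_norm_sq_def
  using set_borel_integral_eq_integral(2)[OF set_integrable_continuous_Icc, of 0 l "\<lambda>x. (\<psi> x)\<^sup>2"] assms
  by (simp add: continuous_on_power)

locale Dirichlet_solution =
  fixes l T \<alpha> :: real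
    and p \<phi> :: "real \<Rightarrow> real"
    and f u :: "real \<Rightarrow> real \<Rightarrow> real"
  assumes l: "l > 0" and T: "T > 0" and \<alpha>: "0 < \<alpha>" "\<alpha> < 1"
    and p_nonneg: "\<And>t. t \<in> {0..T} \<Longrightarrow> p t \<ge> 0"
    and f_cont: "continuous_on (closure (Q l T)) (\<lambda>(x, t). f x t)"
    and sol: "is_solution l T \<alpha> p f \<phi> u"
    and sq_int: "caputo_square_integrable l T \<alpha> u"
begin

abbreviation g :: "real \<Rightarrow> real \<Rightarrow> real" where "g x \<equiv> caputo \<alpha> (u x)"
abbreviation E :: "real \<Rightarrow> real" where "E t \<equiv> L2_norm_sq l (\<lambda>x. u x t)"
abbreviation F :: "real \<Rightarrow> real" where "F t \<equiv> L2_norm_sq l (\<lambda>x. f x t)"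

lemma ac: "x \<in> {0..l} \<Longrightarrow> abs_continuous_on 0 T (u x)"
  and cc: "x \<in> {0..l} \<Longrightarrow> caputo_continuous T \<alpha> (u x)"
  and boundary: "t \<in> {0..T} \<Longrightarrow> u 0 t = 0" "t \<in> {0..T} \<Longrightarrow> u l t = 0"
  using sol by (auto simp: is_solution_def)

lemma closure_Q: "closure (Q l T) = {0..l} \<times> {0..T}"
  using l by (simp add: Q_def closure_Times)

lemma f_slice: "t \<in> {0..T} \<Longrightarrow> continuous_on {0..l} (\<lambda>x. f x t)"
  using f_cont unfolding closure_Q
  by (intro continuous_on_compose2[OF f_cont[unfolded closure_Q], of _ "\<lambda>x. (x, t)", simplified])
     (auto intro!: continuous_intros)

lemma u_slice: "t \<in> {0..T} \<Longrightarrow> continuous_on {0..l} (\<lambda>x. u x t)"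
  using sol unfolding is_solution_def C2_on_def by (meson DERIV_continuous_on)

lemma F_cont: "continuous_on {0..T} F"
proof -
  have "continuous_on ({0..T} \<times> cbox 0 l) (\<lambda>(t, x). (f x t)\<^sup>2)"
    unfolding case_prod_beta
    by (intro continuous_on_power
          continuous_on_compose2[OF f_cont[unfolded closure_Q case_prod_beta], of _ "\<lambda>z. (snd z, fst z)", simplified])
       (auto intro!: continuous_intros)
  then have "continuous_on {0..T} (\<lambda>t. integral (cbox 0 l) (\<lambda>x. (f x t)\<^sup>2))"
    by (rule integral_continuous_on_param)
  then show ?thesis
    by (rule continuous_on_eq) (simp add: L2_norm_sq_eq_integral f_slice)
qed

text \<open>The equation expresses g(., s) through f, u and the second derivative of u, so
  \<open>R\<close> extends it continuously to the closed interval with one-sided derivatives at the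
  ends. Testing with \<open>u\<close>, the term in \<open>p\<close> has a favourable sign and the
  second derivative goes to Wirtinger's inequality.\<close>

lemma energy_slice:
  assumes s: "s \<in> {0..T}"
  obtains R where "continuous_on {0..l} R" "\<And>x. x \<in> {0<..<l} \<Longrightarrow> g x s = R x"
    "integral {0..l} (\<lambda>x. u x s * R x) \<le> l\<^sup>2 / (4 * pi\<^sup>2) * F s"
proof -
  have "C2_on 0 l (\<lambda>x. u x s)" using sol s by (simp add: is_solution_def)
  then obtain v' v'' where v:
      "\<And>x. x \<in> {0..l} \<Longrightarrow> ((\<lambda>x. u x s) has_real_derivative v' x) (at x within {0..l})"
      "\<And>x. x \<in> {0..l} \<Longrightarrow> (v' has_real_derivative v'' x) (at x within {0..l})"
    and cv: "continuous_on {0..l} v''"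
    unfolding C2_on_def by blast
  define R where "R x = f x s + v'' x - p s * u x s" for x
  note cu = u_slice[OF s] and cf = f_slice[OF s]
  have cR: "continuous_on {0..l} R" unfolding R_def using cu cf cv by (intro continuous_intros)
  have gR: "g x s = R x" if x: "x \<in> {0<..<l}" for x
  proof -
    have at: "at y within {0..l} = at y" if "y \<in> {0<..<l}" for y
      using that by (intro at_within_interior) (auto simp: interior_atLeastAtMost_real)
    have d: "deriv (\<lambda>y. u y s) y = v' y" if "y \<in> {0<..<l}" for y
      using v(1)[of y] that by (intro DERIV_imp_deriv) (auto simp: at)
    \<comment> \<open>The iterated \<open>deriv\<close> differentiates
      \<open>deriv (\<lambda>y. u y s)\<close>, so agreement with v' is required on a neighbourhood
      of \<open>x\<close>, not just at \<open>x\<close>.\<close>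
    have "(v' has_real_derivative v'' x) (at x)" using v(2)[of x] x by (auto simp: at)
    then have "(deriv (\<lambda>y. u y s) has_real_derivative v'' x) (at x)"
      by (rule has_field_derivative_transform_within_open[OF _ open_greaterThanLessThan x]) (simp add: d)
    then have "(deriv ^^ 2) (\<lambda>y. u y s) x = v'' x"
      by (simp add: numeral_2_eq_2 DERIV_imp_deriv)
    moreover have "g x s - (deriv ^^ 2) (\<lambda>y. u y s) x + p s * u x s = f x s"
      using sol x s by (auto simp: is_solution_def Q_def)
    ultimately show ?thesis by (simp add: R_def)
  qed
  define c where "c = pi / l"
  have "c > 0" using l by (simp add: c_def)
  \<comment> \<open>The Young constant paired with the weight c^2 on u^2, the most that Wirtinger's
    inequality can absorb; it equals l^2 / (4 pi^2).\<close>
  define K where "K = 1 / (4 * c\<^sup>2)"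
  have "integral {0..l} (\<lambda>x. u x s * R x) \<le>
      integral {0..l} (\<lambda>x. (u x s * v'' x + c\<^sup>2 * (u x s)\<^sup>2) + K * (f x s)\<^sup>2)"
  proof (rule integral_le)
    show "(\<lambda>x. u x s * R x) integrable_on {0..l}"
      "(\<lambda>x. (u x s * v'' x + c\<^sup>2 * (u x s)\<^sup>2) + K * (f x s)\<^sup>2) integrable_on {0..l}"
      by (intro integrable_continuous_real continuous_intros cu cf cv cR)+
    fix x
    have "0 \<le> (c * u x s - 1 / (2 * c) * f x s)\<^sup>2" by simp
    also have "\<dots> = c\<^sup>2 * (u x s)\<^sup>2 + K * (f x s)\<^sup>2 - u x s * f x s"
      using \<open>c > 0\<close> by (simp add: K_def power2_eq_square field_simps)
    finally have "u x s * f x s \<le> c\<^sup>2 * (u x s)\<^sup>2 + K * (f x s)\<^sup>2" by simp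
    moreover have "0 \<le> p s * (u x s)\<^sup>2" using p_nonneg[OF s] by simp
    moreover have "u x s * R x = u x s * f x s + u x s * v'' x - p s * (u x s)\<^sup>2"
      by (simp add: R_def power2_eq_square algebra_simps)
    ultimately show "u x s * R x \<le> (u x s * v'' x + c\<^sup>2 * (u x s)\<^sup>2) + K * (f x s)\<^sup>2"
      by linarith
  qed
  also have "\<dots> = integral {0..l} (\<lambda>x. u x s * v'' x + c\<^sup>2 * (u x s)\<^sup>2) + integral {0..l} (\<lambda>x. K * (f x s)\<^sup>2)"
    by (intro Henstock_Kurzweil_Integration.integral_add integrable_continuous_real continuous_intros cu cf cv)
  also have "\<dots> \<le> 0 + K * F s"
  proof (rule add_mono)
    show "integral {0..l} (\<lambda>x. u x s * v'' x + c\<^sup>2 * (u x s)\<^sup>2) \<le> 0"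
      unfolding c_def using Wirtinger_inequality[OF l v cv] boundary[OF s] by blast
    show "integral {0..l} (\<lambda>x. K * (f x s)\<^sup>2) \<le> K * F s"
      by (simp only: L2_norm_sq_eq_integral[OF cf] integral_mult_right)
  qed
  also have "0 + K * F s = l\<^sup>2 / (4 * pi\<^sup>2) * F s" by (simp add: K_def c_def power_divide)
  finally show thesis using that cR gR by blast
qed

text \<open>The time variable is clamped to \<open>[0, T]\<close>, which gives Caratheodory functions on the plane.\<close>

definition clamp_time :: "real \<Rightarrow> real" where "clamp_time t = max 0 (min T t)"
definition U :: "real \<Rightarrow> real \<Rightarrow> real" where "U x t = indicator {0<..<l} x * u x (clamp_time t)"
definition G :: "real \<Rightarrow> real \<Rightarrow> real" where "G x t = indicator {0<..<l} x * g x (clamp_time t)"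

lemma clamp_time: "clamp_time t \<in> {0..T}" "t \<in> {0..T} \<Longrightarrow> clamp_time t = t"
  using T by (auto simp: clamp_time_def)

lemma continuous_on_clamp_time:
  assumes "continuous_on {0..T} h"
  shows "continuous_on UNIV (\<lambda>t. h (clamp_time t))"
  by (rule continuous_on_compose2[OF assms]) (use clamp_time in \<open>auto simp: clamp_time_def intro!: continuous_intros\<close>)

text \<open>Continuity in time is given. For \<open>G\<close>, regularity in \<open>x\<close> is not
  part of the notion of solution; it comes from the equation through the continuous \<open>R\<close>
  of \<open>energy_slice\<close>.\<close>

lemma measurable_U_G [measurable]:
  "(\<lambda>(x, t). U x t) \<in> borel_measurable (borel \<Otimes>\<^sub>M borel)"
  "(\<lambda>(x, t). G x t) \<in> borel_measurable (borel \<Otimes>\<^sub>M borel)"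
proof -
  have slice: "(\<lambda>x. indicator {0<..<l} x * h x) \<in> borel_measurable borel" if "continuous_on {0..l} h" for h :: "real \<Rightarrow> real"
    using borel_measurable_continuous_on_indicator[of "{0<..<l}" h] continuous_on_subset[OF that, of "{0<..<l}"]
    by (simp add: greaterThanLessThan_subseteq_atLeastAtMost_iff)
  show "(\<lambda>(x, t). U x t) \<in> borel_measurable (borel \<Otimes>\<^sub>M borel)"
  proof (rule borel_measurable_Caratheodory)
    show "continuous_on UNIV (U x)" for x
    proof (cases "x \<in> {0<..<l}")
      case True
      then have "continuous_on {0..T} (u x)" by (intro abs_continuous_on_imp_continuous_on ac) auto
      then show ?thesis using True by (simp add: U_def[abs_def] continuous_on_clamp_time)
    qed (simp add: U_def[abs_def])
    show "(\<lambda>x. U x t) \<in> borel_measurable borel" for t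
      unfolding U_def using u_slice[OF clamp_time(1)] by (rule slice)
  qed
  show "(\<lambda>(x, t). G x t) \<in> borel_measurable (borel \<Otimes>\<^sub>M borel)"
  proof (rule borel_measurable_Caratheodory)
    show "continuous_on UNIV (G x)" for x
    proof (cases "x \<in> {0<..<l}")
      case True
      then have "continuous_on {0..T} (g x)" using cc[of x] by (auto simp: caputo_continuous_def)
      then show ?thesis using True by (simp add: G_def[abs_def] continuous_on_clamp_time)
    qed (simp add: G_def[abs_def])
    fix t
    obtain R where R: "continuous_on {0..l} R" "\<And>x. x \<in> {0<..<l} \<Longrightarrow> g x (clamp_time t) = R x"
      using energy_slice[OF clamp_time(1)] by blast
    have "(\<lambda>x. G x t) = (\<lambda>x. indicator {0<..<l} x * R x)"
      using R(2) by (auto simp: G_def indicator_def)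
    then show "(\<lambda>x. G x t) \<in> borel_measurable borel" using slice[OF R(1)] by simp
  qed
qed

lemma E_eq:
  assumes "t \<in> {0..T}"
  shows "integrable lborel (\<lambda>x. (U x t)\<^sup>2)" "E t = (LINT x|lborel. (U x t)\<^sup>2)"
proof -
  have eq: "indicator {0<..<l} x *\<^sub>R (u x t)\<^sup>2 = (U x t)\<^sup>2" for x
    using clamp_time(2)[OF assms] by (auto simp: U_def indicator_def)
  have "set_integrable lborel {0..l} (\<lambda>x. (u x t)\<^sup>2)"
    using u_slice[OF assms] by (intro set_integrable_continuous_Icc continuous_intros)
  then have "set_integrable lborel {0<..<l} (\<lambda>x. (u x t)\<^sup>2)"
    by (rule set_integrable_subset) auto
  then show "integrable lborel (\<lambda>x. (U x t)\<^sup>2)" by (simp only: set_integrable_def eq)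
  show "E t = (LINT x|lborel. (U x t)\<^sup>2)"
    by (simp only: L2_norm_sq_def power2_abs set_integral_Icc_eq_Ioo) (simp only: set_lebesgue_integral_def eq)
qed

lemma initial: "L2_norm_sq l \<phi> = E 0"
proof -
  have "x \<in> {0..l} \<Longrightarrow> \<phi> x = u x 0" for x using sol by (auto simp: is_solution_def)
  then show ?thesis unfolding L2_norm_sq_def by (intro set_lebesgue_integral_cong) auto
qed

end

lemma RL_integral_nonneg:
  assumes "\<alpha> > 0" "\<And>s. h s \<ge> 0"
  shows "RL_integral \<alpha> h t \<ge> 0"
  unfolding RL_integral_def set_lebesgue_integral_def using Gamma_real_pos[OF assms(1)] assms(2)
  by (intro mult_nonneg_nonneg Bochner_Integration.integral_nonneg) auto

lemma ennreal_RL_integral: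
  fixes h :: "real \<Rightarrow> real"
  assumes "\<alpha> > 0" "continuous_on {0..T} h" "t \<in> {0..T}" "\<And>s. s \<in> {0..T} \<Longrightarrow> h s \<ge> 0"
  shows "ennreal (RL_integral \<alpha> h t) =
    ennreal (1 / Gamma \<alpha>) * (\<integral>\<^sup>+s. ennreal (indicator {0<..<t} s * (t - s) powr (\<alpha> - 1)) * ennreal (h s) \<partial>lborel)"
proof -
  have int: "integrable lborel (\<lambda>s. indicator {0<..<t} s *\<^sub>R (h s / (t - s) powr (1 - \<alpha>)))"
    using set_integrable_RL_kernel_mult[OF assms(1,2), of t] assms(3) by (simp add: set_integrable_def)
  have eq: "ennreal (indicator {0<..<t} s *\<^sub>R (h s / (t - s) powr (1 - \<alpha>))) =
      ennreal (indicator {0<..<t} s * (t - s) powr (\<alpha> - 1)) * ennreal (h s)" for s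
  proof (cases "s \<in> {0<..<t}")
    case True
    then have "h s \<ge> 0" using assms(3,4) by auto
    then show ?thesis
      using True powr_minus_divide[of "t - s" "1 - \<alpha>"]
      by (simp add: ennreal_mult[symmetric])
  qed simp
  have "ennreal (RL_integral \<alpha> h t) =
      ennreal (1 / Gamma \<alpha>) * ennreal (LINT s|lborel. indicator {0<..<t} s *\<^sub>R (h s / (t - s) powr (1 - \<alpha>)))"
    unfolding RL_integral_def set_lebesgue_integral_def
    using Gamma_real_pos[OF assms(1)] by (intro ennreal_mult') auto
  also have "ennreal (LINT s|lborel. indicator {0<..<t} s *\<^sub>R (h s / (t - s) powr (1 - \<alpha>))) =
      (\<integral>\<^sup>+s. ennreal (indicator {0<..<t} s *\<^sub>R (h s / (t - s) powr (1 - \<alpha>))) \<partial>lborel)"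
    using assms(3,4) by (intro nn_integral_eq_integral[symmetric] int AE_I2) (auto simp: indicator_def)
  finally show ?thesis unfolding eq .
qed

lemma borel_measurable_nn_integral_RL_kernel:
  fixes W :: "real \<Rightarrow> ennreal"
  assumes [measurable]: "W \<in> borel_measurable borel"
  shows "(\<lambda>t. \<integral>\<^sup>+s. ennreal (indicator {0<..<t} s * (t - s) powr (\<alpha> - 1)) * W s \<partial>lborel) \<in> borel_measurable borel"
proof -
  have "(\<lambda>(t, s). (if 0 < s \<and> s < t then ennreal ((t - s) powr (\<alpha> - 1)) else 0) * W s) \<in> borel_measurable (borel \<Otimes>\<^sub>M lborel)"
    by measurable
  then have "(\<lambda>t. \<integral>\<^sup>+s. (if 0 < s \<and> s < t then ennreal ((t - s) powr (\<alpha> - 1)) else 0) * W s \<partial>lborel) \<in> borel_measurable borel"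
    by (rule lborel.borel_measurable_nn_integral)
  also have "(\<lambda>t. \<integral>\<^sup>+s. (if 0 < s \<and> s < t then ennreal ((t - s) powr (\<alpha> - 1)) else 0) * W s \<partial>lborel) =
     (\<lambda>t. \<integral>\<^sup>+s. ennreal (indicator {0<..<t} s * (t - s) powr (\<alpha> - 1)) * W s \<partial>lborel)"
    by (intro ext nn_integral_cong) (auto simp: indicator_def)
  finally show ?thesis .
qed

section \<open>Integrability in the plane, Fubini for almost every time, passage to every
  time\<close>

context Dirichlet_solution
begin

lemma U_slice_measurable [measurable]: "U x \<in> borel_measurable borel" "(\<lambda>x. U x t) \<in> borel_measurable borel"
  and G_slice_measurable [measurable]: "G x \<in> borel_measurable borel" "(\<lambda>x. G x t) \<in> borel_measurable borel"
proof -
  have fst: "(\<lambda>t. h x t) \<in> borel_measurable borel" and snd: "(\<lambda>x. h x t) \<in> borel_measurable borel"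
    if h [measurable]: "(\<lambda>(x, t). h x t) \<in> borel_measurable (borel \<Otimes>\<^sub>M borel)"
    for h :: "real \<Rightarrow> real \<Rightarrow> real"
  proof -
    have "(\<lambda>t. case (x, t) of (x, t) \<Rightarrow> h x t) \<in> borel_measurable borel"
      "(\<lambda>x. case (x, t) of (x, t) \<Rightarrow> h x t) \<in> borel_measurable borel"
      by (rule measurable_compose[OF _ h]; measurable)+
    then show "(\<lambda>t. h x t) \<in> borel_measurable borel" "(\<lambda>x. h x t) \<in> borel_measurable borel" by simp_all
  qed
  show "U x \<in> borel_measurable borel" "(\<lambda>x. U x t) \<in> borel_measurable borel"
    "G x \<in> borel_measurable borel" "(\<lambda>x. G x t) \<in> borel_measurable borel"
    using fst snd measurable_U_G by blast+
qed

text \<open>Here \<open>caputo_square_integrable\<close> enters, turned into an iterated integral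
  that later steps can dominate slice by slice.\<close>

lemma G_power2_finite:
  "(\<integral>\<^sup>+x. \<integral>\<^sup>+t. indicator {0<..<T} t * ennreal ((G x t)\<^sup>2) \<partial>lborel \<partial>lborel) < \<infinity>"
proof -
  define h where "h = (\<lambda>z. indicator (Q l T) z *\<^sub>R (case z of (x, t) \<Rightarrow> (g x t)\<^sup>2))"
  have h: "integrable (lborel \<Otimes>\<^sub>M lborel) h"
    using sq_int by (simp add: caputo_square_integrable_def set_integrable_def h_def lborel_prod)
  then have [measurable]: "h \<in> borel_measurable (lborel \<Otimes>\<^sub>M lborel)" by (rule borel_measurable_integrable)
  have "(\<integral>\<^sup>+x. \<integral>\<^sup>+t. indicator {0<..<T} t * ennreal ((G x t)\<^sup>2) \<partial>lborel \<partial>lborel)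
      \<le> (\<integral>\<^sup>+x. \<integral>\<^sup>+t. ennreal (norm (h (x, t))) \<partial>lborel \<partial>lborel)"
    by (intro nn_integral_mono) (auto simp: h_def G_def Q_def indicator_def clamp_time(2))
  also have "\<dots> = (\<integral>\<^sup>+z. ennreal (norm (h z)) \<partial>(lborel \<Otimes>\<^sub>M lborel))"
    by (rule lborel.nn_integral_fst) measurable
  also have "\<dots> < \<infinity>" using h by (simp add: integrable_iff_bounded)
  finally show ?thesis .
qed

text \<open>For fixed \<open>x\<close>, u^2 is at most 2 u(x, 0)^2 plus a multiple of I^\<alpha>
  (g^2). Integrating in \<open>t\<close> uses the L^1 bound for I^\<alpha>; integrating in
  \<open>x\<close> uses finiteness of the initial energy and of the integral of g^2.\<close>

lemma U_power2_finite:
  "(\<integral>\<^sup>+x. \<integral>\<^sup>+t. indicator {0<..<T} t * ennreal ((U x t)\<^sup>2) \<partial>lborel \<partial>lborel) < \<infinity>"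
proof -
  define C where "C = 2 * (T powr \<alpha> / (\<alpha> * Gamma \<alpha>))"
  have "C \<ge> 0" using \<alpha> Gamma_real_pos[of \<alpha>] by (simp add: C_def)
  define D where "D = ennreal C * (ennreal (1 / Gamma \<alpha>) * ennreal (T powr \<alpha> / \<alpha>))"
  have "D < \<infinity>" by (simp add: D_def ennreal_mult_less_top)
  define I where "I x = (\<integral>\<^sup>+t. indicator {0<..<T} t * ennreal ((G x t)\<^sup>2) \<partial>lborel)" for x
  have [measurable]: "I \<in> borel_measurable borel"
    unfolding I_def[abs_def] by (intro lborel.borel_measurable_nn_integral) measurable
  have "(\<integral>\<^sup>+t. indicator {0<..<T} t * ennreal ((U x t)\<^sup>2) \<partial>lborel)
      \<le> ennreal (2 * T) * ennreal ((U x 0)\<^sup>2) + D * I x" for x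
  proof (cases "x \<in> {0<..<l}")
    case False
    then show ?thesis by (simp add: U_def)
  next
    case True
    then have x: "x \<in> {0..l}" by auto
    have cg: "continuous_on {0..T} (\<lambda>s. (g x s)\<^sup>2)"
      using cc[OF x] by (auto simp: caputo_continuous_def intro!: continuous_intros)
    define J where "J t = (\<integral>\<^sup>+s. ennreal (indicator {0<..<t} s * (t - s) powr (\<alpha> - 1)) * ennreal ((G x s)\<^sup>2) \<partial>lborel)" for t
    have [measurable]: "J \<in> borel_measurable borel"
      unfolding J_def[abs_def] by (intro borel_measurable_nn_integral_RL_kernel) measurable
    have pt: "indicator {0<..<T} t * ennreal ((U x t)\<^sup>2)
        \<le> indicator {0<..<T} t * ennreal (2 * (U x 0)\<^sup>2) + ennreal C * (ennreal (1 / Gamma \<alpha>) * (indicator {0<..<T} t * J t))" for t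
    proof (cases "t \<in> {0<..<T}")
      case False
      then show ?thesis by simp
    next
      case t: True
      then have t': "t \<in> {0..T}" by auto
      have "(u x t)\<^sup>2 \<le> 2 * (u x 0)\<^sup>2 + C * RL_integral \<alpha> (\<lambda>s. (g x s)\<^sup>2) t"
        unfolding C_def by (rule power2_le_RL_integral_caputo_power2[OF \<alpha> ac[OF x] cc[OF x] t'])
      then have "ennreal ((u x t)\<^sup>2) \<le> ennreal (2 * (u x 0)\<^sup>2 + C * RL_integral \<alpha> (\<lambda>s. (g x s)\<^sup>2) t)"
        by (rule ennreal_leI)
      also have "\<dots> = ennreal (2 * (u x 0)\<^sup>2) + ennreal (C * RL_integral \<alpha> (\<lambda>s. (g x s)\<^sup>2) t)"
        using \<open>C \<ge> 0\<close> RL_integral_nonneg[OF \<alpha>(1), of "\<lambda>s. (g x s)\<^sup>2" t] by (intro ennreal_plus) auto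
      also have "ennreal (C * RL_integral \<alpha> (\<lambda>s. (g x s)\<^sup>2) t) = ennreal C * ennreal (RL_integral \<alpha> (\<lambda>s. (g x s)\<^sup>2) t)"
        using \<open>C \<ge> 0\<close> by (rule ennreal_mult')
      also have "ennreal (RL_integral \<alpha> (\<lambda>s. (g x s)\<^sup>2) t) = ennreal (1 / Gamma \<alpha>) * J t"
      proof -
        have "(\<integral>\<^sup>+s. ennreal (indicator {0<..<t} s * (t - s) powr (\<alpha> - 1)) * ennreal ((g x s)\<^sup>2) \<partial>lborel) = J t"
          unfolding J_def
        proof (rule nn_integral_cong)
          show "ennreal (indicator {0<..<t} s * (t - s) powr (\<alpha> - 1)) * ennreal ((g x s)\<^sup>2) =
              ennreal (indicator {0<..<t} s * (t - s) powr (\<alpha> - 1)) * ennreal ((G x s)\<^sup>2)" for s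
            using t True by (cases "s \<in> {0<..<t}") (simp_all add: G_def clamp_time(2))
        qed
        then show ?thesis using ennreal_RL_integral[OF \<alpha>(1) cg t' zero_le_power2] by simp
      qed
      finally show ?thesis using t True T by (simp add: U_def clamp_time(2))
    qed
    have "(\<integral>\<^sup>+t. indicator {0<..<T} t * ennreal ((U x t)\<^sup>2) \<partial>lborel)
      \<le> (\<integral>\<^sup>+t. indicator {0<..<T} t * ennreal (2 * (U x 0)\<^sup>2) + ennreal C * (ennreal (1 / Gamma \<alpha>) * (indicator {0<..<T} t * J t)) \<partial>lborel)"
      by (intro nn_integral_mono pt)
    also have "\<dots> = (\<integral>\<^sup>+t. indicator {0<..<T} t * ennreal (2 * (U x 0)\<^sup>2) \<partial>lborel) +
        ennreal C * (ennreal (1 / Gamma \<alpha>) * (\<integral>\<^sup>+t. indicator {0<..<T} t * J t \<partial>lborel))"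
      by (subst nn_integral_add) (auto simp: nn_integral_cmult)
    also have "(\<integral>\<^sup>+t. indicator {0<..<T} t * ennreal (2 * (U x 0)\<^sup>2) \<partial>lborel) = ennreal (2 * T) * ennreal ((U x 0)\<^sup>2)"
      using T by (subst nn_integral_multc) (auto simp: ennreal_mult[symmetric] mult.assoc mult.left_commute)
    also have "(\<integral>\<^sup>+t. indicator {0<..<T} t * J t \<partial>lborel) \<le> ennreal (T powr \<alpha> / \<alpha>) * I x"
      unfolding J_def I_def using \<alpha> T by (intro nn_integral_RL_kernel_le) auto
    finally show ?thesis
      by (simp add: D_def mult.assoc mult_left_mono add_left_mono)
  qed
  then have "(\<integral>\<^sup>+x. \<integral>\<^sup>+t. indicator {0<..<T} t * ennreal ((U x t)\<^sup>2) \<partial>lborel \<partial>lborel)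
      \<le> (\<integral>\<^sup>+x. ennreal (2 * T) * ennreal ((U x 0)\<^sup>2) + D * I x \<partial>lborel)"
    by (intro nn_integral_mono)
  also have "\<dots> = ennreal (2 * T) * (\<integral>\<^sup>+x. ennreal ((U x 0)\<^sup>2) \<partial>lborel) + D * (\<integral>\<^sup>+x. I x \<partial>lborel)"
    by (subst nn_integral_add) (auto simp: nn_integral_cmult)
  also have "\<dots> < \<infinity>"
  proof -
    have "(\<integral>\<^sup>+x. ennreal ((U x 0)\<^sup>2) \<partial>lborel) < \<infinity>"
      using E_eq(1)[of 0] T by (simp add: integrable_iff_bounded)
    moreover have "(\<integral>\<^sup>+x. I x \<partial>lborel) < \<infinity>" unfolding I_def by (rule G_power2_finite)
    ultimately show ?thesis using \<open>D < \<infinity>\<close> by (simp add: ennreal_mult_less_top)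
  qed
  finally show ?thesis .
qed

text \<open>The L^1 norm in \<open>x\<close> of u g at time \<open>s\<close>. Up to a Gamma factor
  \<open>RL_W t\<close> is its Riemann-Liouville integral, and its finiteness is exactly the Fubini
  condition at time \<open>t\<close>.\<close>

definition W :: "real \<Rightarrow> ennreal" where "W s = (\<integral>\<^sup>+x. ennreal \<bar>U x s * G x s\<bar> \<partial>lborel)"

lemma W_measurable [measurable]: "W \<in> borel_measurable borel"
proof -
  have "(\<lambda>(s, x). ennreal \<bar>U x s * G x s\<bar>) \<in> borel_measurable (borel \<Otimes>\<^sub>M lborel)" by measurable
  then show ?thesis unfolding W_def[abs_def] by (rule lborel.borel_measurable_nn_integral)
qed

lemma W_finite: "(\<integral>\<^sup>+s. indicator {0<..<T} s * W s \<partial>lborel) < \<infinity>"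
proof -
  have "(\<integral>\<^sup>+s. indicator {0<..<T} s * W s \<partial>lborel)
      = (\<integral>\<^sup>+s. \<integral>\<^sup>+x. indicator {0<..<T} s * ennreal \<bar>U x s * G x s\<bar> \<partial>lborel \<partial>lborel)"
    unfolding W_def by (intro nn_integral_cong nn_integral_cmult[symmetric]) measurable
  also have "\<dots> = (\<integral>\<^sup>+x. \<integral>\<^sup>+s. indicator {0<..<T} s * ennreal \<bar>U x s * G x s\<bar> \<partial>lborel \<partial>lborel)"
    by (rule lborel_pair.Fubini') measurable
  also have "\<dots> \<le> (\<integral>\<^sup>+x. \<integral>\<^sup>+s. indicator {0<..<T} s * ennreal ((U x s)\<^sup>2) + indicator {0<..<T} s * ennreal ((G x s)\<^sup>2) \<partial>lborel \<partial>lborel)"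
  proof (intro nn_integral_mono)
    fix x s :: real
    have "2 * (\<bar>U x s\<bar> * \<bar>G x s\<bar>) \<le> (U x s)\<^sup>2 + (G x s)\<^sup>2"
      using sum_squares_bound[of "\<bar>U x s\<bar>" "\<bar>G x s\<bar>"] by (simp add: mult.assoc)
    moreover have "0 \<le> \<bar>U x s\<bar> * \<bar>G x s\<bar>" by simp
    ultimately have "\<bar>U x s * G x s\<bar> \<le> (U x s)\<^sup>2 + (G x s)\<^sup>2" unfolding abs_mult by linarith
    then have "ennreal \<bar>U x s * G x s\<bar> \<le> ennreal ((U x s)\<^sup>2) + ennreal ((G x s)\<^sup>2)"
      by (simp add: ennreal_plus[symmetric] del: ennreal_plus)
    then show "indicator {0<..<T} s * ennreal \<bar>U x s * G x s\<bar>
        \<le> indicator {0<..<T} s * ennreal ((U x s)\<^sup>2) + indicator {0<..<T} s * ennreal ((G x s)\<^sup>2)"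
      unfolding distrib_left[symmetric] by (rule mult_left_mono) simp
  qed
  also have "\<dots> = (\<integral>\<^sup>+x. (\<integral>\<^sup>+s. indicator {0<..<T} s * ennreal ((U x s)\<^sup>2) \<partial>lborel) +
      (\<integral>\<^sup>+s. indicator {0<..<T} s * ennreal ((G x s)\<^sup>2) \<partial>lborel) \<partial>lborel)"
    by (intro nn_integral_cong nn_integral_add) measurable
  also have "\<dots> = (\<integral>\<^sup>+x. \<integral>\<^sup>+s. indicator {0<..<T} s * ennreal ((U x s)\<^sup>2) \<partial>lborel \<partial>lborel) +
      (\<integral>\<^sup>+x. \<integral>\<^sup>+s. indicator {0<..<T} s * ennreal ((G x s)\<^sup>2) \<partial>lborel \<partial>lborel)"
    by (intro nn_integral_add lborel.borel_measurable_nn_integral) measurable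
  also have "\<dots> < \<infinity>" using U_power2_finite G_power2_finite by simp
  finally show ?thesis .
qed

abbreviation RL_W :: "real \<Rightarrow> ennreal" where
  "RL_W t \<equiv> (\<integral>\<^sup>+s. ennreal (indicator {0<..<t} s * (t - s) powr (\<alpha> - 1)) * W s \<partial>lborel)"

text \<open>\<open>W\<close> is known only to be integrable over (0, T), and I^\<alpha> of such a
  function is again integrable but may be infinite at single times; this is the origin of the
  exceptional times.\<close>

lemma AE_RL_W_finite: "AE t in lborel. t \<in> {0<..<T} \<longrightarrow> RL_W t < \<infinity>"
proof -
  have "(\<integral>\<^sup>+t. indicator {0<..<T} t * RL_W t \<partial>lborel)
     \<le> ennreal (T powr \<alpha> / \<alpha>) * (\<integral>\<^sup>+s. indicator {0<..<T} s * W s \<partial>lborel)"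
    using \<alpha> T by (intro nn_integral_RL_kernel_le) auto
  also have "\<dots> < \<infinity>" using W_finite by (simp add: ennreal_mult_less_top)
  finally have fin: "(\<integral>\<^sup>+t. indicator {0<..<T} t * RL_W t \<partial>lborel) < \<infinity>" .
  have m: "(\<lambda>t. indicator {0<..<T} t * RL_W t) \<in> borel_measurable lborel"
    using borel_measurable_nn_integral_RL_kernel[OF W_measurable] by measurable
  have "AE t in lborel. indicator {0<..<T} t * RL_W t \<noteq> \<infinity>"
    by (rule nn_integral_noteq_infinite[OF m]) (use fin in simp)
  then show ?thesis
    by (rule AE_mp, intro AE_I2 impI) (simp add: less_top)
qed

text \<open>\<open>A\<close> bounds the integral of \<open>H\<close> over \<open>s\<close> from
  below for each \<open>x\<close>, \<open>B\<close> bounds its integral over \<open>x\<close> from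
  above for each \<open>s\<close>. Fubini equates the two iterated integrals, so the energy
  increment is at most the forcing term.\<close>

lemma estimate_if_RL_W_finite:
  assumes t: "t \<in> {0<..<T}" and fin: "RL_W t < \<infinity>"
  shows "E t \<le> E 0 + l\<^sup>2 / (2 * pi\<^sup>2) * RL_integral \<alpha> F t"
proof -
  have t': "t \<in> {0..T}" "t \<in> {0<..T}" "0 \<in> {0..T}" using t T by auto
  have \<Gamma>: "Gamma \<alpha> > 0" using \<alpha> by (simp add: Gamma_real_pos)
  define k where "k s = indicator {0<..<t} s * (t - s) powr (\<alpha> - 1)" for s
  have [measurable]: "k \<in> borel_measurable borel" unfolding k_def[abs_def] by measurable
  have k: "k s \<ge> 0" for s by (simp add: k_def)
  have k_eq: "k s * a = indicator {0<..<t} s *\<^sub>R (a / (t - s) powr (1 - \<alpha>))" for s a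
    using powr_minus_divide[of "t - s" "1 - \<alpha>"] by (simp add: k_def)
  define H where "H x s = k s * (U x s * G x s)" for x s
  have [measurable]: "(\<lambda>(x, s). H x s) \<in> borel_measurable (lborel \<Otimes>\<^sub>M lborel)"
    unfolding H_def by measurable
  have "integrable (lborel \<Otimes>\<^sub>M lborel) (\<lambda>(x, s). H x s)"
  proof (rule integrableI_bounded)
    have "(\<integral>\<^sup>+z. ennreal (norm (case z of (x, s) \<Rightarrow> H x s)) \<partial>(lborel \<Otimes>\<^sub>M lborel)) =
        (\<integral>\<^sup>+s. \<integral>\<^sup>+x. ennreal (norm (H x s)) \<partial>lborel \<partial>lborel)"
      by (subst lborel_pair.nn_integral_snd[symmetric]) auto
    also have "\<dots> = (\<integral>\<^sup>+s. \<integral>\<^sup>+x. ennreal (k s) * ennreal \<bar>U x s * G x s\<bar> \<partial>lborel \<partial>lborel)"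
      using k by (intro nn_integral_cong) (simp add: H_def abs_mult ennreal_mult')
    also have "\<dots> = RL_W t"
      unfolding W_def k_def by (intro nn_integral_cong nn_integral_cmult) measurable
    finally show "(\<integral>\<^sup>+z. ennreal (norm (case z of (x, s) \<Rightarrow> H x s)) \<partial>(lborel \<Otimes>\<^sub>M lborel)) < \<infinity>"
      using fin by simp
  qed measurable
  note HI = this
  \<comment> \<open>The time inequality along a fixed \<open>x\<close>, with Gamma \<alpha> cleared
    since \<open>H\<close> carries the bare kernel.\<close>
  have A: "Gamma \<alpha> / 2 * ((U x t)\<^sup>2 - (U x 0)\<^sup>2) \<le> (LINT s|lborel. H x s)" for x
  proof (cases "x \<in> {0<..<l}")
    case False
    then show ?thesis by (simp add: U_def H_def)
  next
    case True
    then have x: "x \<in> {0..l}" by auto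
    have "(LINT s|lborel. H x s) = (LINT s:{0<..<t}|lborel. (u x s * g x s) / (t - s) powr (1 - \<alpha>))"
      unfolding set_lebesgue_integral_def H_def k_eq
      using True t by (intro Bochner_Integration.integral_cong) (auto simp: U_def G_def indicator_def clamp_time(2))
    also have "\<dots> = Gamma \<alpha> * RL_integral \<alpha> (\<lambda>s. u x s * g x s) t"
      using \<Gamma> by (simp add: RL_integral_def)
    also have "\<dots> \<ge> Gamma \<alpha> * (((u x t)\<^sup>2 - (u x 0)\<^sup>2) / 2)"
      using \<Gamma> power2_le_RL_integral_mult_caputo[OF \<alpha> ac[OF x] cc[OF x] t'(2)] by (intro mult_left_mono) auto
    finally show ?thesis using True t' by (simp add: U_def clamp_time(2))
  qed
  \<comment> \<open>The space inequality at a fixed \<open>s\<close>, multiplied by the nonnegative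
    number \<open>k s\<close>; inside the interval \<open>R\<close> replaces
    \<open>g\<close>.\<close>
  have B: "(LINT x|lborel. H x s) \<le> indicator {0<..<t} s *\<^sub>R (l\<^sup>2 / (4 * pi\<^sup>2) * F s / (t - s) powr (1 - \<alpha>))" for s
  proof (cases "s \<in> {0<..<t}")
    case False
    then show ?thesis by (simp add: H_def k_def)
  next
    case True
    then have s: "s \<in> {0..T}" using t by auto
    obtain R where R: "continuous_on {0..l} R" "\<And>x. x \<in> {0<..<l} \<Longrightarrow> g x s = R x"
      "integral {0..l} (\<lambda>x. u x s * R x) \<le> l\<^sup>2 / (4 * pi\<^sup>2) * F s"
      using energy_slice[OF s] by blast
    have "(LINT x|lborel. H x s) = k s * (LINT x|lborel. U x s * G x s)"
      unfolding H_def by (rule integral_mult_right_zero)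
    also have "(LINT x|lborel. U x s * G x s) = (LINT x:{0<..<l}|lborel. u x s * R x)"
      unfolding set_lebesgue_integral_def using R(2) clamp_time(2)[OF s]
      by (intro Bochner_Integration.integral_cong) (auto simp: U_def G_def indicator_def)
    also have "\<dots> = integral {0..l} (\<lambda>x. u x s * R x)"
      unfolding set_integral_Icc_eq_Ioo[symmetric]
      using u_slice[OF s] R(1)
      by (intro set_borel_integral_eq_integral(2) set_integrable_continuous_Icc continuous_intros)
    also have "k s * integral {0..l} (\<lambda>x. u x s * R x) \<le> k s * (l\<^sup>2 / (4 * pi\<^sup>2) * F s)"
      using R(3) k by (intro mult_left_mono) auto
    finally show ?thesis unfolding k_eq .
  qed
  have F_int: "set_integrable lborel {0<..<t} (\<lambda>s. l\<^sup>2 / (4 * pi\<^sup>2) * F s / (t - s) powr (1 - \<alpha>))"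
    using t by (intro set_integrable_RL_kernel_mult[OF \<alpha>(1), of T] continuous_on_mult F_cont continuous_on_const) auto
  have "Gamma \<alpha> / 2 * (E t - E 0) = (LINT x|lborel. Gamma \<alpha> / 2 * ((U x t)\<^sup>2 - (U x 0)\<^sup>2))"
    unfolding E_eq(2)[OF t'(1)] E_eq(2)[OF t'(3)]
    using E_eq(1)[OF t'(1)] E_eq(1)[OF t'(3)] by simp
  also have "\<dots> \<le> (LINT x|lborel. LINT s|lborel. H x s)"
    using E_eq(1)[OF t'(1)] E_eq(1)[OF t'(3)] A
    by (intro Bochner_Integration.integral_mono lborel_pair.integrable_fst[OF HI]) auto
  also have "\<dots> = (LINT s|lborel. LINT x|lborel. H x s)"
    by (rule lborel_pair.Fubini_integral[OF HI, symmetric])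
  also have "\<dots> \<le> (LINT s:{0<..<t}|lborel. l\<^sup>2 / (4 * pi\<^sup>2) * F s / (t - s) powr (1 - \<alpha>))"
    unfolding set_lebesgue_integral_def
    using F_int B
    by (intro Bochner_Integration.integral_mono lborel_pair.integrable_snd[OF HI]) (auto simp: set_integrable_def)
  also have "\<dots> = l\<^sup>2 / (4 * pi\<^sup>2) * (LINT s:{0<..<t}|lborel. F s / (t - s) powr (1 - \<alpha>))"
    unfolding times_divide_eq_right[symmetric] by (rule set_integral_mult_right)
  also have "\<dots> = Gamma \<alpha> / 2 * (l\<^sup>2 / (2 * pi\<^sup>2) * RL_integral \<alpha> F t)"
    using \<Gamma> by (simp add: RL_integral_def)
  finally have "E t - E 0 \<le> l\<^sup>2 / (2 * pi\<^sup>2) * RL_integral \<alpha> F t"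
    using \<Gamma> by (simp only: mult_le_cancel_left_pos half_gt_zero)
  then show ?thesis by simp
qed

text \<open>The good times have full measure, so they accumulate at \<open>t\<close> from the left,
  also for t = T. The right side is continuous along them, and Fatou with continuity of each
  \<open>u x\<close> gives lower semicontinuity of the energy.\<close>

lemma estimate_pos:
  assumes t: "t \<in> {0<..T}"
  shows "E t \<le> E 0 + l\<^sup>2 / (2 * pi\<^sup>2) * RL_integral \<alpha> F t"
proof -
  let ?B = "\<lambda>t. E 0 + l\<^sup>2 / (2 * pi\<^sup>2) * RL_integral \<alpha> F t"
  have t': "t \<in> {0..T}" using t by auto
  \<comment> \<open>With \<open>Suc n\<close> the left end of the interval is at least 0 even for n
    = 0, so every chosen time is positive.\<close>
  have "\<exists>\<tau>. \<tau> \<in> {t - t / real (Suc n)<..<t} \<and> E \<tau> \<le> ?B \<tau>" for n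
  proof -
    have "t - t / real (Suc n) < t" using t by simp
    then obtain \<tau> where \<tau>: "\<tau> \<in> {t - t / real (Suc n)<..<t}" "\<tau> \<in> {0<..<T} \<longrightarrow> RL_W \<tau> < \<infinity>"
      using AE_lborel_Ioo_exists[OF AE_RL_W_finite] by blast
    have "t / real (Suc n) \<le> t / 1" using t by (intro divide_left_mono) auto
    then have "\<tau> \<in> {0<..<T}" using \<tau>(1) t by auto
    then show ?thesis using \<tau> estimate_if_RL_W_finite by blast
  qed
  then obtain \<tau> where \<tau>: "\<And>n. \<tau> n \<in> {t - t / real (Suc n)<..<t}" "\<And>n. E (\<tau> n) \<le> ?B (\<tau> n)" by metis
  have "\<tau> \<longlonglongrightarrow> t"
  proof (rule tendsto_sandwich)
    show "(\<lambda>n. t - t / real (Suc n)) \<longlonglongrightarrow> t" by real_asymp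
    show "\<forall>\<^sub>F n in sequentially. t - t / real (Suc n) \<le> \<tau> n" "\<forall>\<^sub>F n in sequentially. \<tau> n \<le> t"
      using \<tau>(1) by (auto intro!: always_eventually less_imp_le simp del: of_nat_Suc)
  qed auto
  have \<tau>_in: "0 \<le> \<tau> n \<and> \<tau> n \<le> t" for n
  proof -
    have "t / real (Suc n) \<le> t / 1" using t by (intro divide_left_mono) auto
    then show ?thesis using \<tau>(1)[of n] by auto
  qed
  then have \<tau>_in': "\<tau> n \<in> {0..T}" for n using t by (meson atLeastAtMost_iff greaterThanAtMost_iff order_trans)
  have E_nn: "ennreal (E s) = (\<integral>\<^sup>+x. ennreal ((U x s)\<^sup>2) \<partial>lborel)" if "s \<in> {0..T}" for s
    using E_eq[OF that] by (simp add: nn_integral_eq_integral)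
  have Ulim: "(\<lambda>n. ennreal ((U x (\<tau> n))\<^sup>2)) \<longlonglongrightarrow> ennreal ((U x t)\<^sup>2)" for x
  proof (cases "x \<in> {0<..<l}")
    case False
    then show ?thesis by (simp add: U_def)
  next
    case True
    then have "continuous_on {0..T} (u x)" by (intro abs_continuous_on_imp_continuous_on ac) auto
    then have "isCont (U x) t"
      using continuous_on_clamp_time[of "u x"] True
      by (simp add: U_def[abs_def] continuous_on_eq_continuous_at)
    then have "(\<lambda>n. U x (\<tau> n)) \<longlonglongrightarrow> U x t" using \<open>\<tau> \<longlonglongrightarrow> t\<close> by (rule isCont_tendsto_compose)
    then show ?thesis by (intro tendsto_ennrealI tendsto_power)
  qed
  have "(\<lambda>n. RL_integral \<alpha> F (\<tau> n)) \<longlonglongrightarrow> RL_integral \<alpha> F t"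
    using RL_integral_tendsto_left[OF \<alpha>(1) F_cont _ _ \<tau>_in \<open>\<tau> \<longlonglongrightarrow> t\<close>] t by simp
  then have Blim: "(\<lambda>n. ennreal (?B (\<tau> n))) \<longlonglongrightarrow> ennreal (?B t)"
    by (intro tendsto_ennrealI tendsto_add tendsto_mult_left tendsto_const)
  have "ennreal (E t) = (\<integral>\<^sup>+x. liminf (\<lambda>n. ennreal ((U x (\<tau> n))\<^sup>2)) \<partial>lborel)"
    unfolding E_nn[OF t'] using lim_imp_Liminf[OF _ Ulim] by simp
  also have "\<dots> \<le> liminf (\<lambda>n. \<integral>\<^sup>+x. ennreal ((U x (\<tau> n))\<^sup>2) \<partial>lborel)"
    by (rule nn_integral_liminf) measurable
  also have "\<dots> \<le> liminf (\<lambda>n. ennreal (?B (\<tau> n)))"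
    using \<tau>(2) by (intro Liminf_mono always_eventually allI) (simp only: E_nn[OF \<tau>_in', symmetric] ennreal_leI)
  also have "\<dots> = ennreal (?B t)" using Blim by (intro lim_imp_Liminf) auto
  finally have "ennreal (E t) \<le> ennreal (?B t)" .
  moreover have "0 \<le> ?B t"
  proof -
    have "F s \<ge> 0" "E s \<ge> 0" for s
      unfolding L2_norm_sq_def set_lebesgue_integral_def by (intro Bochner_Integration.integral_nonneg; simp)+
    moreover from this have "RL_integral \<alpha> F t \<ge> 0" by (intro RL_integral_nonneg \<alpha>)
    ultimately show ?thesis by simp
  qed
  ultimately show ?thesis by (simp add: ennreal_le_iff)
qed

end

theorem theorem3p1:
  fixes l T \<alpha> :: real
    and p \<phi> :: "real \<Rightarrow> real"
    and f u :: "real \<Rightarrow> real \<Rightarrow> real"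
  assumes "l > 0" and "T > 0" and "0 < \<alpha>" and "\<alpha> < 1"
    and "continuous_on {0..T} p" and "\<And>t. t \<in> {0..T} \<Longrightarrow> p t \<ge> 0"
    and "continuous_on (closure (Q l T)) (\<lambda>(x, t). f x t)"
    and "is_solution l T \<alpha> p f \<phi> u"
    and "caputo_square_integrable l T \<alpha> u"
  shows "\<forall>t\<in>{0..T}. L2_norm_sq l (\<lambda>x. u x t) \<le>
           L2_norm_sq l \<phi> + l\<^sup>2 / (2 * pi\<^sup>2) * RL_integral \<alpha> (\<lambda>s. L2_norm_sq l (\<lambda>x. f x s)) t"
proof
  interpret Dirichlet_solution l T \<alpha> p \<phi> f u
    using assms by unfold_locales
  fix t assume "t \<in> {0..T}"
  \<comment> \<open>At t = 0 there are no times to the left to approach from; there the fractional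
    integral is over an empty interval and the estimate is an equality.\<close>
  then consider "t = 0" | "t \<in> {0<..T}" by fastforce
  then show "L2_norm_sq l (\<lambda>x. u x t) \<le>
      L2_norm_sq l \<phi> + l\<^sup>2 / (2 * pi\<^sup>2) * RL_integral \<alpha> (\<lambda>s. L2_norm_sq l (\<lambda>x. f x s)) t"
  proof cases
    case 1
    then show ?thesis by (simp add: initial RL_integral_def set_lebesgue_integral_def)
  next
    case 2
    then show ?thesis unfolding initial by (rule estimate_pos)
  qed
qed

end
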